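(* Let $h \geq 2$ be an integer and let $\mathcal{N}_h(x)$ be the set of $h$-full natural numbers $n \leq x$. Then for $x > 2$, $$\sum_{n \in \mathcal{N}_h(x)} (\omega(n) - \log \log n)^2 = \gamma_{0,h} x^{1/h} \log \log x + D_2 \gamma_{0,h} x^{1/h} + O_h \left( \frac{x^{1/h} \log \log x}{\log x} \right).$$ Moreover, let $g(x)$ be an increasing function with $g(x) \to \infty$ as $x \to \infty$. Then the number of $n \in \mathcal{N}_h(x)$ such that $$\frac{|\omega(n) - \log \log n|}{\sqrt{\log \log n}} \geq g(x)$$ is $o(|\mathcal{N}_h(x)|)$ as $x \to \infty$. As a consequence, $\omega(n)$ has normal order $\log \log n$ over $h$-full numbers.
   Context: For a natural number $n$, $\omega(n)$ denotes the number of distinct prime factors of $n$. A natural number $n = p_1^{s_1}\cdots p_r^{s_r}$ (distinct primes $p_i$) is $h$-full if $s_i \geq h$ for all $i$. All sums and products over $p$ run over primes; $\zeta$ is the Riemann zeta function; $B_1 = \gamma + \sum_p(\log(1-1/p) + 1/p)$ is the Mertens constant. Define $\gamma_{0,h} := \prod_p \left( 1 + \frac{p - p^{1/h}}{p^2 (p^{1/h}-1)} \right)$; for real $r>h$, $\mathcal{L}_h(r) := \sum_p \frac{1}{p^{(r/h)-1}(p - p^{1-1/h} + 1)}$; $D_1 := B_1 - \log h + \mathcal{L}_h(h+1) - \mathcal{L}_h(2h)$; $D_2 := D_1^2 + D_1 - \zeta(2) - \sum_p \left( \frac{1}{p - p^{1-1/h}+1}\right)^2$. For $S \subseteq \mathbb{N}$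 with $S(x) = \{n \in S : n \leq x\}$, and functions $f, F: S \to \mathbb{R}_{\geq 0}$ with $F$ non-decreasing, $f$ has normal order $F$ over $S$ if for every $\epsilon > 0$ the number of $n \in S(x)$ failing $(1-\epsilon)F(n) \leq f(n) \leq (1+\epsilon)F(n)$ is $o(|S(x)|)$ as $x \to \infty$. $O_h$ means the implied constant depends only on $h$.
   Formalization: The asymptotic formula is proved for x > 2 with |x − e| ≥ δ, for any δ > 0, with constant depending on h and δ and |log log x| in the error term; at x = e that error term vanishes and the formula as stated fails. *)

theory Defs
  imports
    "HOL-Analysis.Analysis"
    "HOL-Computational_Algebra.Computational_Algebra"
    "HOL-Library.Landau_Symbols"
begin

definition omega :: "nat \<Rightarrow> nat" where
  "omega n = card (prime_factors n)"

text \<open>The number 1 (empty product of prime powers) is \<open>h\<close>-full for every \<open>h\<close>; 0 is not.\<close>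

definition h_full :: "nat \<Rightarrow> nat \<Rightarrow> bool" where
  "h_full h n \<longleftrightarrow> n > 0 \<and> (\<forall>p\<in>prime_factors n. h \<le> multiplicity p n)"

definition h_full_upto :: "nat \<Rightarrow> real \<Rightarrow> nat set" where
  "h_full_upto h x = {n. h_full h n \<and> real n \<le> x}"

text \<open>
  At \<open>n = 1\<close>, where \<open>log log n\<close> is undefined, the HOL convention \<open>ln 0 = 0\<close> gives the value 0.
  Every other \<open>h\<close>-full number with \<open>h \<ge> 2\<close> is at least 4, where \<open>log log n > 0\<close>.
\<close>

definition loglog :: "real \<Rightarrow> real" where
  "loglog x = ln (ln x)"

text \<open>Dirichlet series of the Riemann zeta function; meaningful for real \<open>s > 1\<close> only.\<close>

definition zeta :: "real \<Rightarrow> real" where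
  "zeta s = (\<Sum>n. 1 / real (Suc n) powr s)"

definition mertens_B1 :: real where
  "mertens_B1 = euler_mascheroni
     + (\<Sum>\<^sub>\<infinity>p\<in>{p::nat. prime p}. ln (1 - 1 / real p) + 1 / real p)"

definition gamma0 :: "nat \<Rightarrow> real" where
  "gamma0 h = (\<Prod>p. if prime p
     then 1 + (real p - real p powr (1 / real h)) /
              ((real p)\<^sup>2 * (real p powr (1 / real h) - 1))
     else 1)"

text \<open>The series converges for real \<open>r > h\<close>.\<close>

definition L_series :: "nat \<Rightarrow> real \<Rightarrow> real" where
  "L_series h r = (\<Sum>\<^sub>\<infinity>p\<in>{p::nat. prime p}.
     1 / (real p powr (r / real h - 1) * (real p - real p powr (1 - 1 / real h) + 1)))"

definition D1 :: "nat \<Rightarrow> real" where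
  "D1 h = mertens_B1 - ln (real h) + L_series h (real h + 1) - L_series h (2 * real h)"

definition D2 :: "nat \<Rightarrow> real" where
  "D2 h = (D1 h)\<^sup>2 + D1 h - zeta 2
     - (\<Sum>\<^sub>\<infinity>p\<in>{p::nat. prime p}. (1 / (real p - real p powr (1 - 1 / real h) + 1))\<^sup>2)"

definition has_normal_order :: "(nat \<Rightarrow> real) \<Rightarrow> (nat \<Rightarrow> real) \<Rightarrow> nat set \<Rightarrow> bool" where
  "has_normal_order f F S \<longleftrightarrow>
     (\<forall>n\<in>S. 0 \<le> f n) \<and> (\<forall>n\<in>S. 0 \<le> F n) \<and> mono_on S F \<and>
     (\<forall>\<epsilon>>0. (\<lambda>x::real. real (card {n\<in>S. real n \<le> x \<and>
                 \<not> ((1 - \<epsilon>) * F n \<le> f n \<and> f n \<le> (1 + \<epsilon>) * F n)}))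
            \<in> o[at_top](\<lambda>x. real (card {n\<in>S. real n \<le> x})))"

end

theory Submission
  imports Defs "HOL-Real_Asymp.Real_Asymp"
begin

text \<open>
  Every \<open>h\<close>-full number is uniquely \<open>n = a\<^sup>h b\<close> with the exponents of \<open>b\<close> in \<open>{0, h + 1, \<dots>, 2 h - 1}\<close>.
  Hence, with \<open>y = x\<^sup>1\<^sup>/\<^sup>h\<close>, the \<open>h\<close>-full \<open>n \<le> x\<close> divisible by a squarefree \<open>d\<close> number
  \<open>\<Sum>\<^sub>b \<lfloor>y b\<^sup>-\<^sup>1\<^sup>/\<^sup>h gcd(d, b) / d\<rfloor>\<close>, and bounding fractional parts by a power with exponent \<open>\<theta> < 1\<close> gives
  \<open>\<gamma>\<^sub>0 y \<Prod>\<^sub>p\<^sub>|\<^sub>d \<lambda>\<^sub>p + O((y / d)\<^sup>\<theta>)\<close> with \<open>\<lambda>\<^sub>p = 1 / (p - p\<^sup>1\<^sup>-\<^sup>1\<^sup>/\<^sup>h + 1)\<close>. Summing over \<open>d = p\<close> and \<open>d = p q\<close>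
  reduces the first two moments of \<open>\<omega>\<close> to \<open>\<Sum> \<lambda>\<^sub>p\<close> over \<open>p \<le> y\<close> and \<open>\<Sum> \<lambda>\<^sub>p \<lambda>\<^sub>q\<close> over \<open>p q \<le> y\<close>. Both are handled
  by partial summation from \<open>\<Sum> \<lambda>\<^sub>p log p = log y + O(1)\<close>; the second one produces the constant \<open>\<zeta>(2)\<close>.
  Replacing \<open>log log x\<close> by \<open>log log n\<close> costs an error of the admissible size, and
  Chebyshev's inequality turns the variance bound into the normal order.
\<close>

section \<open>Mertens weights\<close>

text \<open>Bounding each fractional part by 1 would be useless once the counts are summed over all
  primes up to \<open>y\<close>. The bound \<open>t powr \<theta>\<close> is summable over
  \<open>b\<close> as soon as \<open>\<theta> * (h + 1) > h\<close>, because the nonzero exponents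
  in \<open>b\<close> exceed \<open>h\<close>, and it retains a factor
  \<open>p powr - \<theta>\<close> for each prime. The errors then add up to
  \<open>O(y / log y)\<close> over \<open>p \<le> y\<close> and to
  \<open>O(y log log y / log y)\<close> over \<open>p q \<le> y\<close>, the error term of the
  theorem. No h-full \<open>n \<le> x\<close> is divisible by \<open>p q > y\<close>, so the second
  moment lives on a hyperbolic region; its sum falls short of the square of
  \<open>\<Sum> \<lambda>_p\<close> by \<open>\<zeta>(2)\<close> in the limit, and the excluded
  diagonal \<open>p = q\<close> yields the last sum in \<open>D2\<close>. The \<open>log h\<close>
  in \<open>D1\<close> is \<open>log log x - log log y\<close>. Partial summation gives only the
  existence of a constant in Mertens' second theorem; its identification with \<open>B_1\<close>,
  defined through Euler's constant, uses the pole of zeta at 1.\<close>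

lemma sum_by_parts_interval:
  fixes b \<phi> :: "nat \<Rightarrow> real"
  assumes "m \<le> N"
  shows "(\<Sum>k=m..N. b k * \<phi> k) =
    (\<Sum>k=m..N. b k) * \<phi> N + (\<Sum>k=m..<N. (\<Sum>i=m..k. b i) * (\<phi> k - \<phi> (Suc k)))"
  using assms
proof (induction N rule: dec_induct)
  case (step n)
  then show ?case by (simp add: algebra_simps)
qed simp

text \<open>Only the partial sums of \<open>b\<close> are controlled. After summation by parts the
  variation of a monotone \<open>\<phi>\<close> telescopes to at most \<open>\<phi> N\<close>, and
  the boundary term costs another \<open>R * \<phi> N\<close>, whence the factor 2.\<close>

lemma abel_inequality_mono:
  fixes b \<phi> :: "nat \<Rightarrow> real"
  assumes "m \<le> N"
    and R: "\<And>n. m \<le> n \<Longrightarrow> n \<le> N \<Longrightarrow> \<bar>\<Sum>k=m..n. b k\<bar> \<le> R"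
    and mono: "\<And>k. m \<le> k \<Longrightarrow> k < N \<Longrightarrow> \<phi> k \<le> \<phi> (Suc k)"
    and "0 \<le> \<phi> m"
  shows "\<bar>\<Sum>k=m..N. b k * \<phi> k\<bar> \<le> 2 * R * \<phi> N"
proof -
  have R0: "0 \<le> R" using R[of m] assms(1) by auto
  have tel: "(\<Sum>k=m..<N. \<phi> (Suc k) - \<phi> k) = \<phi> N - \<phi> m"
    using assms(1) by (simp add: sum_Suc_diff')
  have "(\<Sum>k=m..<N. \<phi> (Suc k) - \<phi> k) \<ge> 0"
    by (intro sum_nonneg) (use mono in auto)
  with tel assms have pN: "0 \<le> \<phi> N" by simp
  have "\<bar>\<Sum>k=m..N. b k * \<phi> k\<bar> \<le> \<bar>(\<Sum>k=m..N. b k) * \<phi> N\<bar>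
      + \<bar>\<Sum>k=m..<N. (\<Sum>i=m..k. b i) * (\<phi> k - \<phi> (Suc k))\<bar>"
    unfolding sum_by_parts_interval[OF assms(1)] by (rule abs_triangle_ineq)
  also have "\<bar>(\<Sum>k=m..N. b k) * \<phi> N\<bar> \<le> R * \<phi> N"
    using R[of N] assms(1) pN by (auto simp: abs_mult intro!: mult_mono)
  also have "\<bar>\<Sum>k=m..<N. (\<Sum>i=m..k. b i) * (\<phi> k - \<phi> (Suc k))\<bar>
      \<le> (\<Sum>k=m..<N. R * (\<phi> (Suc k) - \<phi> k))"
  proof (rule order.trans[OF sum_abs], rule sum_mono)
    fix k assume "k \<in> {m..<N}"
    then show "\<bar>(\<Sum>i=m..k. b i) * (\<phi> k - \<phi> (Suc k))\<bar> \<le> R * (\<phi> (Suc k) - \<phi> k)"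
      using R[of k] mono[of k] R0 by (auto simp: abs_mult intro!: mult_mono)
  qed
  also have "\<dots> = R * (\<phi> N - \<phi> m)" by (simp only: tel flip: sum_distrib_left)
  also have "R * \<phi> N + R * (\<phi> N - \<phi> m) \<le> 2 * R * \<phi> N"
    using R0 assms(4) by (simp add: algebra_simps)
  finally show ?thesis by simp
qed

text \<open>For decreasing \<open>\<phi>\<close> the boundary term and the telescoped variation add
  up to exactly \<open>R * \<phi> m\<close>, so the bound involves only the left end and controls
  tails.\<close>

lemma abel_inequality_antimono:
  fixes b \<phi> :: "nat \<Rightarrow> real"
  assumes "m \<le> N"
    and R: "\<And>n. m \<le> n \<Longrightarrow> n \<le> N \<Longrightarrow> \<bar>\<Sum>k=m..n. b k\<bar> \<le> R"
    and mono: "\<And>k. m \<le> k \<Longrightarrow> k < N \<Longrightarrow> \<phi> (Suc k) \<le> \<phi> k"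
    and "0 \<le> \<phi> N"
  shows "\<bar>\<Sum>k=m..N. b k * \<phi> k\<bar> \<le> R * \<phi> m"
proof -
  have R0: "0 \<le> R" using R[of m] assms(1) by auto
  have tel: "(\<Sum>k=m..<N. \<phi> k - \<phi> (Suc k)) = \<phi> m - \<phi> N"
    using sum_Suc_diff'[OF assms(1), of "\<lambda>k. - \<phi> k"] by simp
  have "\<bar>\<Sum>k=m..N. b k * \<phi> k\<bar> \<le> \<bar>(\<Sum>k=m..N. b k) * \<phi> N\<bar>
      + \<bar>\<Sum>k=m..<N. (\<Sum>i=m..k. b i) * (\<phi> k - \<phi> (Suc k))\<bar>"
    unfolding sum_by_parts_interval[OF assms(1)] by (rule abs_triangle_ineq)
  also have "\<bar>(\<Sum>k=m..N. b k) * \<phi> N\<bar> \<le> R * \<phi> N"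
    using R[of N] assms(1,4) by (auto simp: abs_mult intro!: mult_mono)
  also have "\<bar>\<Sum>k=m..<N. (\<Sum>i=m..k. b i) * (\<phi> k - \<phi> (Suc k))\<bar>
      \<le> (\<Sum>k=m..<N. R * (\<phi> k - \<phi> (Suc k)))"
  proof (rule order.trans[OF sum_abs], rule sum_mono)
    fix k assume "k \<in> {m..<N}"
    then show "\<bar>(\<Sum>i=m..k. b i) * (\<phi> k - \<phi> (Suc k))\<bar> \<le> R * (\<phi> k - \<phi> (Suc k))"
      using R[of k] mono[of k] R0 by (auto simp: abs_mult intro!: mult_mono)
  qed
  also have "\<dots> = R * (\<phi> m - \<phi> N)" by (simp only: tel flip: sum_distrib_left)
  also have "R * \<phi> N + R * (\<phi> m - \<phi> N) = R * \<phi> m" by (simp add: algebra_simps)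
  finally show ?thesis by simp
qed

lemma ln_diff_bounds:
  fixes a b :: real
  assumes "0 < a" "a \<le> b"
  shows "(b - a) / b \<le> ln b - ln a" "ln b - ln a \<le> (b - a) / a"
proof -
  have "ln (a / b) \<le> a / b - 1" using assms by (intro ln_le_minus_one) auto
  then show "(b - a) / b \<le> ln b - ln a" using assms by (simp add: ln_div field_simps)
  have "ln (b / a) \<le> b / a - 1" using assms by (intro ln_le_minus_one) auto
  then show "ln b - ln a \<le> (b - a) / a" using assms by (simp add: ln_div field_simps)
qed

lemma ln_step_bounds:
  assumes "2 \<le> (n::nat)"
  shows "0 \<le> ln (real n) - ln (real n - 1)" "ln (real n) - ln (real n - 1) \<le> 1"
proof -
  have "ln (real n) - ln (real n - 1) \<le> 1 / (real n - 1)"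
    using ln_diff_bounds(2)[of "real n - 1" "real n"] assms by simp
  also have "\<dots> \<le> 1" using assms by (simp add: field_simps)
  finally show "ln (real n) - ln (real n - 1) \<le> 1" .
qed (use assms in simp)

lemma finite_real_nat_le [simp]: "finite {n::nat. real n \<le> y}"
  by (rule finite_subset[of _ "{..nat \<lfloor>y\<rfloor>}"]) (auto simp: le_nat_floor)

lemma finite_real_nat_le_conj [simp]: "finite {n::nat. real n \<le> y \<and> P n}"
  by (rule finite_subset[of _ "{n. real n \<le> y}"]) auto

lemma real_nat_le_eq:
  assumes "0 \<le> y"
  shows "{n::nat. real n \<le> y} = {..nat \<lfloor>y\<rfloor>}"
  using assms by (auto simp: le_nat_iff le_floor_iff)

text \<open>The integer part \<open>N\<close> satisfies \<open>y \<le> 2 * N \<le> N * N\<close>, so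
  rounding down at most halves the logarithm, and bounds in \<open>1 / ln N\<close> carry over to
  \<open>1 / ln y\<close> with a factor 2.\<close>

lemma ln_floor_ge_half:
  assumes "2 \<le> (y::real)"
  shows "ln (real (nat \<lfloor>y\<rfloor>)) \<ge> ln y / 2" "2 \<le> nat \<lfloor>y\<rfloor>" "real (nat \<lfloor>y\<rfloor>) \<le> y" "y < real (nat \<lfloor>y\<rfloor>) + 1"
proof -
  define N where "N = nat \<lfloor>y\<rfloor>"
  show N2: "2 \<le> nat \<lfloor>y\<rfloor>" using assms by linarith
  show "real (nat \<lfloor>y\<rfloor>) \<le> y" "y < real (nat \<lfloor>y\<rfloor>) + 1" using assms by linarith+
  then have "y \<le> real N * 2" using N2 unfolding N_def by linarith
  also have "\<dots> \<le> real N * real N" using N2 unfolding N_def by (intro mult_left_mono) auto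
  finally have "ln y \<le> ln (real N * real N)" using assms N2 unfolding N_def by (subst ln_le_cancel_iff) auto
  also have "\<dots> = 2 * ln (real N)" using N2 unfolding N_def by (subst ln_mult) auto
  finally show "ln (real (nat \<lfloor>y\<rfloor>)) \<ge> ln y / 2" unfolding N_def by simp
qed

text \<open>The analogue of Mertens' first theorem is the only arithmetic information about
  \<open>c\<close>. Primality does not enter, so the same theory serves \<open>1 / p\<close> (for
  \<open>B_1\<close> and the error terms) and \<open>\<lambda>_p\<close> (for the main
  terms).\<close>

locale mertens_weight =
  fixes c :: "nat \<Rightarrow> real" and C :: real
  assumes nonneg: "0 \<le> c n"
    and c_small: "n < 2 \<Longrightarrow> c n = 0"
    and bound: "1 \<le> N \<Longrightarrow> \<bar>(\<Sum>n\<le>N. c n * ln (real n)) - ln (real N)\<bar> \<le> C"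
begin

lemma C_nonneg: "0 \<le> C"
  using bound[of 1] by auto

text \<open>On average \<open>c k * ln k\<close> behaves like the increment
  \<open>ln k - ln (k - 1)\<close>. The increments telescope, and comparing at both ends of
  \<open>m..n\<close> costs \<open>C\<close> twice, uniformly in \<open>m\<close>.\<close>

lemma partial_defect:
  assumes "2 \<le> m" "m \<le> n"
  shows "\<bar>\<Sum>k=m..n. c k * ln (real k) - (ln (real k) - ln (real k - 1))\<bar> \<le> 2 * C"
proof -
  have split: "(\<Sum>k\<le>n. c k * ln (real k)) = (\<Sum>k\<le>m - 1. c k * ln (real k)) + (\<Sum>k=m..n. c k * ln (real k))"
  proof -
    have "{..n} = {..m-1} \<union> {m..n}" using assms by auto
    then show ?thesis by (simp add: sum.union_disjoint[symmetric] ivl_disj_int_two) (subst sum.union_disjoint, use assms in auto)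
  qed
  have "(\<Sum>k=m..n. ln (real k) - ln (real k - 1)) = ln (real n) - ln (real m - 1)"
  proof -
    have "(\<Sum>k=m..n. ln (real k) - ln (real k - 1)) = (\<Sum>k=m..n. ln (real k) - ln (real (k - 1)))"
      using assms by (intro sum.cong) (auto simp: of_nat_diff)
    also have "\<dots> = ln (real n) - ln (real (m - 1))"
      using assms(2)
    proof (induction n rule: dec_induct)
      case (step k) then show ?case by simp
    qed simp
    finally show ?thesis using assms by (simp add: of_nat_diff)
  qed
  then have "(\<Sum>k=m..n. c k * ln (real k) - (ln (real k) - ln (real k - 1)))
      = ((\<Sum>k\<le>n. c k * ln (real k)) - ln (real n)) - ((\<Sum>k\<le>m - 1. c k * ln (real k)) - ln (real (m - 1)))"
    using assms by (simp add: split sum_subtractf of_nat_diff)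
  then show ?thesis
    using bound[of n] bound[of "m - 1"] assms by linarith
qed

text \<open>This exchanges a sum over the weight for a Riemann sum of \<open>\<phi>\<close> against
  \<open>d ln\<close>, which can be evaluated by elementary means for each \<open>\<phi>\<close>
  that occurs.\<close>

lemma weighted_mono:
  assumes "2 \<le> m" "m \<le> N"
    and "\<And>k. m \<le> k \<Longrightarrow> k < N \<Longrightarrow> \<phi> k \<le> \<phi> (Suc k)" "0 \<le> \<phi> m"
  shows "\<bar>(\<Sum>k=m..N. c k * ln (real k) * \<phi> k) - (\<Sum>k=m..N. (ln (real k) - ln (real k - 1)) * \<phi> k)\<bar> \<le> 4 * C * \<phi> N"
  using abel_inequality_mono[OF assms(2) partial_defect[OF assms(1)] assms(3,4)]
  by (simp add: sum_subtractf left_diff_distrib)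

lemma weighted_antimono:
  assumes "2 \<le> m" "m \<le> N"
    and "\<And>k. m \<le> k \<Longrightarrow> k < N \<Longrightarrow> \<phi> (Suc k) \<le> \<phi> k" "0 \<le> \<phi> N"
  shows "\<bar>(\<Sum>k=m..N. c k * ln (real k) * \<phi> k) - (\<Sum>k=m..N. (ln (real k) - ln (real k - 1)) * \<phi> k)\<bar> \<le> 2 * C * \<phi> m"
  using abel_inequality_antimono[OF assms(2) partial_defect[OF assms(1)] assms(3,4)]
  by (simp add: sum_subtractf left_diff_distrib)

text \<open>With \<open>\<phi> k = 1 / ln k\<close> the Riemann sum approximates the integral of
  \<open>du / u\<close> in \<open>u = ln k\<close>, which is an increment of \<open>ln ln\<close>.
  The error decays in \<open>N\<close>, and this yields the Cauchy property.\<close>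

lemma loglog_increment:
  assumes "2 \<le> N" "N \<le> N'"
  shows "\<bar>(\<Sum>k=Suc N..N'. c k) - (ln (ln (real N')) - ln (ln (real N)))\<bar> \<le> (2 * C + 1) / ln (real N)"
proof (cases "N = N'")
  case True
  then show ?thesis using assms C_nonneg by auto
next
  case False
  with assms have NN: "Suc N \<le> N'" by simp
  have lnN: "ln (real N) > 0" using assms by simp
  define \<phi> where "\<phi> = (\<lambda>k::nat. 1 / ln (real k))"
  have "\<bar>(\<Sum>k=Suc N..N'. c k * ln (real k) * \<phi> k) - (\<Sum>k=Suc N..N'. (ln (real k) - ln (real k - 1)) * \<phi> k)\<bar>
      \<le> 2 * C * \<phi> (Suc N)"
    unfolding \<phi>_def using assms NN by (intro weighted_antimono divide_left_mono mult_pos_pos) auto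
  also have "(\<Sum>k=Suc N..N'. c k * ln (real k) * \<phi> k) = (\<Sum>k=Suc N..N'. c k)"
    using assms by (intro sum.cong) (auto simp: \<phi>_def)
  finally have 1: "\<bar>(\<Sum>k=Suc N..N'. c k) - (\<Sum>k=Suc N..N'. (ln (real k) - ln (real k - 1)) * \<phi> k)\<bar>
      \<le> 2 * C * \<phi> (Suc N)" .
  have "\<phi> (Suc N) \<le> 1 / ln (real N)"
    unfolding \<phi>_def using assms lnN by (intro divide_left_mono) auto
  then have 2: "2 * C * \<phi> (Suc N) \<le> 2 * C / ln (real N)"
    using C_nonneg mult_left_mono[of "\<phi> (Suc N)" "1 / ln (real N)" "2 * C"] by auto
  have tel: "(\<Sum>k=Suc N..N'. f k - f (k - 1)) = f N' - f N" for f :: "nat \<Rightarrow> real"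
    using assms(2)
  proof (induction N' rule: dec_induct)
    case (step k) then show ?case by simp
  qed simp
  have 3: "\<bar>(\<Sum>k=Suc N..N'. (ln (real k) - ln (real k - 1)) * \<phi> k) - (ln (ln (real N')) - ln (ln (real N)))\<bar>
      \<le> 1 / ln (real N)"
  proof -
    have "\<bar>(\<Sum>k=Suc N..N'. (ln (real k) - ln (real k - 1)) * \<phi> k) - (ln (ln (real N')) - ln (ln (real N)))\<bar>
       = \<bar>\<Sum>k=Suc N..N'. (ln (real k) - ln (real k - 1)) * \<phi> k - (ln (ln (real k)) - ln (ln (real (k - 1))))\<bar>"
      unfolding sum_subtractf[of "\<lambda>k. (ln (real k) - ln (real k - 1)) * \<phi> k"] tel[of "\<lambda>k. ln (ln (real k))"] by simp
    \<comment> \<open>One step of the Riemann sum is off by at most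
      \<open>(b - a) * (1 / a - 1 / b)\<close> with \<open>b - a \<le> 1\<close>, and the majorant
      \<open>1 / a - 1 / b\<close> telescopes.\<close>
    also have "\<dots> \<le> (\<Sum>k=Suc N..N'. - \<phi> k - (- \<phi> (k - 1)))"
    proof (rule order.trans[OF sum_abs], rule sum_mono)
      fix k assume k: "k \<in> {Suc N..N'}"
      define a b where "a = ln (real k - 1)" and "b = ln (real k)"
      have ab: "0 < a" "a \<le> b" "b - a \<le> 1" using k assms ln_step_bounds[of k] by (auto simp: a_def b_def)
      have bd: "(b - a) / b \<le> ln b - ln a" "ln b - ln a \<le> (b - a) / a" using ln_diff_bounds[of a b] ab by auto
      have "(b - a) / a - (b - a) / b = (b - a) * (1 / a - 1 / b)" by (simp add: algebra_simps)
      also have "\<dots> \<le> 1 * (1 / a - 1 / b)"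
        using ab by (intro mult_right_mono) (auto simp: field_simps)
      finally have "\<bar>(b - a) * (1 / b) - (ln b - ln a)\<bar> \<le> - (1 / b) - (- (1 / a))" using bd by simp
      then show "\<bar>(ln (real k) - ln (real k - 1)) * \<phi> k - (ln (ln (real k)) - ln (ln (real (k - 1))))\<bar> \<le> - \<phi> k - (- \<phi> (k - 1))"
        using k by (simp add: a_def b_def \<phi>_def of_nat_diff)
    qed
    also have "\<dots> = \<phi> N - \<phi> N'" using tel[of "\<lambda>k. - \<phi> k"] by simp
    also have "\<dots> \<le> 1 / ln (real N)" using assms by (simp add: \<phi>_def)
    finally show ?thesis .
  qed
  have "(2 * C + 1) / ln (real N) = 2 * C / ln (real N) + 1 / ln (real N)" by (simp add: add_divide_distrib)
  with 1 2 3 show ?thesis by linarith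
qed

definition A :: "real \<Rightarrow> real" where "A y = (\<Sum>n | real n \<le> y. c n)"

text \<open>The constant in the analogue of Mertens' second theorem. It is evaluated only later:
  \<open>mertens_B1\<close> for the weight \<open>1 / p\<close>, and \<open>D1 h + ln h\<close> for
  \<open>\<lambda>_p\<close>.\<close>

definition M :: real where "M = lim (\<lambda>N. (\<Sum>n\<le>N. c n) - ln (ln (real N)))"

lemma A_nonneg: "0 \<le> A y"
  unfolding A_def by (intro sum_nonneg nonneg)

lemma A_mono: "y \<le> z \<Longrightarrow> A y \<le> A z"
  unfolding A_def by (intro sum_mono2) (auto simp: nonneg)

lemma A_eq_0: "y < 2 \<Longrightarrow> A y = 0"
  unfolding A_def by (intro sum.neutral ballI c_small) auto

lemma A_nat: "A (real N) = (\<Sum>n\<le>N. c n)"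
  unfolding A_def by (auto intro!: sum.cong)

lemma increment:
  assumes "2 \<le> N" "N \<le> N'"
  shows "\<bar>(A (real N') - ln (ln (real N'))) - (A (real N) - ln (ln (real N)))\<bar> \<le> (2 * C + 1) / ln (real N)"
proof -
  have "A (real N') = A (real N) + (\<Sum>k=Suc N..N'. c k)"
    unfolding A_nat using assms(2)
  proof (induction N' rule: dec_induct)
    case (step k) then show ?case by simp
  qed simp
  then show ?thesis using loglog_increment[OF assms] by simp
qed

lemma M_LIMSEQ: "(\<lambda>N. A (real N) - ln (ln (real N))) \<longlonglongrightarrow> M"
proof -
  have "Cauchy (\<lambda>N. A (real N) - ln (ln (real N)))"
  proof (rule CauchyI')
    fix e :: real assume e: "e > 0"
    have "(\<lambda>N. (2 * C + 1) / ln (real N)) \<longlonglongrightarrow> 0" by real_asymp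
    then have "\<forall>\<^sub>F N in sequentially. (2 * C + 1) / ln (real N) < e"
      using e by (rule order_tendstoD)
    then obtain N0 where N0: "\<And>N. N \<ge> N0 \<Longrightarrow> (2 * C + 1) / ln (real N) < e"
      by (auto simp: eventually_sequentially)
    show "\<exists>K. \<forall>m\<ge>K. \<forall>n>m. dist (A (real m) - ln (ln (real m))) (A (real n) - ln (ln (real n))) < e"
    proof (intro exI[of _ "max 2 N0"] allI impI)
      fix m n :: nat assume "max 2 N0 \<le> m" "m < n"
      then show "dist (A (real m) - ln (ln (real m))) (A (real n) - ln (ln (real n))) < e"
        using increment[of m n] N0[of m] by (simp add: dist_real_def abs_minus_commute)
    qed
  qed
  then have "convergent (\<lambda>N. A (real N) - ln (ln (real N)))"
    by (rule Cauchy_convergent)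
  then show ?thesis
    unfolding M_def A_nat by (simp add: convergent_LIMSEQ_iff)
qed

lemma A_asymp_nat:
  assumes "2 \<le> N"
  shows "\<bar>A (real N) - ln (ln (real N)) - M\<bar> \<le> (2 * C + 1) / ln (real N)"
proof -
  have "(\<lambda>N'. \<bar>(A (real N') - ln (ln (real N'))) - (A (real N) - ln (ln (real N)))\<bar>)
      \<longlonglongrightarrow> \<bar>M - (A (real N) - ln (ln (real N)))\<bar>"
    by (intro tendsto_intros M_LIMSEQ)
  then have "\<bar>M - (A (real N) - ln (ln (real N)))\<bar> \<le> (2 * C + 1) / ln (real N)"
    by (rule tendsto_upperbound) (use increment[OF assms] in \<open>auto simp: eventually_sequentially\<close>)
  then show ?thesis by (simp add: abs_minus_commute)
qed

lemma A_floor: "0 \<le> y \<Longrightarrow> A y = A (real (nat \<lfloor>y\<rfloor>))"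
  unfolding A_nat A_def by (simp add: real_nat_le_eq)

text \<open>This is \<open>2 * (2 * C + 2)\<close>: the bound at integers gives
  \<open>2 * C + 1\<close>, rounding \<open>y\<close> down adds 1, and
  \<open>ln N \<ge> ln y / 2\<close> doubles the sum.\<close>

definition K1 :: real where "K1 = 4 * C + 4"

lemma K1_pos: "0 < K1" using C_nonneg by (simp add: K1_def)

lemma A_asymp:
  assumes "2 \<le> y"
  shows "\<bar>A y - ln (ln y) - M\<bar> \<le> K1 / ln y"
proof -
  define N where "N = nat \<lfloor>y\<rfloor>"
  have N: "2 \<le> N" "ln (real N) \<ge> ln y / 2" "real N \<le> y" "y \<le> real N + 1"
    using ln_floor_ge_half[OF assms] by (auto simp: N_def)
  have ly: "ln y > 0" using assms by simp
  have lN: "ln (real N) > 0" using N by simp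
  have 1: "\<bar>A y - ln (ln (real N)) - M\<bar> \<le> (2 * C + 1) / ln (real N)"
    using A_asymp_nat[OF N(1)] A_floor[of y] assms by (simp add: N_def)
  have "ln (ln y) - ln (ln (real N)) \<le> (ln y - ln (real N)) / ln (real N)"
    using lN N assms by (intro ln_diff_bounds) auto
  also have "\<dots> \<le> 1 / ln (real N)"
  proof -
    have "ln y - ln (real N) \<le> (y - real N) / real N" using N by (intro ln_diff_bounds) auto
    also have "\<dots> \<le> 1" using N by (simp add: field_simps)
    finally show ?thesis using lN by (intro divide_right_mono) auto
  qed
  finally have 2: "ln (ln y) - ln (ln (real N)) \<le> 1 / ln (real N)" .
  have 3: "ln (ln (real N)) \<le> ln (ln y)" using lN N assms by simp
  have "\<bar>A y - ln (ln y) - M\<bar> \<le> (2 * C + 1) / ln (real N) + 1 / ln (real N)"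
    using 1 2 3 by linarith
  also have "\<dots> = (2 * C + 2) / ln (real N)" by (simp add: add_divide_distrib)
  also have "\<dots> \<le> (2 * C + 2) / (ln y / 2)"
    using N ly lN C_nonneg by (intro divide_left_mono) auto
  finally show ?thesis by (simp add: K1_def algebra_simps)
qed

end

section \<open>Powers, the logarithm series and partial sums of zeta(2)\<close>

lemma power_diff_le:
  fixes a b :: real
  assumes "0 \<le> a" "a \<le> b"
  shows "b ^ Suc k - a ^ Suc k \<le> real (Suc k) * b ^ k * (b - a)"
proof (induction k)
  case (Suc k)
  have "b ^ Suc (Suc k) - a ^ Suc (Suc k) = b * (b ^ Suc k - a ^ Suc k) + a ^ Suc k * (b - a)"
    by (simp add: algebra_simps)
  also have "\<dots> \<le> b * (real (Suc k) * b ^ k * (b - a)) + b ^ Suc k * (b - a)"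
    using assms Suc by (intro add_mono mult_left_mono mult_right_mono power_mono) auto
  also have "\<dots> = real (Suc (Suc k)) * b ^ Suc k * (b - a)"
    by (simp add: algebra_simps)
  finally show ?case .
qed simp

lemma power_diff_ge:
  fixes a b :: real
  assumes "0 \<le> a" "a \<le> b"
  shows "real (Suc k) * a ^ k * (b - a) \<le> b ^ Suc k - a ^ Suc k"
proof (induction k)
  case (Suc k)
  have "real (Suc (Suc k)) * a ^ Suc k * (b - a) = a * (real (Suc k) * a ^ k * (b - a)) + a ^ Suc k * (b - a)"
    by (simp add: algebra_simps)
  also have "\<dots> \<le> b * (b ^ Suc k - a ^ Suc k) + a ^ Suc k * (b - a)"
  proof (intro add_mono order.refl mult_mono Suc)
    show "0 \<le> real (Suc k) * a ^ k * (b - a)" using assms by simp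
  qed (use assms in auto)
  also have "\<dots> = b ^ Suc (Suc k) - a ^ Suc (Suc k)"
    by (simp add: algebra_simps)
  finally show ?case .
qed simp

lemma telescope_pred:
  fixes f :: "nat \<Rightarrow> real"
  assumes "m \<le> Suc N" "1 \<le> m"
  shows "(\<Sum>k=m..N. f k - f (k - 1)) = f N - f (m - 1)"
  using assms(1)
proof (induction N)
  case 0 then show ?case using assms by (cases "m = 1") auto
next
  case (Suc N)
  then show ?case using assms by (cases "m = Suc (Suc N)") auto
qed

text \<open>The tail of the series is at most \<open>1 / K\<close> times a geometric series. As
  \<open>s\<close> tends to 1 the bound degenerates only like \<open>1 / (1 - s)\<close>, which a
  large \<open>K\<close> can offset.\<close>

lemma neg_ln_one_minus_partial_sum:
  fixes s :: real
  assumes "0 \<le> s" "s < 1" "1 \<le> K"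
  shows "(\<Sum>k=1..K. s ^ k / real k) \<le> - ln (1 - s)"
    and "- ln (1 - s) \<le> (\<Sum>k=1..K. s ^ k / real k) + 1 / (real K * (1 - s))"
proof -
  have "(\<lambda>n. - ((- (- s)) ^ n) / of_nat n) sums ln (1 + - s)"
    using assms by (intro ln_series') auto
  then have sums: "(\<lambda>n. s ^ n / real n) sums (- ln (1 - s))"
    using sums_minus by fastforce
  have eq: "(\<Sum>n<Suc K. s ^ n / real n) = (\<Sum>k=1..K. s ^ k / real k)"
    by (rule sum.mono_neutral_right) (auto simp: not_less_eq_eq Suc_le_eq)
  have tail: "(\<lambda>n. s ^ (n + Suc K) / real (n + Suc K)) sums (- ln (1 - s) - (\<Sum>k=1..K. s ^ k / real k))"
    using sums_iff_shift[of "\<lambda>n. s ^ n / real n" "Suc K"] sums eq by (simp add: sums_iff_shift')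
  have "0 \<le> - ln (1 - s) - (\<Sum>k=1..K. s ^ k / real k)"
    by (rule sums_le[OF _ sums_zero tail]) (use assms in auto)
  then show "(\<Sum>k=1..K. s ^ k / real k) \<le> - ln (1 - s)" by simp
  have "(\<lambda>n. s ^ n * (1 / real K)) sums (1 / (1 - s) * (1 / real K))"
    using assms by (intro sums_mult2 geometric_sums) auto
  then have "- ln (1 - s) - (\<Sum>k=1..K. s ^ k / real k) \<le> 1 / (1 - s) * (1 / real K)"
  proof (rule sums_le[rotated, OF tail])
    fix n
    have "s ^ (n + Suc K) / real (n + Suc K) \<le> s ^ n / real K"
      using assms by (intro frac_le power_decreasing) auto
    then show "s ^ (n + Suc K) / real (n + Suc K) \<le> s ^ n * (1 / real K)" by simp
  qed
  then show "- ln (1 - s) \<le> (\<Sum>k=1..K. s ^ k / real k) + 1 / (real K * (1 - s))"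
    by (simp add: algebra_simps)
qed

lemma sum_inverse_le_ln:
  assumes "1 \<le> K"
  shows "(\<Sum>k=1..K. 1 / real k) \<le> 1 + ln (real K)"
  using assms
proof (induction K rule: dec_induct)
  case (step n)
  have "(real (Suc n) - real n) / real (Suc n) \<le> ln (real (Suc n)) - ln (real n)"
    using step by (intro ln_diff_bounds) auto
  then show ?case using step by simp
qed simp

text \<open>The tail is compared termwise with \<open>1 / t - 1 / (t + 1)\<close>, which
  telescopes.\<close>

lemma zeta2_partial_sum:
  assumes "1 \<le> K"
  shows "(\<Sum>k=1..K. 1 / (real k)\<^sup>2) \<le> zeta 2" "zeta 2 \<le> (\<Sum>k=1..K. 1 / (real k)\<^sup>2) + 1 / real K"
proof -
  have z: "zeta 2 = (\<Sum>n. 1 / (real (Suc n))\<^sup>2)"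
    by (simp add: zeta_def powr_numeral)
  have summ: "summable (\<lambda>n. 1 / (real (Suc n))\<^sup>2)"
    using inverse_squares_sums by (simp add: sums_iff add.commute)
  have eq: "(\<Sum>n<K. 1 / (real (Suc n))\<^sup>2) = (\<Sum>k=1..K. 1 / (real k)\<^sup>2)"
    by (rule sum.reindex_bij_witness[of _ "\<lambda>k. k - 1" Suc]) auto
  show "(\<Sum>k=1..K. 1 / (real k)\<^sup>2) \<le> zeta 2"
    unfolding z eq[symmetric] by (intro sum_le_suminf summ) auto
  have s1: "(\<lambda>n. 1 / real (n + K) - 1 / real (Suc n + K)) sums (1 / real (0 + K) - 0)"
    by (rule telescope_sums') real_asymp
  have s2: "(\<lambda>n. 1 / (real (Suc (n + K)))\<^sup>2) sums (zeta 2 - (\<Sum>k=1..K. 1 / (real k)\<^sup>2))"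
    using sums_iff_shift'[of "\<lambda>n. 1 / (real (Suc n))\<^sup>2" K "zeta 2"] summable_sums[OF summ] eq z by simp
  have "zeta 2 - (\<Sum>k=1..K. 1 / (real k)\<^sup>2) \<le> 1 / real (0 + K) - 0"
  proof (rule sums_le[OF _ s2 s1])
    fix n
    define t where "t = real (n + K)"
    have "t \<ge> 1" using assms by (simp add: t_def)
    then have "1 / (t + 1)\<^sup>2 \<le> 1 / (t * (t + 1))"
      unfolding power2_eq_square by (intro divide_left_mono mult_right_mono mult_pos_pos) auto
    also have "\<dots> = 1 / t - 1 / (t + 1)" using \<open>t \<ge> 1\<close> by (simp add: field_simps)
    finally have "1 / (t + 1)\<^sup>2 \<le> 1 / t - 1 / (t + 1)" .
    then show "1 / (real (Suc (n + K)))\<^sup>2 \<le> 1 / real (n + K) - 1 / real (Suc n + K)"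
      by (simp add: t_def add_ac)
  qed
  then show "zeta 2 \<le> (\<Sum>k=1..K. 1 / (real k)\<^sup>2) + 1 / real K" by simp
qed

section \<open>Double sums over the hyperbolic region \<open>m * n \<le> y\<close>\<close>

context mertens_weight
begin

lemma sum_real_le:
  assumes "0 \<le> y"
  shows "(\<Sum>n | real n \<le> y. c n * f n) = (\<Sum>n=2..nat \<lfloor>y\<rfloor>. c n * f n)"
  unfolding real_nat_le_eq[OF assms] by (rule sum.mono_neutral_right) (auto intro!: c_small)

lemma A_le:
  assumes "2 \<le> y"
  shows "A y \<le> ln (ln y) + (\<bar>M\<bar> + K1 / ln 2)"
proof -
  have "K1 / ln y \<le> K1 / ln 2" using K1_pos assms by (intro divide_left_mono) auto
  then show ?thesis using A_asymp[OF assms] by linarith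
qed

lemma ln_half_ge:
  assumes "4 \<le> (y::real)"
  shows "ln y / 2 \<le> ln (y / 2)"
proof -
  have "ln 4 \<le> ln y" using assms by simp
  moreover have "ln (4::real) = 2 * ln 2" using ln_realpow[of 2 2] by simp
  ultimately show ?thesis using assms by (simp add: ln_div)
qed

text \<open>\<open>ln ln\<close> varies by \<open>O(1 / ln y)\<close> over a dyadic block. The range
  \<open>n > y / 2\<close> has to be treated apart because \<open>ln (y / n)\<close> can come
  arbitrarily close to 0 there.\<close>

lemma dyadic_block:
  assumes "4 \<le> y"
  shows "A y - A (y / 2) \<le> (2 + 3 * K1) / ln y"
proof -
  have ly: "0 < ln y" using assms by simp
  note h = ln_half_ge[OF assms]
  define a where "a = 1 / ln y"
  have "1 / ln (y / 2) \<le> 1 / (ln y / 2)" using h ly by (intro divide_left_mono mult_pos_pos) linarith+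
  then have inv: "1 / ln (y / 2) \<le> 2 * a" by (simp add: a_def)
  have 1: "A y - ln (ln y) - M \<le> K1 * a" using A_asymp[of y] assms by (simp add: a_def)
  have "- (A (y / 2) - ln (ln (y / 2)) - M) \<le> K1 * (1 / ln (y / 2))" using A_asymp[of "y / 2"] assms by simp
  also have "\<dots> \<le> K1 * (2 * a)" using inv K1_pos by (intro mult_left_mono) auto
  finally have 2: "- (A (y / 2) - ln (ln (y / 2)) - M) \<le> 2 * (K1 * a)" by simp
  have "ln (ln y) - ln (ln (y / 2)) \<le> (ln y - ln (y / 2)) / ln (y / 2)"
    using assms h ly by (intro ln_diff_bounds) (linarith, simp)
  also have "\<dots> \<le> 1 / ln (y / 2)"
    using assms h ly less_imp_le[OF ln_2_less_1] by (intro divide_right_mono) (auto simp: ln_div)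
  finally have 3: "ln (ln y) - ln (ln (y / 2)) \<le> 2 * a" using inv by linarith
  have "A y - A (y / 2) \<le> 2 * a + 3 * (K1 * a)" using 1 2 3 by linarith
  also have "\<dots> = (2 + 3 * K1) / ln y" by (simp add: a_def add_divide_distrib)
  finally show ?thesis .
qed

text \<open>With \<open>u = ln n\<close> and \<open>U = ln y\<close> this is a Riemann sum for the
  integral of \<open>1 / (U - u)\<close>, that is, for \<open>ln U - ln (ln 2)\<close>: the
  condition \<open>2 * n \<le> y\<close> keeps \<open>U - u \<ge> ln 2\<close>.\<close>

lemma inv_log_weighted_sum:
  assumes "4 \<le> y"
  shows "(\<Sum>n | 2 * real n \<le> y. c n * (ln (real n) / ln (y / real n)))
    \<le> ln (ln y) - ln (ln 2) + (1 + 4 * C) / ln 2"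
proof -
  define N where "N = nat \<lfloor>y / 2\<rfloor>"
  have N: "2 \<le> N" "real N \<le> y / 2" using ln_floor_ge_half[of "y / 2"] assms by (auto simp: N_def)
  define v where "v = (\<lambda>n::nat. ln y - ln (real n))"
  have v_pos: "ln 2 \<le> v n" if "1 \<le> n" "n \<le> N" for n
  proof -
    have "ln (real n) \<le> ln (y / 2)" using that N assms by (subst ln_le_cancel_iff) linarith+
    then show ?thesis using assms by (simp add: v_def ln_div)
  qed
  have vl2: "0 < ln (2::real)" by simp
  have v_dec: "v n \<le> v (n - 1)" "v (n - 1) - v n \<le> 1" if "2 \<le> n" for n
    using ln_step_bounds[of n] that by (auto simp: v_def of_nat_diff)
  have "{n. 2 * real n \<le> y} = {n. real n \<le> y / 2}" by auto
  then have "(\<Sum>n | 2 * real n \<le> y. c n * (ln (real n) / ln (y / real n)))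
     = (\<Sum>n=2..N. c n * (ln (real n) / ln (y / real n)))"
    using sum_real_le[of "y / 2" "\<lambda>n. ln (real n) / ln (y / real n)"] assms by (simp only: N_def)
  also have "\<dots> = (\<Sum>n=2..N. c n * ln (real n) * (1 / v n))"
    using assms by (intro sum.cong) (auto simp: v_def ln_div)
  also have "\<dots> \<le> (\<Sum>n=2..N. (ln (real n) - ln (real n - 1)) * (1 / v n)) + 4 * C * (1 / v N)"
  proof -
    have m1: "1 / v k \<le> 1 / v (Suc k)" if "2 \<le> k" "k < N" for k
    proof -
      have "ln 2 \<le> v k" "ln 2 \<le> v (Suc k)" "v (Suc k) \<le> v k"
        using v_pos[of k] v_pos[of "Suc k"] v_dec[of "Suc k"] that by auto
      then show ?thesis using vl2 by (intro divide_left_mono mult_pos_pos) linarith+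
    qed
    have m2: "0 \<le> 1 / v 2"
    proof -
      have "ln 2 \<le> v 2" using v_pos[of 2] N by simp
      then have "0 < v 2" using vl2 by linarith
      then show ?thesis by simp
    qed
    show ?thesis
      using weighted_mono[of 2 N "\<lambda>n. 1 / v n", OF order.refl N(1) m1 m2] by linarith
  qed
  \<comment> \<open>\<open>- ln v\<close> is the primitive of the integrand; the added
    \<open>1 / v\<close> absorbs the error of the steps, whose length is at most 1.\<close>
  also have "(\<Sum>n=2..N. (ln (real n) - ln (real n - 1)) * (1 / v n))
      \<le> (\<Sum>n=2..N. (1 / v n - ln (v n)) - (1 / v (n - 1) - ln (v (n - 1))))"
  proof (rule sum_mono)
    fix n assume n: "n \<in> {2..N}"
    define a b where "a = v (n - 1)" and "b = v n"
    have ab: "0 < b" "b \<le> a" "a - b \<le> 1"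
    proof -
      have "ln 2 \<le> v n" "v n \<le> v (n - 1)" "v (n - 1) - v n \<le> 1" using v_pos[of n] v_dec[of n] n by auto
      then show "0 < b" "b \<le> a" "a - b \<le> 1" using vl2 unfolding a_def b_def by linarith+
    qed
    have "(a - b) / a \<le> ln a - ln b" using ab by (intro ln_diff_bounds) auto
    moreover have "(a - b) * (1 / b - 1 / a) \<le> 1 * (1 / b - 1 / a)"
      using ab by (intro mult_right_mono) (auto simp: field_simps)
    ultimately have "(a - b) * (1 / b) \<le> (1 / b - ln b) - (1 / a - ln a)"
      by (simp add: algebra_simps)
    moreover have "ln (real n) - ln (real n - 1) = a - b"
      using n by (simp add: a_def b_def v_def of_nat_diff)
    ultimately show "(ln (real n) - ln (real n - 1)) * (1 / v n) \<le> (1 / v n - ln (v n)) - (1 / v (n - 1) - ln (v (n - 1)))"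
      unfolding a_def b_def by simp
  qed
  also have "\<dots> = (1 / v N - ln (v N)) - (1 / v 1 - ln (v 1))"
    using telescope_pred[of 2 N "\<lambda>n. 1 / v n - ln (v n)"] N by simp
  also have "\<dots> + 4 * C * (1 / v N) \<le> ln (ln y) - ln (ln 2) + (1 + 4 * C) / ln 2"
  proof -
    define p q r where "p = 1 / v N" and "q = 1 / ln (2::real)" and "r = 1 / v 1"
    have "ln 2 \<le> v 1" "ln 2 \<le> v N" using v_pos[of 1] v_pos[of N] N by auto
    then have v: "0 < v 1" "0 < v N" "ln 2 \<le> v N" using vl2 by linarith+
    then have "p \<le> q" unfolding p_def q_def by (intro divide_left_mono mult_pos_pos) auto
    moreover from this have "4 * C * p \<le> 4 * C * q" using C_nonneg by (intro mult_left_mono) auto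
    moreover have "ln (ln 2) \<le> ln (v N)" using v by (subst ln_le_cancel_iff) auto
    moreover have "0 \<le> r" using v by (simp add: r_def)
    moreover have "(1 + 4 * C) / ln 2 = q + 4 * C * q" by (simp add: q_def add_divide_distrib)
    moreover have "ln (v 1) = ln (ln y)" by (simp add: v_def)
    ultimately show ?thesis unfolding p_def[symmetric] r_def[symmetric] by linarith
  qed
  finally show ?thesis by simp
qed

text \<open>Writing \<open>ln y = u + v\<close> with \<open>u = ln n\<close> and
  \<open>v = ln (y / n)\<close> turns \<open>1 / v\<close> into \<open>(1 + u / v) / ln y\<close>,
  up to a factor 2 that is given away. The sum thus costs only \<open>ln (ln y) / ln y\<close>,
  where bounding every \<open>v\<close> by \<open>ln 2\<close> would leave
  \<open>ln (ln y)\<close>.\<close>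

lemma inv_log_sum_le:
  assumes "4 \<le> y"
  shows "(\<Sum>n | 2 * real n \<le> y. c n / ln (y / real n))
    \<le> (2 / ln y) * (2 * ln (ln y) + (\<bar>M\<bar> + K1 / ln 2) - ln (ln 2) + (1 + 4 * C) / ln 2)"
proof -
  have ly: "0 < ln y" using assms by simp
  have fin: "finite {n. 2 * real n \<le> y}" by (rule finite_subset[OF _ finite_real_nat_le[of "y / 2"]]) auto
  have "(\<Sum>n | 2 * real n \<le> y. c n / ln (y / real n))
     \<le> (\<Sum>n | 2 * real n \<le> y. (2 / ln y) * (c n + c n * (ln (real n) / ln (y / real n))))"
  proof (rule sum_mono)
    fix n assume "n \<in> {n. 2 * real n \<le> y}"
    then have n: "2 * real n \<le> y" by simp
    show "c n / ln (y / real n) \<le> (2 / ln y) * (c n + c n * (ln (real n) / ln (y / real n)))"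
    proof (cases "n < 2")
      case True then show ?thesis by (simp add: c_small)
    next
      case False
      define u v where "u = ln (real n)" and "v = ln (y / real n)"
      have uv: "u + v = ln y" using assms False by (simp add: u_def v_def ln_div)
      have "0 < u" using False by (simp add: u_def)
      have "2 \<le> y / real n" using False n by (simp add: field_simps)
      then have "0 < v" by (simp add: v_def)
      have "1 / v = (2 / ln y) * ((u + v) / (2 * v))" using ly uv by (simp add: field_simps)
      also have "\<dots> \<le> (2 / ln y) * (1 + u / v)"
        using ly \<open>0 < u\<close> \<open>0 < v\<close> by (intro mult_left_mono) (auto simp: field_simps)
      finally have "c n * (1 / v) \<le> c n * ((2 / ln y) * (1 + u / v))" by (intro mult_left_mono nonneg)
      then show ?thesis unfolding u_def v_def by (simp add: algebra_simps)
    qed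
  qed
  also have "\<dots> = (2 / ln y) * ((\<Sum>n | 2 * real n \<le> y. c n) + (\<Sum>n | 2 * real n \<le> y. c n * (ln (real n) / ln (y / real n))))"
    by (simp only: sum.distrib sum_distrib_left[symmetric])
  also have "\<dots> \<le> (2 / ln y) * ((ln (ln y) + (\<bar>M\<bar> + K1 / ln 2)) + (ln (ln y) - ln (ln 2) + (1 + 4 * C) / ln 2))"
  proof (intro mult_left_mono add_mono inv_log_weighted_sum[OF assms])
    have "(\<Sum>n | 2 * real n \<le> y. c n) \<le> A y"
      unfolding A_def by (intro sum_mono2) (auto simp: nonneg)
    also have "\<dots> \<le> ln (ln y) + (\<bar>M\<bar> + K1 / ln 2)" using assms by (intro A_le) auto
    finally show "(\<Sum>n | 2 * real n \<le> y. c n) \<le> ln (ln y) + (\<bar>M\<bar> + K1 / ln 2)" .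
  qed (use ly in auto)
  finally show ?thesis by (simp add: algebra_simps)
qed

text \<open>In the variable \<open>s = ln n / ln y\<close> the weight looks like
  \<open>ds / s\<close>, so the moment of order \<open>k + 1\<close> is the integral of
  \<open>s^k\<close> over the unit interval. It matters that the error is independent of
  \<open>k\<close>: the expansion of \<open>- ln (1 - s)\<close> will use all orders up to about
  \<open>(ln y)^2\<close>.\<close>

lemma power_sum_asymp:
  assumes "2 \<le> y"
  shows "\<bar>(\<Sum>n | real n \<le> y. c n * (ln (real n) / ln y) ^ Suc k) - 1 / real (Suc k)\<bar> \<le> (4 * C + 2) / ln y"
proof -
  define N where "N = nat \<lfloor>y\<rfloor>"
  have N: "2 \<le> N" "real N \<le> y" "y \<le> real N + 1"
    using ln_floor_ge_half[OF assms] by (auto simp: N_def)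
  define U where "U = ln y"
  have U: "0 < U" using assms by (simp add: U_def)
  define s where "s = (\<lambda>n::nat. ln (real n) / U)"
  have s_le: "s n \<le> 1" if "n \<le> N" for n
  proof (cases "n = 0")
    case False
    then have "ln (real n) \<le> U" using that N unfolding U_def by (subst ln_le_cancel_iff) auto
    then show ?thesis using U by (simp add: s_def)
  qed (simp add: s_def)
  have s0: "0 \<le> s n" for n using U by (cases "n = 0") (auto simp: s_def)
  have s_mono: "s m \<le> s n" if "1 \<le> m" "m \<le> n" for m n
    using that U by (auto simp: s_def intro!: divide_right_mono)
  define \<phi> where "\<phi> = (\<lambda>n. s n ^ k / U)"
  have e1: "(\<Sum>n | real n \<le> y. c n * (ln (real n) / ln y) ^ Suc k) = (\<Sum>n=2..N. c n * ln (real n) * \<phi> n)"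
    using sum_real_le[of y "\<lambda>n. (ln (real n) / ln y) ^ Suc k"] assms
    by (simp add: N_def s_def \<phi>_def U_def mult_ac)
  have e2: "\<bar>(\<Sum>n=2..N. c n * ln (real n) * \<phi> n) - (\<Sum>n=2..N. (ln (real n) - ln (real n - 1)) * \<phi> n)\<bar> \<le> 4 * C * \<phi> N"
    using N U s0 by (intro weighted_mono) (auto simp: \<phi>_def intro!: divide_right_mono power_mono s_mono)
  have "\<phi> N \<le> 1 / U" unfolding \<phi>_def using U s0 s_le by (intro divide_right_mono power_le_one) auto
  then have e3: "4 * C * \<phi> N \<le> 4 * C * (1 / U)" using C_nonneg by (intro mult_left_mono) auto
  have e4: "\<bar>(\<Sum>n=2..N. (ln (real n) - ln (real n - 1)) * \<phi> n) - s N ^ Suc k / real (Suc k)\<bar> \<le> 1 / U"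
  proof -
    have t1: "s N ^ Suc k / real (Suc k) = (\<Sum>n=2..N. s n ^ Suc k / real (Suc k) - s (n - 1) ^ Suc k / real (Suc k))"
      using telescope_pred[of 2 N "\<lambda>n. s n ^ Suc k / real (Suc k)"] N by (simp add: s_def)
    have "\<bar>(\<Sum>n=2..N. (ln (real n) - ln (real n - 1)) * \<phi> n) - s N ^ Suc k / real (Suc k)\<bar>
        \<le> (\<Sum>n=2..N. s n ^ k / U - s (n - 1) ^ k / U)"
      unfolding t1 sum_subtractf[symmetric, of "\<lambda>n. (ln (real n) - ln (real n - 1)) * \<phi> n"]
    proof (rule order.trans[OF sum_abs], rule sum_mono)
      fix n assume n: "n \<in> {2..N}"
      define a b where "a = s (n - 1)" and "b = s n"
      have ab: "0 \<le> a" "a \<le> b" using s0 s_mono[of "n - 1" n] n by (auto simp: a_def b_def)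
      have d: "ln (real n) - ln (real n - 1) = U * (b - a)"
        using n U by (simp add: a_def b_def s_def of_nat_diff field_simps)
      have d1: "b - a \<le> 1 / U" using ln_step_bounds[of n] n d U by (simp add: field_simps)
      have p1: "b ^ Suc k / real (Suc k) - a ^ Suc k / real (Suc k) \<le> (b - a) * b ^ k"
        using power_diff_le[OF ab, of k] by (simp add: diff_divide_distrib[symmetric] pos_divide_le_eq mult_ac del: power_Suc of_nat_Suc)
      have p2: "(b - a) * a ^ k \<le> b ^ Suc k / real (Suc k) - a ^ Suc k / real (Suc k)"
        using power_diff_ge[OF ab, of k] by (simp add: diff_divide_distrib[symmetric] pos_le_divide_eq mult_ac del: power_Suc of_nat_Suc)
      have "(b - a) * (b ^ k - a ^ k) \<le> 1 / U * (b ^ k - a ^ k)"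
        using d1 ab by (intro mult_right_mono) (auto intro: power_mono)
      then have "\<bar>(b - a) * b ^ k - (b ^ Suc k / real (Suc k) - a ^ Suc k / real (Suc k))\<bar> \<le> b ^ k / U - a ^ k / U"
        using p1 p2 by (simp add: algebra_simps)
      moreover have "(ln (real n) - ln (real n - 1)) * \<phi> n = (b - a) * b ^ k"
        using U by (simp add: d \<phi>_def b_def)
      ultimately show "\<bar>(ln (real n) - ln (real n - 1)) * \<phi> n - (s n ^ Suc k / real (Suc k) - s (n - 1) ^ Suc k / real (Suc k))\<bar>
          \<le> s n ^ k / U - s (n - 1) ^ k / U"
        unfolding a_def b_def by simp
    qed
    also have "\<dots> = s N ^ k / U - s 1 ^ k / U"
      using telescope_pred[of 2 N "\<lambda>n. s n ^ k / U"] N by simp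
    also have "\<dots> \<le> 1 / U"
    proof -
      have "s N ^ k / U \<le> 1 / U" using U s0 s_le by (intro divide_right_mono power_le_one) auto
      moreover have "0 \<le> s 1 ^ k / U" using U s0[of 1] by simp
      ultimately show ?thesis by linarith
    qed
    finally show ?thesis .
  qed
  \<comment> \<open>\<open>s N\<close> falls short of 1 because \<open>N\<close> is only the integer
    part of \<open>y\<close>; the factor \<open>k + 1\<close> lost in taking the power is regained
    by the division by \<open>k + 1\<close>.\<close>
  have e5: "\<bar>s N ^ Suc k / real (Suc k) - 1 / real (Suc k)\<bar> \<le> 1 / U"
  proof -
    have "ln y - ln (real N) \<le> (y - real N) / real N" using N by (intro ln_diff_bounds) auto
    also have "\<dots> \<le> 1" using N by (simp add: field_simps)
    finally have "(U - ln (real N)) / U \<le> 1 / U" using U by (intro divide_right_mono) (auto simp: U_def)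
    then have "1 - s N \<le> 1 / U" using U by (simp add: s_def diff_divide_distrib)
    moreover have "1 - s N ^ Suc k \<le> real (Suc k) * (1 - s N)"
      using power_diff_le[of "s N" 1 k] s0 s_le by simp
    ultimately have "1 - s N ^ Suc k \<le> real (Suc k) * (1 / U)"
      by (meson mult_left_mono of_nat_0_le_iff order_trans)
    then have "1 / real (Suc k) - s N ^ Suc k / real (Suc k) \<le> 1 / U"
      by (simp add: field_simps del: power_Suc)
    moreover have "s N ^ Suc k / real (Suc k) \<le> 1 / real (Suc k)"
      using s0 s_le by (intro divide_right_mono power_le_one) auto
    ultimately show ?thesis by linarith
  qed
  have "(4 * C + 2) / ln y = 4 * C * (1 / U) + 1 / U + 1 / U" by (simp add: U_def add_divide_distrib)
  then show ?thesis unfolding e1 using e2 e3 e4 e5 by linarith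
qed

lemma finite_double_le [simp]: "finite {n. 2 * real n \<le> y}"
  by (rule finite_subset[OF _ finite_real_nat_le[of "y / 2"]]) auto

lemma split_half:
  assumes "0 \<le> y"
  shows "(\<Sum>n | real n \<le> y. f n) = (\<Sum>n | 2 * real n \<le> y. f n) + (\<Sum>n | real n \<le> y \<and> y < 2 * real n. f n)"
proof -
  have "{n. real n \<le> y} = {n. 2 * real n \<le> y} \<union> {n. real n \<le> y \<and> y < 2 * real n}" using assms by auto
  then show ?thesis by (simp only:) (subst sum.union_disjoint, auto)
qed

lemma upper_half_sum:
  assumes "4 \<le> y"
  shows "(\<Sum>n | real n \<le> y \<and> y < 2 * real n. c n) \<le> (2 + 3 * K1) / ln y"
proof -
  have "{n. real n \<le> y / 2} = {n. 2 * real n \<le> y}" by auto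
  then have "A (y / 2) = (\<Sum>n | 2 * real n \<le> y. c n)" by (simp add: A_def)
  then show ?thesis using split_half[of y c] dyadic_block[OF assms] assms by (simp add: A_def)
qed

text \<open>Expanding \<open>- ln (1 - s)\<close> into \<open>s^k / k\<close> and inserting the
  moments \<open>1 / k\<close> gives \<open>\<Sum> 1 / k^2\<close>. The errors of the moments are
  multiplied by a harmonic sum of size \<open>O(ln (ln y))\<close>, which explains the shape of the
  bound.\<close>

lemma log_weighted_sum_asymp:
  assumes "4 \<le> y"
  shows "\<bar>(\<Sum>n | 2 * real n \<le> y. c n * (- ln (1 - ln (real n) / ln y))) - zeta 2\<bar>
    \<le> (A y / ln 2 + (4 * C + 4 + 3 * K1) * (2 + 2 * ln (ln y)) + 1) / ln y"
proof -
  define U where "U = ln y"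
  have "exp 1 < (4::real)" using exp_le by linarith
  then have "1 \<le> U" unfolding U_def using assms by (subst ln_ge_iff) auto
  \<comment> \<open>Because of \<open>2 * n \<le> y\<close> the distance \<open>1 - s n\<close> is
    at least \<open>ln 2 / U\<close>. So the tail \<open>1 / (K * (1 - s n))\<close> becomes
    \<open>O(1 / U)\<close> with \<open>K\<close> of order \<open>U^2\<close>, while
    \<open>ln K\<close> remains \<open>O(ln U)\<close>.\<close>
  define K where "K = nat \<lceil>U\<^sup>2\<rceil>"
  have K: "U\<^sup>2 \<le> real K" "real K \<le> U\<^sup>2 + 1" unfolding K_def
    using of_int_ceiling_le_add_one[of "U\<^sup>2"] zero_le_power2[of U] by (auto simp: le_of_int_ceiling)
  have "1 \<le> U\<^sup>2" using \<open>1 \<le> U\<close> by (simp add: one_le_power)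
  then have K1': "1 \<le> K" "real K \<le> 2 * U\<^sup>2" using K by linarith+
  define s where "s = (\<lambda>n::nat. ln (real n) / U)"
  define f where "f = (\<lambda>n. \<Sum>k=1..K. s n ^ k / real k)"
  define H where "H = (\<Sum>k=1..K. 1 / real k)"
  have s0: "0 \<le> s n" for n using \<open>1 \<le> U\<close> by (cases "n = 0") (auto simp: s_def)
  have H: "H \<le> 2 + 2 * ln U" "0 \<le> H"
  proof -
    have "ln (real K) \<le> ln (2 * U\<^sup>2)" using K1' by (subst ln_le_cancel_iff) auto
    also have "\<dots> = ln 2 + 2 * ln U" using \<open>1 \<le> U\<close> by (simp add: ln_mult ln_realpow)
    finally show "H \<le> 2 + 2 * ln U"
      unfolding H_def using sum_inverse_le_ln[OF K1'(1)] ln_2_less_1 by linarith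
    show "0 \<le> H" unfolding H_def by (intro sum_nonneg) auto
  qed
  have 1: "\<bar>(\<Sum>n | 2 * real n \<le> y. c n * (- ln (1 - s n))) - (\<Sum>n | 2 * real n \<le> y. c n * f n)\<bar> \<le> A y / ln 2 / U"
  proof -
    have "\<bar>(\<Sum>n | 2 * real n \<le> y. c n * (- ln (1 - s n))) - (\<Sum>n | 2 * real n \<le> y. c n * f n)\<bar>
       \<le> (\<Sum>n | 2 * real n \<le> y. c n * (1 / ln 2 / U))"
      unfolding sum_subtractf[symmetric]
    proof (rule order.trans[OF sum_abs], rule sum_mono)
      fix n assume n: "n \<in> {n. 2 * real n \<le> y}"
      show "\<bar>c n * (- ln (1 - s n)) - c n * f n\<bar> \<le> c n * (1 / ln 2 / U)"
      proof (cases "n < 2")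
        case True then show ?thesis by (simp add: c_small)
      next
        case False
        have "ln (real n) \<le> ln (y / 2)" using n False by (subst ln_le_cancel_iff) auto
        also have "\<dots> = U - ln 2" using assms by (simp add: U_def ln_div)
        finally have d: "ln 2 / U \<le> 1 - s n" using \<open>1 \<le> U\<close> by (simp add: s_def field_simps)
        have "0 < ln 2 / U" using \<open>1 \<le> U\<close> by simp
        with d have s1: "s n < 1" by linarith
        have "1 / (real K * (1 - s n)) \<le> 1 / (U\<^sup>2 * (ln 2 / U))"
          using d K \<open>1 \<le> U\<close> K1' s1 by (intro divide_left_mono mult_mono mult_pos_pos) auto
        also have "\<dots> = 1 / ln 2 / U" using \<open>1 \<le> U\<close> by (simp add: power2_eq_square)
        finally have "\<bar>- ln (1 - s n) - f n\<bar> \<le> 1 / ln 2 / U"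
          using neg_ln_one_minus_partial_sum[OF s0 s1 K1'(1)] unfolding f_def by linarith
        then have "c n * \<bar>- ln (1 - s n) - f n\<bar> \<le> c n * (1 / ln 2 / U)" by (intro mult_left_mono nonneg)
        moreover have "\<bar>c n * (- ln (1 - s n)) - c n * f n\<bar> = c n * \<bar>- ln (1 - s n) - f n\<bar>"
        proof -
          have "c n * (- ln (1 - s n)) - c n * f n = c n * (- ln (1 - s n) - f n)" by (simp add: algebra_simps)
          then show ?thesis using nonneg[of n] by (simp add: abs_mult)
        qed
        ultimately show ?thesis by simp
      qed
    qed
    also have "\<dots> = (\<Sum>n | 2 * real n \<le> y. c n) * (1 / ln 2 / U)" by (simp only: sum_distrib_right)
    also have "\<dots> \<le> A y * (1 / ln 2 / U)"
      unfolding A_def using \<open>1 \<le> U\<close> by (intro mult_right_mono sum_mono2) (auto simp: nonneg)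
    finally show ?thesis by simp
  qed
  \<comment> \<open>The moments are known for the full range \<open>n \<le> y\<close>. On its upper
    half the truncated series stays below the harmonic sum \<open>H\<close>, although
    \<open>- ln (1 - s)\<close> is singular at \<open>s = 1\<close>.\<close>
  have 2: "(\<Sum>n | real n \<le> y. c n * f n) - (\<Sum>n | 2 * real n \<le> y. c n * f n) \<in> {0..(2 + 3 * K1) * H / U}"
  proof -
    have f0: "0 \<le> f n" for n unfolding f_def using s0 by (intro sum_nonneg) auto
    have "(\<Sum>n | real n \<le> y \<and> y < 2 * real n. c n * f n) \<le> (\<Sum>n | real n \<le> y \<and> y < 2 * real n. c n * H)"
    proof (intro sum_mono mult_left_mono nonneg)
      fix n assume "n \<in> {n. real n \<le> y \<and> y < 2 * real n}"
      then have n: "real n \<le> y" "0 < n" using assms by (auto intro: ccontr)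
      then have "ln (real n) \<le> U" unfolding U_def by (subst ln_le_cancel_iff) auto
      then have "s n \<le> 1" using \<open>1 \<le> U\<close> by (simp add: s_def)
      then show "f n \<le> H" unfolding f_def H_def using s0 by (intro sum_mono divide_right_mono power_le_one) auto
    qed
    also have "\<dots> = (\<Sum>n | real n \<le> y \<and> y < 2 * real n. c n) * H" by (simp only: sum_distrib_right)
    also have "\<dots> \<le> (2 + 3 * K1) / U * H" unfolding U_def using assms H by (intro mult_right_mono upper_half_sum)
    finally show ?thesis using split_half[of y "\<lambda>n. c n * f n"] assms
      by (auto intro!: sum_nonneg mult_nonneg_nonneg nonneg f0)
  qed
  have 3: "\<bar>(\<Sum>n | real n \<le> y. c n * f n) - (\<Sum>k=1..K. 1 / (real k)\<^sup>2)\<bar> \<le> (4 * C + 2) * H / U"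
  proof -
    have "(\<Sum>n | real n \<le> y. c n * f n) = (\<Sum>k=1..K. 1 / real k * (\<Sum>n | real n \<le> y. c n * s n ^ k))"
      unfolding f_def sum_distrib_left by (subst sum.swap) (simp add: mult_ac)
    then have "\<bar>(\<Sum>n | real n \<le> y. c n * f n) - (\<Sum>k=1..K. 1 / (real k)\<^sup>2)\<bar>
       = \<bar>\<Sum>k=1..K. 1 / real k * ((\<Sum>n | real n \<le> y. c n * s n ^ k) - 1 / real k)\<bar>"
      by (simp add: sum_subtractf right_diff_distrib power2_eq_square)
    also have "\<dots> \<le> (\<Sum>k=1..K. 1 / real k * ((4 * C + 2) / U))"
    proof (rule order.trans[OF sum_abs], rule sum_mono)
      fix k assume k: "k \<in> {1..K}"
      then obtain j where j: "k = Suc j" by (cases k) auto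
      have "\<bar>(\<Sum>n | real n \<le> y. c n * s n ^ k) - 1 / real k\<bar> \<le> (4 * C + 2) / U"
        using power_sum_asymp[of y j] assms unfolding j s_def U_def by simp
      then show "\<bar>1 / real k * ((\<Sum>n | real n \<le> y. c n * s n ^ k) - 1 / real k)\<bar> \<le> 1 / real k * ((4 * C + 2) / U)"
        unfolding abs_mult using k by (intro mult_mono) auto
    qed
    also have "\<dots> = H * ((4 * C + 2) / U)" by (simp only: H_def sum_distrib_right)
    finally show ?thesis by (simp add: mult_ac)
  qed
  have 4: "\<bar>(\<Sum>k=1..K. 1 / (real k)\<^sup>2) - zeta 2\<bar> \<le> 1 / U"
  proof -
    have "U \<le> U\<^sup>2" using \<open>1 \<le> U\<close> by (simp add: power2_eq_square)
    then have "1 / real K \<le> 1 / U" using K \<open>1 \<le> U\<close> by (intro divide_left_mono) auto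
    then show ?thesis using zeta2_partial_sum[OF K1'(1)] by linarith
  qed
  have "\<bar>(\<Sum>n | 2 * real n \<le> y. c n * (- ln (1 - s n))) - zeta 2\<bar>
    \<le> A y / ln 2 / U + (2 + 3 * K1) * H / U + (4 * C + 2) * H / U + 1 / U"
    using 1 2 3 4 by (simp only: atLeastAtMost_iff) linarith
  also have "\<dots> = (A y / ln 2 + (4 * C + 4 + 3 * K1) * H + 1) / U"
    by (simp add: add_divide_distrib algebra_simps)
  also have "\<dots> \<le> (A y / ln 2 + (4 * C + 4 + 3 * K1) * (2 + 2 * ln U) + 1) / U"
    using H C_nonneg K1_pos \<open>1 \<le> U\<close> by (intro divide_right_mono add_mono mult_left_mono) auto
  finally show ?thesis unfolding s_def U_def .
qed

text \<open>Unfolding \<open>A\<close> shows the sum of \<open>c m * c n\<close> over the hyperbolic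
  region \<open>m * n \<le> y\<close>, taken over ordered pairs and with the diagonal.\<close>

definition S2 :: "real \<Rightarrow> real" where
  "S2 y = (\<Sum>m | real m \<le> y. c m * A (y / real m))"

text \<open>\<open>A y - A (y / m)\<close> is close to
  \<open>ln (ln y) - ln (ln (y / m)) = - ln (1 - ln m / ln y)\<close>, the constant \<open>M\<close>
  cancelling. For \<open>m > y / 2\<close> the asymptotics of \<open>A (y / m)\<close> are useless,
  but then \<open>A (y / m) = 0\<close> and the terms add up to
  \<open>O(A y / ln y)\<close>.\<close>

lemma A_sq_minus_S2:
  assumes "4 \<le> y"
  shows "\<bar>(A y)\<^sup>2 - S2 y - (\<Sum>n | 2 * real n \<le> y. c n * (- ln (1 - ln (real n) / ln y)))\<bar>
    \<le> 2 * K1 * (\<Sum>n | 2 * real n \<le> y. c n / ln (y / real n)) + A y * ((2 + 3 * K1) / ln y)"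
proof -
  have ly: "0 < ln y" using assms by simp
  have "(A y)\<^sup>2 - S2 y = (\<Sum>m | real m \<le> y. c m * (A y - A (y / real m)))"
    unfolding S2_def power2_eq_square by (subst (1) A_def) (simp add: sum_subtractf right_diff_distrib sum_distrib_right)
  also have "\<dots> = (\<Sum>m | 2 * real m \<le> y. c m * (A y - A (y / real m))) + (\<Sum>m | real m \<le> y \<and> y < 2 * real m. c m * (A y - A (y / real m)))"
    using assms by (intro split_half) auto
  also have "(\<Sum>m | real m \<le> y \<and> y < 2 * real m. c m * (A y - A (y / real m))) = (\<Sum>m | real m \<le> y \<and> y < 2 * real m. c m * A y)"
  proof (intro sum.cong refl)
    fix m assume "m \<in> {m. real m \<le> y \<and> y < 2 * real m}"
    then have "y / real m < 2" using assms by (auto simp: field_simps)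
    then show "c m * (A y - A (y / real m)) = c m * A y" by (simp add: A_eq_0)
  qed
  also have "\<dots> = A y * (\<Sum>m | real m \<le> y \<and> y < 2 * real m. c m)" by (simp add: sum_distrib_left mult_ac)
  finally have e: "(A y)\<^sup>2 - S2 y = (\<Sum>m | 2 * real m \<le> y. c m * (A y - A (y / real m))) + A y * (\<Sum>m | real m \<le> y \<and> y < 2 * real m. c m)" .
  have p: "A y * (\<Sum>m | real m \<le> y \<and> y < 2 * real m. c m) \<le> A y * ((2 + 3 * K1) / ln y)"
    by (rule mult_left_mono[OF upper_half_sum[OF assms] A_nonneg])
  have p': "0 \<le> A y * (\<Sum>m | real m \<le> y \<and> y < 2 * real m. c m)"
    by (intro mult_nonneg_nonneg sum_nonneg nonneg A_nonneg)
  have "\<bar>(\<Sum>m | 2 * real m \<le> y. c m * (A y - A (y / real m))) - (\<Sum>n | 2 * real n \<le> y. c n * (- ln (1 - ln (real n) / ln y)))\<bar>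
     \<le> (\<Sum>n | 2 * real n \<le> y. 2 * K1 * (c n / ln (y / real n)))"
    unfolding sum_subtractf[symmetric]
  proof (rule order.trans[OF sum_abs], rule sum_mono)
    fix n assume n: "n \<in> {n. 2 * real n \<le> y}"
    show "\<bar>c n * (A y - A (y / real n)) - c n * (- ln (1 - ln (real n) / ln y))\<bar> \<le> 2 * K1 * (c n / ln (y / real n))"
    proof (cases "n < 2")
      case True then show ?thesis by (simp add: c_small)
    next
      case False
      define v where "v = y / real n"
      have v: "2 \<le> v" "v \<le> y" using False n assms by (auto simp: v_def field_simps mult_le_cancel_right1)
      have "1 - ln (real n) / ln y = ln v / ln y"
        using ly False assms by (simp add: v_def ln_div field_simps)
      then have "ln (1 - ln (real n) / ln y) = ln (ln v) - ln (ln y)"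
        using v by (simp add: ln_div)
      moreover have "\<bar>A y - ln (ln y) - M\<bar> \<le> K1 / ln v"
      proof -
        have "K1 / ln y \<le> K1 / ln v" using v K1_pos by (intro divide_left_mono mult_pos_pos) auto
        with A_asymp[of y] assms show ?thesis by simp
      qed
      moreover have "\<bar>A v - ln (ln v) - M\<bar> \<le> K1 / ln v" using v by (intro A_asymp)
      moreover have "2 * K1 / ln v = K1 / ln v + K1 / ln v" by simp
      ultimately have "\<bar>(A y - A v) - (- ln (1 - ln (real n) / ln y))\<bar> \<le> 2 * K1 / ln v"
        unfolding abs_le_iff by linarith
      then have "c n * \<bar>(A y - A v) - (- ln (1 - ln (real n) / ln y))\<bar> \<le> c n * (2 * K1 / ln v)"
        by (intro mult_left_mono nonneg)
      moreover have "\<bar>c n * (A y - A v) - c n * (- ln (1 - ln (real n) / ln y))\<bar> = c n * \<bar>(A y - A v) - (- ln (1 - ln (real n) / ln y))\<bar>"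
        using nonneg[of n] by (simp only: right_diff_distrib[symmetric] abs_mult abs_of_nonneg)
      ultimately show ?thesis unfolding v_def by (simp add: mult_ac)
    qed
  qed
  also have "\<dots> = 2 * K1 * (\<Sum>n | 2 * real n \<le> y. c n / ln (y / real n))" by (simp only: sum_distrib_left)
  finally show ?thesis using e p p' by linarith
qed

text \<open>The constant \<open>\<zeta>(2)\<close> is \<open>\<integral>\<^sub>0\<^sup>1 - ln (1 - s) / s ds\<close>, the measure of the corner \<open>u, v \<le> 1 < u + v\<close>
  under \<open>du dv / (u v)\<close> that the hyperbola \<open>m n \<le> y\<close> cuts off from the square \<open>m, n \<le> y\<close>.\<close>

theorem S2_asymp:
  "(\<lambda>y. S2 y - ((ln (ln y) + M)\<^sup>2 - zeta 2)) \<in> O[at_top](\<lambda>y. ln (ln y) / ln y)"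
proof -
  define K where "K = \<bar>M\<bar> + K1 / ln 2"
  define T where "T = (\<lambda>y. \<Sum>n | 2 * real n \<le> y. c n * (- ln (1 - ln (real n) / ln y)))"
  define E1 where "E1 = (\<lambda>y::real. (2 / ln y) * (2 * ln (ln y) + K - ln (ln 2) + (1 + 4 * C) / ln 2))"
  define E2 where "E2 = (\<lambda>y::real. 2 * K1 * E1 y + (ln (ln y) + K) * ((2 + 3 * K1) / ln y))"
  define E3 where "E3 = (\<lambda>y::real. ((ln (ln y) + K) / ln 2 + (4 * C + 4 + 3 * K1) * (2 + 2 * ln (ln y)) + 1) / ln y)"
  define E4 where "E4 = (\<lambda>y::real. K1 / ln y * (2 * (ln (ln y) + \<bar>M\<bar>) + K1 / ln y))"
  have bnd: "\<bar>S2 y - ((ln (ln y) + M)\<^sup>2 - zeta 2)\<bar> \<le> E2 y + E3 y + E4 y" if y: "4 \<le> y" for y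
  proof -
    have ly: "0 < ln y" using y by simp
    have "exp 1 < (4::real)" using exp_le by linarith
    then have "1 \<le> ln y" using y by (subst ln_ge_iff) auto
    then have lly: "0 \<le> ln (ln y)" by simp
    have Ay: "A y \<le> ln (ln y) + K" unfolding K_def using y by (intro A_le) auto
    have "\<bar>(A y)\<^sup>2 - S2 y - T y\<bar> \<le> 2 * K1 * (\<Sum>n | 2 * real n \<le> y. c n / ln (y / real n)) + A y * ((2 + 3 * K1) / ln y)"
      unfolding T_def by (rule A_sq_minus_S2[OF y])
    also have "\<dots> \<le> E2 y"
      unfolding E2_def using inv_log_sum_le[OF y] Ay K1_pos ly
      by (intro add_mono mult_left_mono mult_right_mono) (auto simp: E1_def K_def)
    finally have 1: "\<bar>(A y)\<^sup>2 - S2 y - T y\<bar> \<le> E2 y" .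
    have "\<bar>T y - zeta 2\<bar> \<le> (A y / ln 2 + (4 * C + 4 + 3 * K1) * (2 + 2 * ln (ln y)) + 1) / ln y"
      unfolding T_def by (rule log_weighted_sum_asymp[OF y])
    also have "\<dots> \<le> E3 y" unfolding E3_def using Ay ly
      by (intro divide_right_mono add_mono order.refl) auto
    finally have 2: "\<bar>T y - zeta 2\<bar> \<le> E3 y" .
    \<comment> \<open>In the square the error \<open>K1 / ln y\<close> of \<open>A y\<close> is
      multiplied by about \<open>2 * ln (ln y)\<close>, which is still admissible.\<close>
    define B where "B = ln (ln y) + M"
    have AB: "\<bar>A y - B\<bar> \<le> K1 / ln y" using A_asymp[of y] y by (simp add: B_def)
    have "(A y)\<^sup>2 - B\<^sup>2 = (A y - B) * (2 * B + (A y - B))" by (simp add: power2_eq_square algebra_simps)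
    then have "\<bar>(A y)\<^sup>2 - B\<^sup>2\<bar> = \<bar>A y - B\<bar> * \<bar>2 * B + (A y - B)\<bar>" by (simp add: abs_mult)
    also have "\<dots> \<le> E4 y" unfolding E4_def
    proof (intro mult_mono AB)
      have "\<bar>B\<bar> \<le> ln (ln y) + \<bar>M\<bar>" using lly by (simp add: B_def)
      then show "\<bar>2 * B + (A y - B)\<bar> \<le> 2 * (ln (ln y) + \<bar>M\<bar>) + K1 / ln y"
        by (intro order.trans[OF abs_triangle_ineq] add_mono AB) (auto simp: abs_mult)
    qed (use K1_pos ly in auto)
    finally show ?thesis using 1 2 unfolding B_def by linarith
  qed
  have "(\<lambda>y. E2 y + E3 y + E4 y) \<in> O[at_top](\<lambda>y. ln (ln y) / ln y)"
  proof -
    \<comment> \<open>The constants have unknown signs and may vanish, so the majorant is decomposed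
      into multiples of a few model functions.\<close>
    have R: "(\<lambda>y::real. D * ((ln (ln y) + a) / ln y)) \<in> O[at_top](\<lambda>y. ln (ln y) / ln y)" for D a :: real
    proof -
      have "(\<lambda>y::real. (ln (ln y) + a) / ln y) \<in> O[at_top](\<lambda>y. ln (ln y) / ln y)" by real_asymp
      then show ?thesis by (cases "D = 0") (simp_all del: times_divide_eq_right)
    qed
    have R': "(\<lambda>y::real. D * (1 / (ln y)\<^sup>2)) \<in> O[at_top](\<lambda>y. ln (ln y) / ln y)" for D :: real
    proof -
      have "(\<lambda>y::real. 1 / (ln y)\<^sup>2) \<in> O[at_top](\<lambda>y. ln (ln y) / ln y)" by real_asymp
      then show ?thesis by (cases "D = 0") (simp_all del: times_divide_eq_right)
    qed
    have R'': "(\<lambda>y::real. 1 / ln y) \<in> O[at_top](\<lambda>y. ln (ln y) / ln y)" by real_asymp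
    define a where "a = (K - ln (ln 2) + (1 + 4 * C) / ln 2) / 2"
    have "(\<lambda>y. E2 y + E3 y + E4 y) =
      (\<lambda>y. (8 * K1) * ((ln (ln y) + a) / ln y) + (2 + 3 * K1) * ((ln (ln y) + K) / ln y)
        + 1 / ln 2 * ((ln (ln y) + K) / ln y) + (2 * (4 * C + 4 + 3 * K1)) * ((ln (ln y) + 1) / ln y) + 1 / ln y
        + (2 * K1) * ((ln (ln y) + \<bar>M\<bar>) / ln y) + K1\<^sup>2 * (1 / (ln y)\<^sup>2))"
    proof
      fix y :: real
      define u w where "u = inverse (ln y)" and "w = ln (ln y)"
      have e: "z / ln y = z * u" "1 / (ln y)\<^sup>2 = u * u" for z
        by (simp_all add: u_def divide_inverse power2_eq_square)
      show "E2 y + E3 y + E4 y = (8 * K1) * ((ln (ln y) + a) / ln y) + (2 + 3 * K1) * ((ln (ln y) + K) / ln y)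
        + 1 / ln 2 * ((ln (ln y) + K) / ln y) + (2 * (4 * C + 4 + 3 * K1)) * ((ln (ln y) + 1) / ln y) + 1 / ln y
        + (2 * K1) * ((ln (ln y) + \<bar>M\<bar>) / ln y) + K1\<^sup>2 * (1 / (ln y)\<^sup>2)"
        unfolding E1_def E2_def E3_def E4_def e w_def[symmetric] a_def
        by (simp add: algebra_simps power2_eq_square add_divide_distrib diff_divide_distrib)
    qed
    then show ?thesis by (simp only:) (intro sum_in_bigo(1) R R' R'')
  qed
  moreover have "(\<lambda>y. S2 y - ((ln (ln y) + M)\<^sup>2 - zeta 2)) \<in> O[at_top](\<lambda>y. E2 y + E3 y + E4 y)"
  proof (rule landau_o.big_mono)
    show "\<forall>\<^sub>F y in at_top. norm (S2 y - ((ln (ln y) + M)\<^sup>2 - zeta 2)) \<le> norm (E2 y + E3 y + E4 y)"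
      using eventually_ge_at_top[of 4] by eventually_elim (use bnd in force)
  qed
  ultimately show ?thesis by (rule landau_o.big.trans[rotated])
qed

section \<open>Sums weighted by powers of n, for the error terms\<close>

lemma ln_powr_sum_le:
  assumes "0 < \<beta>" "\<beta> \<le> 1" "1 \<le> y"
  shows "(\<Sum>n | real n \<le> y. c n * (ln (real n) * real n powr \<beta>)) \<le> (2 / \<beta> + 4 * C) * y powr \<beta>"
proof (cases "y < 2")
  case True
  then have "(\<Sum>n | real n \<le> y. c n * (ln (real n) * real n powr \<beta>)) = 0"
    by (intro sum.neutral) (auto simp: c_small)
  then show ?thesis using assms C_nonneg by auto
next
  case False
  define N where "N = nat \<lfloor>y\<rfloor>"
  have N: "2 \<le> N" "real N \<le> y" using ln_floor_ge_half[of y] False by (auto simp: N_def)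
  have "(\<Sum>n | real n \<le> y. c n * (ln (real n) * real n powr \<beta>)) = (\<Sum>n=2..N. c n * ln (real n) * real n powr \<beta>)"
    using sum_real_le[of y "\<lambda>n. ln (real n) * real n powr \<beta>"] assms by (simp add: N_def mult_ac)
  also have "\<dots> \<le> (\<Sum>n=2..N. (ln (real n) - ln (real n - 1)) * real n powr \<beta>) + 4 * C * real N powr \<beta>"
  proof -
    have "real k powr \<beta> \<le> real (Suc k) powr \<beta>" for k using assms by (intro powr_mono2) auto
    then show ?thesis using weighted_mono[of 2 N "\<lambda>n. real n powr \<beta>"] N by fastforce
  qed
  also have "(\<Sum>n=2..N. (ln (real n) - ln (real n - 1)) * real n powr \<beta>)
     \<le> (\<Sum>n=2..N. 2 / \<beta> * real n powr \<beta> - 2 / \<beta> * real (n - 1) powr \<beta>)"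
  proof (rule sum_mono)
    fix n assume n: "n \<in> {2..N}"
    define a b where "a = real n - 1" and "b = real n"
    have ab: "1 \<le> a" "b = a + 1" using n by (auto simp: a_def b_def)
    have "1 + \<beta> * (ln b - ln a) \<le> exp (\<beta> * (ln b - ln a))" by (rule exp_ge_add_one_self)
    then have "a powr \<beta> * (1 + \<beta> * (ln b - ln a)) \<le> a powr \<beta> * exp (\<beta> * (ln b - ln a))" by (intro mult_left_mono) auto
    also have "\<dots> = b powr \<beta>" using ab by (simp add: powr_def exp_add[symmetric] algebra_simps)
    finally have 1: "\<beta> * ((ln b - ln a) * a powr \<beta>) \<le> b powr \<beta> - a powr \<beta>" by (simp add: algebra_simps)
    have "b powr \<beta> \<le> (2 * a) powr \<beta>" using ab assms by (intro powr_mono2) auto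
    also have "\<dots> = 2 powr \<beta> * a powr \<beta>" using ab by (simp add: powr_mult)
    also have "\<dots> \<le> 2 * a powr \<beta>"
    proof -
      have "2 powr \<beta> \<le> 2 powr (1::real)" using assms by (intro powr_mono) auto
      then show ?thesis by (intro mult_right_mono) auto
    qed
    finally have "(ln b - ln a) * b powr \<beta> \<le> (ln b - ln a) * (2 * a powr \<beta>)"
      using ab by (intro mult_left_mono) auto
    also have "\<dots> \<le> 2 / \<beta> * (b powr \<beta> - a powr \<beta>)" using 1 assms by (simp add: field_simps)
    finally show "(ln (real n) - ln (real n - 1)) * real n powr \<beta> \<le> 2 / \<beta> * real n powr \<beta> - 2 / \<beta> * real (n - 1) powr \<beta>"
      using n by (simp add: a_def b_def of_nat_diff right_diff_distrib)
  qed
  also have "\<dots> = 2 / \<beta> * real N powr \<beta> - 2 / \<beta> * real 1 powr \<beta>"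
    using telescope_pred[of 2 N "\<lambda>n. 2 / \<beta> * real n powr \<beta>"] N by simp
  also have "\<dots> \<le> 2 / \<beta> * real N powr \<beta>" using assms by simp
  also have "2 / \<beta> * real N powr \<beta> + 4 * C * real N powr \<beta> = (2 / \<beta> + 4 * C) * real N powr \<beta>" by (simp add: algebra_simps)
  also have "\<dots> \<le> (2 / \<beta> + 4 * C) * y powr \<beta>"
    using N assms C_nonneg by (intro mult_left_mono powr_mono2) auto
  finally show ?thesis by simp
qed

text \<open>The logarithm is removed from \<open>ln_powr_sum_le\<close> by a cut at
  \<open>sqrt y\<close>: below it \<open>ln n \<ge> ln 2\<close> and the contribution is only
  \<open>O(y powr (\<beta> / 2))\<close>, above it \<open>ln n \<ge> ln y / 2\<close>.\<close>

lemma powr_sum_le: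
  assumes "0 < \<beta>" "\<beta> \<le> 1"
  shows "\<exists>K>0. \<forall>y\<ge>2. (\<Sum>n | real n \<le> y. c n * real n powr \<beta>) \<le> K * (y powr \<beta> / ln y)"
proof (intro exI conjI allI impI)
  define D where "D = 2 / \<beta> + 4 * C"
  have D: "0 < D" using assms C_nonneg by (simp add: D_def add_pos_nonneg)
  show "0 < 2 * D / (\<beta> * ln 2) + 2 * D" using D assms by (simp add: add_pos_pos)
  fix y :: real assume y: "2 \<le> y"
  have ly: "0 < ln y" using y by simp
  have sy: "sqrt y \<le> y" "1 \<le> sqrt y" using y by (auto intro!: real_le_lsqrt simp: power2_eq_square)
  have "(\<Sum>n | real n \<le> y. c n * real n powr \<beta>)
     \<le> (\<Sum>n | real n \<le> y. (if real n \<le> sqrt y then c n * (ln (real n) * real n powr \<beta>) / ln 2 else 0)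
           + 2 / ln y * (c n * (ln (real n) * real n powr \<beta>)))"
  proof (rule sum_mono)
    fix n
    show "c n * real n powr \<beta> \<le> (if real n \<le> sqrt y then c n * (ln (real n) * real n powr \<beta>) / ln 2 else 0)
           + 2 / ln y * (c n * (ln (real n) * real n powr \<beta>))"
    proof (cases "n < 2")
      case True then show ?thesis by (simp add: c_small)
    next
      case False
      define q where "q = c n * real n powr \<beta>"
      have q: "0 \<le> q" by (simp add: q_def nonneg)
      have l2: "ln 2 \<le> ln (real n)" using False by simp
      show ?thesis
      proof (cases "real n \<le> sqrt y")
        case True
        have "q * 1 \<le> q * (ln (real n) / ln 2)" using l2 q by (intro mult_left_mono) auto
        moreover have "0 \<le> 2 / ln y * (q * ln (real n))" using q l2 ly False by (auto intro!: mult_nonneg_nonneg)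
        ultimately show ?thesis using True by (simp add: q_def mult_ac)
      next
        case False
        then have "ln (sqrt y) \<le> ln (real n)" using sy by (subst ln_le_cancel_iff) linarith+
        then have "1 \<le> 2 / ln y * ln (real n)" using ly y by (simp add: ln_sqrt field_simps)
        then have "q * 1 \<le> q * (2 / ln y * ln (real n))" using q by (intro mult_left_mono) auto
        then show ?thesis using False by (simp add: q_def mult_ac)
      qed
    qed
  qed
  also have "\<dots> = (\<Sum>n | real n \<le> y. if real n \<le> sqrt y then c n * (ln (real n) * real n powr \<beta>) / ln 2 else 0)
      + 2 / ln y * (\<Sum>n | real n \<le> y. c n * (ln (real n) * real n powr \<beta>))"
    by (simp only: sum.distrib sum_distrib_left)
  also have "(\<Sum>n | real n \<le> y. if real n \<le> sqrt y then c n * (ln (real n) * real n powr \<beta>) / ln 2 else 0)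
      = (\<Sum>n | real n \<le> sqrt y. c n * (ln (real n) * real n powr \<beta>)) / ln 2"
  proof -
    have "{n. real n \<le> y} \<inter> {n. real n \<le> sqrt y} = {n. real n \<le> sqrt y}" using sy by auto
    then show ?thesis by (simp add: sum.If_cases sum_divide_distrib)
  qed
  also have "\<dots> \<le> D * sqrt y powr \<beta> / ln 2"
    unfolding D_def using assms sy by (intro divide_right_mono ln_powr_sum_le) auto
  also have "2 / ln y * (\<Sum>n | real n \<le> y. c n * (ln (real n) * real n powr \<beta>)) \<le> 2 / ln y * (D * y powr \<beta>)"
    unfolding D_def using assms y ly by (intro mult_left_mono ln_powr_sum_le) auto
  also have "D * sqrt y powr \<beta> / ln 2 \<le> 2 * D / (\<beta> * ln 2) * (y powr \<beta> / ln y)"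
  proof -
    have s: "sqrt y powr \<beta> = y powr (\<beta> / 2)" using y by (simp add: powr_half_sqrt[symmetric] powr_powr)
    have "ln y \<le> y powr (\<beta> / 2) / (\<beta> / 2)" using y assms by (intro ln_powr_bound) auto
    then have "sqrt y powr \<beta> * ln y \<le> sqrt y powr \<beta> * (y powr (\<beta> / 2) / (\<beta> / 2))" by (intro mult_left_mono) auto
    also have "\<dots> = 2 / \<beta> * y powr \<beta>" unfolding s using y by (simp add: powr_add[symmetric])
    finally have "sqrt y powr \<beta> \<le> 2 / \<beta> * y powr \<beta> / ln y" using ly by (simp only: pos_le_divide_eq)
    then have "D / ln 2 * sqrt y powr \<beta> \<le> D / ln 2 * (2 / \<beta> * y powr \<beta> / ln y)" using D by (intro mult_left_mono) auto
    then show ?thesis by (simp add: mult_ac)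
  qed
  also have "2 * D / (\<beta> * ln 2) * (y powr \<beta> / ln y) + 2 / ln y * (D * y powr \<beta>)
     = (2 * D / (\<beta> * ln 2) + 2 * D) * (y powr \<beta> / ln y)" by (simp add: algebra_simps)
  finally show "(\<Sum>n | real n \<le> y. c n * real n powr \<beta>) \<le> (2 * D / (\<beta> * ln 2) + 2 * D) * (y powr \<beta> / ln y)" by simp
qed

text \<open>The inner sum is estimated at \<open>y / m\<close>. Since
  \<open>m powr \<beta> * (y / m) powr \<beta> = y powr \<beta>\<close>, what remains is the sum of
  \<open>c m / ln (y / m)\<close>. With \<open>\<beta> = 1 - \<theta>\<close> and the weight
  \<open>1 / p\<close> this is the accumulated error over pairs of primes.\<close>

lemma powr_pair_sum_bigo:
  assumes "0 < \<beta>" "\<beta> \<le> 1"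
  shows "(\<lambda>y. \<Sum>m | real m \<le> y. c m * real m powr \<beta> * (\<Sum>n | real n \<le> y / real m. c n * real n powr \<beta>))
    \<in> O[at_top](\<lambda>y. y powr \<beta> * ln (ln y) / ln y)"
proof -
  obtain K where K: "0 < K" "\<And>y. 2 \<le> y \<Longrightarrow> (\<Sum>n | real n \<le> y. c n * real n powr \<beta>) \<le> K * (y powr \<beta> / ln y)"
    using powr_sum_le[OF assms] by blast
  define P where "P = (\<lambda>y. \<Sum>n | real n \<le> y. c n * real n powr \<beta>)"
  have P0: "P y = 0" if "y < 2" for y unfolding P_def using that by (intro sum.neutral) (auto simp: c_small)
  have Pnn: "0 \<le> P y" for y unfolding P_def by (intro sum_nonneg) (auto simp: nonneg)
  define E where "E = (\<lambda>y::real. K * y powr \<beta> * ((2 / ln y) * (2 * ln (ln y) + (\<bar>M\<bar> + K1 / ln 2) - ln (ln 2) + (1 + 4 * C) / ln 2)))"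
  have bnd: "norm (\<Sum>m | real m \<le> y. c m * real m powr \<beta> * P (y / real m)) \<le> norm (E y)" if y: "4 \<le> y" for y
  proof -
    have "(\<Sum>m | real m \<le> y \<and> y < 2 * real m. c m * real m powr \<beta> * P (y / real m)) = 0"
    proof (rule sum.neutral, rule ballI)
      fix m assume "m \<in> {m. real m \<le> y \<and> y < 2 * real m}"
      then have "y / real m < 2" using y by (auto simp: field_simps)
      then show "c m * real m powr \<beta> * P (y / real m) = 0" by (simp add: P0)
    qed
    then have "(\<Sum>m | real m \<le> y. c m * real m powr \<beta> * P (y / real m)) = (\<Sum>m | 2 * real m \<le> y. c m * real m powr \<beta> * P (y / real m))"
      using split_half[of y "\<lambda>m. c m * real m powr \<beta> * P (y / real m)"] y by simp
    also have "\<dots> \<le> (\<Sum>m | 2 * real m \<le> y. K * y powr \<beta> * (c m / ln (y / real m)))"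
    proof (rule sum_mono)
      fix m assume m: "m \<in> {m. 2 * real m \<le> y}"
      show "c m * real m powr \<beta> * P (y / real m) \<le> K * y powr \<beta> * (c m / ln (y / real m))"
      proof (cases "m < 2")
        case True then show ?thesis by (simp add: c_small)
      next
        case False
        then have "2 \<le> y / real m" using m by (simp add: field_simps)
        then have "P (y / real m) \<le> K * ((y / real m) powr \<beta> / ln (y / real m))" unfolding P_def by (rule K)
        then have "c m * real m powr \<beta> * P (y / real m) \<le> c m * real m powr \<beta> * (K * ((y / real m) powr \<beta> / ln (y / real m)))"
          by (intro mult_left_mono) (auto simp: nonneg)
        also have "\<dots> = K * (real m powr \<beta> * (y / real m) powr \<beta>) * (c m / ln (y / real m))" by (simp add: mult_ac)
        also have "real m powr \<beta> * (y / real m) powr \<beta> = y powr \<beta>" using False y by (simp add: powr_divide)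
        finally show ?thesis .
      qed
    qed
    also have "\<dots> = K * y powr \<beta> * (\<Sum>m | 2 * real m \<le> y. c m / ln (y / real m))" by (simp only: sum_distrib_left)
    also have "\<dots> \<le> E y" unfolding E_def using K y by (intro mult_left_mono inv_log_sum_le) auto
    finally have "(\<Sum>m | real m \<le> y. c m * real m powr \<beta> * P (y / real m)) \<le> E y" .
    moreover have "0 \<le> (\<Sum>m | real m \<le> y. c m * real m powr \<beta> * P (y / real m))"
      by (intro sum_nonneg mult_nonneg_nonneg nonneg Pnn) auto
    ultimately show ?thesis by auto
  qed
  have "E \<in> O[at_top](\<lambda>y. y powr \<beta> * ln (ln y) / ln y)"
  proof -
    have "(\<lambda>y::real. (2 / ln y) * (2 * ln (ln y) + D - D' + E')) \<in> O[at_top](\<lambda>y. ln (ln y) / ln y)" for D D' E' :: real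
      by real_asymp
    from this[of "\<bar>M\<bar> + K1 / ln 2" "ln (ln 2)" "(1 + 4 * C) / ln 2"] have "(\<lambda>y. K * y powr \<beta> * ((2 / ln y) * (2 * ln (ln y) + (\<bar>M\<bar> + K1 / ln 2) - ln (ln 2) + (1 + 4 * C) / ln 2)))
       \<in> O[at_top](\<lambda>y. y powr \<beta> * (ln (ln y) / ln y))"
      by (intro landau_o.big.mult) auto
    then show ?thesis by (simp add: E_def)
  qed
  moreover have "(\<lambda>y. \<Sum>m | real m \<le> y. c m * real m powr \<beta> * P (y / real m)) \<in> O[at_top](E)"
    by (rule landau_o.big_mono, use eventually_ge_at_top[of 4] in eventually_elim) (rule bnd)
  ultimately show ?thesis unfolding P_def by (rule landau_o.big.trans[rotated])
qed

end

section \<open>Chebyshev's bound and Mertens' first theorem\<close>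

definition chebyshev_theta :: "nat \<Rightarrow> real" where
  "chebyshev_theta n = (\<Sum>p | prime p \<and> p \<le> n. ln (real p))"

lemma finite_primes_le [simp]: "finite {p::nat. prime p \<and> p \<le> n}"
  by (rule finite_subset[of _ "{..n}"]) auto

lemma prod_primes_dvd:
  fixes P :: "nat set"
  assumes "finite P" "\<And>p. p \<in> P \<Longrightarrow> prime p" "\<And>p. p \<in> P \<Longrightarrow> p dvd n"
  shows "\<Prod>P dvd n"
  using assms
proof (induction P rule: finite_induct)
  case (insert p P)
  have "coprime p (\<Prod>P)"
    using insert by (intro prod_coprime_right) (auto intro!: primes_coprime)
  then show ?case using insert by (auto intro: divides_mult)
qed simp

text \<open>The primes in \<open>m + 2..2 * m + 1\<close> divide the binomial coefficient
  \<open>2 * m + 1\<close> over \<open>m\<close>. It occurs twice in a row of sum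
  \<open>2^(2 * m + 1)\<close>, hence it is at most \<open>4^m\<close>.\<close>

lemma chebyshev_theta_odd_step: "chebyshev_theta (2 * m + 1) - chebyshev_theta (m + 1) \<le> real m * ln 4"
proof -
  define P where "P = {p. prime p \<and> m + 1 < p \<and> p \<le> 2 * m + 1}"
  have fin: "finite P" unfolding P_def by (rule finite_subset[of _ "{..2*m+1}"]) auto
  have "\<Prod>P dvd (2 * m + 1) choose m"
  proof (rule prod_primes_dvd[OF fin])
    fix p assume p: "p \<in> P"
    then show "prime p" by (simp add: P_def)
    have "fact m * fact (m + 1) * ((2 * m + 1) choose m) = (fact (2 * m + 1) :: nat)"
      using binomial_fact_lemma[of m "2 * m + 1"] by (simp add: algebra_simps)
    moreover have "p dvd (fact (2 * m + 1) :: nat)" using p by (subst prime_dvd_fact_iff) (auto simp: P_def)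
    moreover have "\<not> p dvd (fact m :: nat)" "\<not> p dvd (fact (m + 1) :: nat)"
      using p by (subst prime_dvd_fact_iff; simp add: P_def)+
    ultimately show "p dvd (2 * m + 1) choose m"
      using \<open>prime p\<close> by (metis prime_dvd_mult_iff)
  qed
  then have "\<Prod>P \<le> (2 * m + 1) choose m" by (intro dvd_imp_le) auto
  also have "\<dots> \<le> 4 ^ m"
  proof -
    have "2 * ((2 * m + 1) choose m) = ((2 * m + 1) choose m) + ((2 * m + 1) choose (m + 1))"
      using binomial_symmetric[of m "2 * m + 1"] by simp
    also have "\<dots> = (\<Sum>k\<in>{m, m + 1}. (2 * m + 1) choose k)" by simp
    also have "\<dots> \<le> (\<Sum>k\<le>2 * m + 1. (2 * m + 1) choose k)" by (intro sum_mono2) auto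
    also have "\<dots> = 2 ^ (2 * m + 1)" by (rule choose_row_sum)
    also have "\<dots> = 2 * 4 ^ m" by (simp add: power_mult)
    finally show ?thesis by simp
  qed
  finally have "real (\<Prod>P) \<le> real (4 ^ m)" by (simp only: of_nat_le_iff)
  then have "real (\<Prod>P) \<le> 4 ^ m" by simp
  moreover have "0 < real (\<Prod>P)" using fin by (auto simp: P_def prime_gt_0_nat intro!: prod_pos)
  ultimately have "ln (real (\<Prod>P)) \<le> ln (4 ^ m)" by (subst ln_le_cancel_iff) auto
  also have "\<dots> = real m * ln 4" by (simp add: ln_realpow)
  also have "ln (real (\<Prod>P)) = (\<Sum>p\<in>P. ln (real p))"
    unfolding of_nat_prod using fin by (subst ln_prod) (auto simp: P_def prime_gt_0_nat)
  also have "\<dots> = chebyshev_theta (2 * m + 1) - chebyshev_theta (m + 1)"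
  proof -
    have "{p. prime p \<and> p \<le> 2 * m + 1} = {p. prime p \<and> p \<le> m + 1} \<union> P" by (auto simp: P_def)
    then show ?thesis unfolding chebyshev_theta_def using fin by (simp only:) (subst sum.union_disjoint, auto simp: P_def)
  qed
  finally show ?thesis .
qed

text \<open>An odd \<open>n = 2 * m + 1\<close> descends to \<open>m + 1\<close> by the binomial
  step, an even \<open>n > 2\<close> to \<open>n - 1\<close> because it is not prime.\<close>

lemma chebyshev_theta_le: "chebyshev_theta n \<le> real n * ln 4"
proof (induction n rule: less_induct)
  case (less n)
  consider "n \<le> 1" | "n = 2" | "n > 2" "even n" | "n > 2" "odd n" by linarith
  then show ?case
  proof cases
    case 1
    then have e: "{p. prime p \<and> p \<le> n} = {}" by (auto dest: prime_gt_1_nat)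
    show ?thesis unfolding chebyshev_theta_def e by simp
  next
    case 2
    have "{p::nat. prime p \<and> p \<le> 2} = {2}"
      by (auto dest: prime_ge_2_nat intro: antisym)
    moreover have "ln 2 \<le> ln (4::real)" "0 \<le> ln (4::real)" by auto
    then have "ln 2 \<le> 2 * ln (4::real)" by linarith
    ultimately show ?thesis using 2 by (simp add: chebyshev_theta_def)
  next
    case 3
    have "{p. prime p \<and> p \<le> n} = {p. prime p \<and> p \<le> n - 1}"
    proof -
      have "\<not> prime n" using 3 prime_odd_nat by blast
      then have "p \<le> n - 1" if "prime p" "p \<le> n" for p
        using that by (cases "p = n") auto
      then show ?thesis by auto
    qed
    then have "chebyshev_theta n = chebyshev_theta (n - 1)" by (simp add: chebyshev_theta_def)
    also have "\<dots> \<le> real (n - 1) * ln 4" using 3 by (intro less) auto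
    also have "\<dots> \<le> real n * ln 4" by (intro mult_right_mono) auto
    finally show ?thesis .
  next
    case 4
    then obtain m where m: "n = 2 * m + 1" "1 \<le> m" by (auto elim!: oddE)
    have "chebyshev_theta n \<le> chebyshev_theta (m + 1) + real m * ln 4" using chebyshev_theta_odd_step[of m] m by simp
    also have "\<dots> \<le> real (m + 1) * ln 4 + real m * ln 4" using m less[of "m + 1"] by simp
    also have "\<dots> = real n * ln 4" using m by (simp add: algebra_simps)
    finally show ?thesis .
  qed
qed

section \<open>Legendre's formula and Mertens' first theorem\<close>

lemma ln_prime_factorization:
  assumes "0 < (m::nat)" "m \<le> n"
  shows "ln (real m) = (\<Sum>p | prime p \<and> p \<le> n. real (multiplicity p m) * ln (real p))"
proof -
  have "real m = (\<Prod>p\<in>prime_factors m. real p ^ multiplicity p m)"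
    using prime_factorization_nat[OF assms(1)] by (metis (no_types, lifting) of_nat_power of_nat_prod prod.cong)
  then have "ln (real m) = ln (\<Prod>p\<in>prime_factors m. real p ^ multiplicity p m)" by simp
  also have "\<dots> = (\<Sum>p\<in>prime_factors m. ln (real p ^ multiplicity p m))"
    by (intro ln_prod) (auto simp: prime_gt_0_nat in_prime_factors_imp_prime)
  also have "\<dots> = (\<Sum>p\<in>prime_factors m. real (multiplicity p m) * ln (real p))"
    by (intro sum.cong) (auto simp: ln_realpow prime_gt_0_nat in_prime_factors_imp_prime)
  also have "\<dots> = (\<Sum>p | prime p \<and> p \<le> n. real (multiplicity p m) * ln (real p))"
  proof (rule sum.mono_neutral_left)
    show "prime_factors m \<subseteq> {p. prime p \<and> p \<le> n}"
      using assms by (auto simp: prime_factors_dvd dest: dvd_imp_le)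
    show "\<forall>p\<in>{p. prime p \<and> p \<le> n} - prime_factors m. real (multiplicity p m) * ln (real p) = 0"
      using assms by (auto simp: prime_factors_dvd not_dvd_imp_multiplicity_0)
  qed auto
  finally show ?thesis .
qed

lemma card_multiples: "0 < d \<Longrightarrow> card {m \<in> {1..n}. d dvd m} = n div (d::nat)"
proof -
  assume d: "0 < d"
  have "{m \<in> {1..n}. d dvd m} = (\<lambda>k. d * k) ` {1..n div d}"
  proof (intro equalityI subsetI)
    fix m assume "m \<in> {m \<in> {1..n}. d dvd m}"
    then obtain k where k: "m = d * k" "1 \<le> m" "m \<le> n" by auto
    then have "1 \<le> k" by (cases k) auto
    moreover have "k \<le> n div d" using k d by (simp add: less_eq_div_iff_mult_less_eq mult.commute)
    ultimately show "m \<in> (\<lambda>k. d * k) ` {1..n div d}" using k by auto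
  next
    fix m assume "m \<in> (\<lambda>k. d * k) ` {1..n div d}"
    then obtain k where k: "m = d * k" "1 \<le> k" "k \<le> n div d" by (auto simp only: atLeastAtMost_iff)
    then have "d * k \<le> n" using d by (simp add: less_eq_div_iff_mult_less_eq mult.commute)
    then show "m \<in> {m \<in> {1..n}. d dvd m}" using k d by auto
  qed
  also have "card \<dots> = n div d" using d by (subst card_image) (auto simp: inj_on_def)
  finally show ?thesis .
qed

lemma sum_multiplicity:
  assumes "prime (p::nat)"
  shows "(\<Sum>m=1..n. multiplicity p m) = (\<Sum>j=1..n. n div p ^ j)"
proof -
  have p: "\<not> is_unit p" "1 < p" using assms prime_gt_1_nat[OF assms] by auto
  have "multiplicity p m = (\<Sum>j=1..n. if p ^ j dvd m then 1 else 0)" if "m \<in> {1..n}" for m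
  proof -
    have "multiplicity p m \<le> n"
    proof -
      have "multiplicity p m < p ^ multiplicity p m" using p by (intro power_gt_expt) auto
      also have "\<dots> \<le> m" using that by (intro dvd_imp_le multiplicity_dvd) auto
      finally show ?thesis using that by simp
    qed
    then have "{j \<in> {1..n}. p ^ j dvd m} = {1..multiplicity p m}"
      using that p by (auto simp: power_dvd_iff_le_multiplicity)
    then have "card {j \<in> {1..n}. p ^ j dvd m} = multiplicity p m" by simp
    then show ?thesis by (simp only: sum.inter_filter[symmetric, OF finite_atLeastAtMost] card_eq_sum)
  qed
  then have "(\<Sum>m=1..n. multiplicity p m) = (\<Sum>m=1..n. \<Sum>j=1..n. if p ^ j dvd m then 1 else 0)" by (rule sum.cong[OF refl])
  also have "\<dots> = (\<Sum>j=1..n. \<Sum>m=1..n. if p ^ j dvd m then 1 else 0)" by (rule sum.swap)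
  also have "\<dots> = (\<Sum>j=1..n. card {m \<in> {1..n}. p ^ j dvd m})" by (simp only: sum.inter_filter[symmetric, OF finite_atLeastAtMost] card_eq_sum)
  also have "\<dots> = (\<Sum>j=1..n. n div p ^ j)" using p by (intro sum.cong refl card_multiples) auto
  finally show ?thesis .
qed

text \<open>Legendre's formula, obtained by adding up the factorizations of \<open>1..n\<close> and
  exchanging the summations.\<close>

lemma ln_fact_eq:
  "ln (fact n) = (\<Sum>p | prime p \<and> p \<le> n. ln (real p) * real (\<Sum>j=1..n. n div p ^ j))"
proof -
  have "ln (fact n :: real) = (\<Sum>m=1..n. ln (real m))"
    unfolding fact_prod of_nat_prod by (subst ln_prod) auto
  also have "\<dots> = (\<Sum>m=1..n. \<Sum>p | prime p \<and> p \<le> n. real (multiplicity p m) * ln (real p))"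
    by (intro sum.cong refl ln_prime_factorization) auto
  also have "\<dots> = (\<Sum>p | prime p \<and> p \<le> n. \<Sum>m=1..n. real (multiplicity p m) * ln (real p))" by (rule sum.swap)
  also have "\<dots> = (\<Sum>p | prime p \<and> p \<le> n. ln (real p) * real (\<Sum>m=1..n. multiplicity p m))"
    by (simp add: sum_distrib_left mult_ac)
  also have "\<dots> = (\<Sum>p | prime p \<and> p \<le> n. ln (real p) * real (\<Sum>j=1..n. n div p ^ j))"
    by (rule sum.cong) (simp_all only: sum_multiplicity mem_Collect_eq)
  finally show ?thesis .
qed

lemma ln_fact_bounds:
  assumes "1 \<le> n"
  shows "real n * ln (real n) - real n \<le> ln (fact n)" "ln (fact n) \<le> real n * ln (real n)"
proof -
  \<comment> \<open>\<open>n^n / n!\<close> is a single term of the exponential series at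
    \<open>n\<close>; this replaces Stirling's formula.\<close>
  have "real n ^ n / fact n \<le> exp (real n)"
  proof -
    have "(\<lambda>k. real n ^ k / fact k) sums exp (real n)"
      using exp_converges[of "real n"] by (simp add: divide_inverse mult.commute)
    then have "(\<Sum>k\<in>{n}. real n ^ k / fact k) \<le> exp (real n)"
      by (subst sums_unique[OF \<open>_ sums _\<close>]) (intro sum_le_suminf, auto simp: sums_iff)
    then show ?thesis by simp
  qed
  then have "real n ^ n \<le> exp (real n) * fact n" by (simp add: field_simps)
  then have "ln (real n ^ n) \<le> ln (exp (real n) * fact n)" using assms by (subst ln_le_cancel_iff) auto
  then show "real n * ln (real n) - real n \<le> ln (fact n)" using assms by (simp add: ln_mult ln_realpow)
  have "(fact n :: real) \<le> real n ^ n" using fact_le_power[of n, where 'a=real] by simp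
  then have "ln (fact n) \<le> ln (real n ^ n)" using assms by (subst ln_le_cancel_iff) auto
  then show "ln (fact n) \<le> real n * ln (real n)" using assms by (simp add: ln_realpow)
qed

lemma real_div_bounds: "real (n div d) \<le> real n / real d" "real n / real d < real (n div d) + 1"
proof -
  have e: "real_of_int \<lfloor>real n / real d\<rfloor> = real (n div d)" by (simp add: floor_divide_of_nat_eq)
  show "real (n div d) \<le> real n / real d" "real n / real d < real (n div d) + 1"
    unfolding e[symmetric] by linarith+
qed

text \<open>The lower bound keeps only \<open>j = 1\<close>; the upper bound drops the integer parts
  and sums the geometric series.\<close>

lemma legendre_sum_bounds:
  assumes "prime (p::nat)" "p \<le> n"
  shows "real n / real p - 1 \<le> real (\<Sum>j=1..n. n div p ^ j)"
    and "real (\<Sum>j=1..n. n div p ^ j) \<le> real n / (real p - 1)"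
proof -
  have p: "1 < p" "1 \<le> n" using assms prime_gt_1_nat[of p] by auto
  have "real n / real p < real (n div p) + 1"
    by (rule real_div_bounds)
  moreover have "n div p = (\<Sum>j\<in>{1::nat}. n div p ^ j)" by simp
  moreover have "(\<Sum>j\<in>{1::nat}. n div p ^ j) \<le> (\<Sum>j=1..n. n div p ^ j)" using p by (intro sum_mono2) auto
  ultimately show "real n / real p - 1 \<le> real (\<Sum>j=1..n. n div p ^ j)" by linarith
  have "real (\<Sum>j=1..n. n div p ^ j) \<le> (\<Sum>j=1..n. real n * (1 / real p) ^ j)"
    unfolding of_nat_sum
  proof (rule sum_mono)
    fix j
    have "real (n div p ^ j) \<le> real n / real (p ^ j)"
      by (rule real_div_bounds)
    then show "real (n div p ^ j) \<le> real n * (1 / real p) ^ j" by (simp add: power_one_over)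
  qed
  also have "\<dots> = real n * (\<Sum>j=1..n. (1 / real p) ^ j)" by (simp only: sum_distrib_left)
  also have "\<dots> \<le> real n * (1 / (real p - 1))"
  proof (intro mult_left_mono)
    have "(\<lambda>j. (1 / real p) ^ Suc j) sums (1 / real p * (1 / (1 - 1 / real p)))"
      unfolding power_Suc using p by (intro sums_mult geometric_sums) auto
    also have "1 / real p * (1 / (1 - 1 / real p)) = 1 / (real p - 1)" using p by (simp add: field_simps)
    finally have s: "(\<lambda>j. (1 / real p) ^ Suc j) sums (1 / (real p - 1))" .
    have "(\<Sum>j=1..n. (1 / real p) ^ j) = (\<Sum>j<n. (1 / real p) ^ Suc j)"
      by (rule sum.reindex_bij_witness[of _ Suc "\<lambda>k. k - 1"]) auto
    also have "\<dots> \<le> 1 / (real p - 1)"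
      unfolding sums_unique[OF s] using p by (intro sum_le_suminf sums_summable[OF s]) auto
    finally show "(\<Sum>j=1..n. (1 / real p) ^ j) \<le> 1 / (real p - 1)" .
  qed auto
  finally show "real (\<Sum>j=1..n. n div p ^ j) \<le> real n / (real p - 1)" by simp
qed

lemma summable_ln_over_square:
  assumes "0 < \<epsilon>"
  shows "summable (\<lambda>n. ln (real n) * real n powr (- 1 - \<epsilon>))"
proof -
  have "summable (\<lambda>n. real n powr (- 1 - \<epsilon> / 2))" using assms by (subst summable_real_powr_iff) auto
  then have "summable (\<lambda>n. norm (real n powr (- 1 - \<epsilon> / 2)))" by simp
  then show ?thesis
  proof (rule summable_comparison_test_bigo)
    show "(\<lambda>n. ln (real n) * real n powr (- 1 - \<epsilon>)) \<in> O(\<lambda>n. real n powr (- 1 - \<epsilon> / 2))"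
      using assms by real_asymp
  qed
qed

lemma ln_nat_nonneg [simp]: "0 \<le> ln (real n)"
  by (cases "n = 0") auto

lemma sum_primes_eq:
  fixes f :: "nat \<Rightarrow> real"
  shows "(\<Sum>p | prime p \<and> p \<le> N. f p) = (\<Sum>n\<le>N. if prime n then f n else 0)"
  by (simp add: sum.If_cases Int_def conj_commute)

text \<open>By Legendre, \<open>ln (n!)\<close> is \<open>n\<close> times the sum of
  \<open>ln p / p\<close> up to two errors. Rounding loses at most
  \<open>chebyshev_theta n = O(n)\<close>, and higher prime powers contribute
  \<open>1 / (p - 1) - 1 / p = O(1 / p^2)\<close>, which is summable against
  \<open>ln p\<close>.\<close>

lemma mertens_first:
  "\<exists>C. \<forall>N\<ge>1. \<bar>(\<Sum>p | prime p \<and> p \<le> N. ln (real p) / real p) - ln (real N)\<bar> \<le> C"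
proof -
  define D where "D = (\<Sum>n. ln (real n) * real n powr (- 1 - 1))"
  have D0: "0 \<le> D" unfolding D_def
    by (intro suminf_nonneg summable_ln_over_square) (auto intro!: mult_nonneg_nonneg)
  show ?thesis
  proof (intro exI[of _ "ln 4 + 1 + 2 * D"] allI impI)
    fix N :: nat assume N: "1 \<le> N"
    define B where "B = (\<Sum>p | prime p \<and> p \<le> N. ln (real p) / real p)"
    have "real N * B - chebyshev_theta N = (\<Sum>p | prime p \<and> p \<le> N. ln (real p) * (real N / real p - 1))"
      by (simp add: B_def chebyshev_theta_def sum_distrib_left sum_subtractf right_diff_distrib mult_ac)
    also have "\<dots> \<le> ln (fact N)"
      unfolding ln_fact_eq by (intro sum_mono mult_left_mono legendre_sum_bounds) (auto dest: prime_gt_0_nat)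
    also have "\<dots> \<le> real N * ln (real N)" using N by (intro ln_fact_bounds)
    finally have "real N * B \<le> real N * (ln (real N) + ln 4)" using chebyshev_theta_le[of N] by (simp add: distrib_left)
    then have up: "B \<le> ln (real N) + ln 4" using N by simp
    have "real N * ln (real N) - real N \<le> ln (fact N)" using N by (intro ln_fact_bounds)
    also have "\<dots> \<le> (\<Sum>p | prime p \<and> p \<le> N. ln (real p) * (real N / (real p - 1)))"
      unfolding ln_fact_eq by (intro sum_mono mult_left_mono legendre_sum_bounds) (auto dest: prime_gt_0_nat)
    also have "\<dots> \<le> (\<Sum>p | prime p \<and> p \<le> N. real N * (ln (real p) / real p + 2 * (ln (real p) * real p powr (- 1 - 1))))"
    proof (rule sum_mono)
      fix p assume "p \<in> {p. prime p \<and> p \<le> N}"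
      then have p: "2 \<le> p" using prime_ge_2_nat by auto
      have "1 / (real p - 1) \<le> 1 / real p + 2 * real p powr (- 1 - 1)"
      proof -
        have "real p powr (- 1 - 1) = 1 / (real p * real p)" using p by (simp add: powr_minus powr_numeral power2_eq_square divide_inverse)
        moreover have "1 / (real p - 1) - 1 / real p = 1 / ((real p - 1) * real p)" using p by (simp add: field_simps)
        moreover have "1 / ((real p - 1) * real p) \<le> 1 / (real p / 2 * real p)"
          using p by (intro divide_left_mono mult_right_mono mult_pos_pos) auto
        ultimately show ?thesis by simp
      qed
      then have "ln (real p) * (1 / (real p - 1)) \<le> ln (real p) * (1 / real p + 2 * real p powr (- 1 - 1))"
        using p by (intro mult_left_mono) auto
      then have "real N * (ln (real p) * (1 / (real p - 1))) \<le> real N * (ln (real p) * (1 / real p + 2 * real p powr (- 1 - 1)))"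
        by (rule mult_left_mono) simp
      moreover have "ln (real p) * (real N / (real p - 1)) = real N * (ln (real p) * (1 / (real p - 1)))" by simp
      ultimately show "ln (real p) * (real N / (real p - 1)) \<le> real N * (ln (real p) / real p + 2 * (ln (real p) * real p powr (- 1 - 1)))"
        by (simp only: distrib_left) (simp only: mult_ac times_divide_eq_right mult_1_right)
    qed
    also have "\<dots> = real N * (B + 2 * (\<Sum>p | prime p \<and> p \<le> N. ln (real p) * real p powr (- 1 - 1)))"
      by (simp only: B_def sum_distrib_left[symmetric] sum.distrib)
    also have "\<dots> \<le> real N * (B + 2 * D)"
    proof -
      have "(\<Sum>p | prime p \<and> p \<le> N. ln (real p) * real p powr (- 1 - 1)) \<le> D"
        unfolding D_def by (intro sum_le_suminf summable_ln_over_square) (auto intro!: mult_nonneg_nonneg)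
      then show ?thesis by (intro mult_left_mono) auto
    qed
    finally have "real N * (ln (real N) - 1) \<le> real N * (B + 2 * D)" by (simp add: right_diff_distrib)
    then have low: "ln (real N) - 1 \<le> B + 2 * D" using N by simp
    have "0 < ln (4::real)" by simp
    then show "\<bar>(\<Sum>p | prime p \<and> p \<le> N. ln (real p) / real p) - ln (real N)\<bar> \<le> ln 4 + 1 + 2 * D"
      using up low D0 unfolding B_def[symmetric] by linarith
  qed
qed

definition prime_weight :: "nat \<Rightarrow> real" where
  "prime_weight n = (if prime n then 1 / real n else 0)"

text \<open>A perturbation of \<open>1 / p\<close> by \<open>O(p powr (- 1 - \<epsilon>))\<close>
  changes the sum of \<open>c p * ln p\<close> by a bounded amount. This brings
  \<open>\<lambda>_p\<close> under the locale with \<open>\<epsilon> = 1 / h\<close>.\<close>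

lemma mertens_weight_perturb:
  assumes "\<And>n. 0 \<le> c n" "\<And>n. \<not> prime n \<Longrightarrow> c n = 0" "0 < \<epsilon>"
    and "\<And>p. prime p \<Longrightarrow> \<bar>c p - 1 / real p\<bar> \<le> D * real p powr (- 1 - \<epsilon>)"
  shows "\<exists>C. mertens_weight c C"
proof -
  obtain C where C: "\<And>N. 1 \<le> N \<Longrightarrow> \<bar>(\<Sum>p | prime p \<and> p \<le> N. ln (real p) / real p) - ln (real N)\<bar> \<le> C"
    using mertens_first by blast
  define S where "S = (\<Sum>n. ln (real n) * real n powr (- 1 - \<epsilon>))"
  \<comment> \<open>The assumption at \<open>p = 2\<close> forces \<open>D \<ge> 0\<close>.\<close>
  have "0 \<le> D * 2 powr (- 1 - \<epsilon>)" using assms(4)[of 2] by (auto intro: order.trans[OF abs_ge_zero])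
  then have D: "0 \<le> D" by (simp add: zero_le_mult_iff)
  show ?thesis
  proof (intro exI[of _ "C + D * S"] mertens_weight.intro)
    fix N :: nat assume N: "1 \<le> N"
    have e: "(\<Sum>n\<le>N. c n * ln (real n)) = (\<Sum>p | prime p \<and> p \<le> N. c p * ln (real p))"
      unfolding sum_primes_eq using assms(2) by (intro sum.cong) auto
    have "\<bar>(\<Sum>p | prime p \<and> p \<le> N. c p * ln (real p)) - (\<Sum>p | prime p \<and> p \<le> N. ln (real p) / real p)\<bar>
        \<le> (\<Sum>p | prime p \<and> p \<le> N. D * (ln (real p) * real p powr (- 1 - \<epsilon>)))"
      unfolding sum_subtractf[symmetric]
    proof (rule order.trans[OF sum_abs], rule sum_mono)
      fix p assume "p \<in> {p. prime p \<and> p \<le> N}"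
      then have p: "prime p" by simp
      have p0: "0 < ln (real p)" using prime_gt_1_nat[OF p] by simp
      have "\<bar>c p * ln (real p) - ln (real p) / real p\<bar> = \<bar>c p - 1 / real p\<bar> * ln (real p)"
      proof -
        have "c p * ln (real p) - ln (real p) / real p = (c p - 1 / real p) * ln (real p)" by (simp add: algebra_simps)
        then show ?thesis using p0 by (simp add: abs_mult)
      qed
      also have "\<dots> \<le> D * real p powr (- 1 - \<epsilon>) * ln (real p)"
        using p p0 assms(4) by (intro mult_right_mono) auto
      finally show "\<bar>c p * ln (real p) - ln (real p) / real p\<bar> \<le> D * (ln (real p) * real p powr (- 1 - \<epsilon>))"
        by (simp add: mult_ac)
    qed
    also have "\<dots> = D * (\<Sum>p | prime p \<and> p \<le> N. ln (real p) * real p powr (- 1 - \<epsilon>))" by (simp only: sum_distrib_left)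
    also have "\<dots> \<le> D * S"
      unfolding S_def using D assms(3)
      by (intro mult_left_mono sum_le_suminf summable_ln_over_square) (auto intro!: mult_nonneg_nonneg)
    finally show "\<bar>(\<Sum>n\<le>N. c n * ln (real n)) - ln (real N)\<bar> \<le> C + D * S"
      using C[OF N] unfolding e by linarith
  next
    fix n :: nat assume "n < 2"
    then show "c n = 0" using assms(2)[of n] prime_ge_2_nat[of n] by auto
  qed (rule assms(1))
qed

lemma mertens_weight_prime_weight: "\<exists>C. mertens_weight prime_weight C"
  by (rule mertens_weight_perturb[where \<epsilon> = 1 and D = 0]) (auto simp: prime_weight_def)

section \<open>Euler products\<close>

text \<open>The multiplicative monoid generated by the primes in \<open>Q\<close>; for the primes up
  to \<open>N\<close> these are the \<open>N\<close>-smooth numbers.\<close>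

definition generated_by :: "nat set \<Rightarrow> nat set" where
  "generated_by Q = {n. n > 0 \<and> prime_factors n \<subseteq> Q}"

text \<open>Multiplicativity is stated in the form in which it is applied, splitting off the full
  power of one prime. Nonnegativity makes every rearrangement unconditional.\<close>

locale multiplicative_fun =
  fixes f :: "nat \<Rightarrow> real"
  assumes one: "f 1 = 1"
    and mult: "prime p \<Longrightarrow> \<not> p dvd m \<Longrightarrow> f (p ^ e * m) = f (p ^ e) * f m"
    and nonneg: "0 \<le> f n"
begin

text \<open>Splitting \<open>n = p^e * m\<close> with \<open>m\<close> prime to \<open>p\<close> is
  a bijection, so the sum factors into the local sum at \<open>p\<close> and the sum over
  \<open>Q\<close>.\<close>

lemma has_sum_insert_prime:
  assumes p: "prime p" "p \<notin> Q"
    and F: "((\<lambda>e. f (p ^ e)) has_sum F) UNIV"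
    and S: "(f has_sum S) (generated_by Q)"
  shows "(f has_sum (F * S)) (generated_by (insert p Q))"
proof -
  have S': "((\<lambda>m. f (p ^ e * m)) has_sum (f (p ^ e) * S)) (generated_by Q)" for e
  proof -
    have "((\<lambda>m. f (p ^ e) * f m) has_sum (f (p ^ e) * S)) (generated_by Q)"
      by (rule has_sum_cmult_right[OF S])
    also have "?this \<longleftrightarrow> ?thesis"
    proof (rule has_sum_cong)
      fix m assume "m \<in> generated_by Q"
      then have "\<not> p dvd m" using p by (auto simp: generated_by_def prime_factors_dvd)
      then show "f (p ^ e) * f m = f (p ^ e * m)" using mult[OF p(1)] by simp
    qed
    finally show ?thesis .
  qed
  have "((\<lambda>(e, m). f (p ^ e * m)) has_sum (F * S)) (UNIV \<times> generated_by Q)"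
  proof (rule has_sum_SigmaI)
    show "((\<lambda>y. case (e, y) of (e, m) \<Rightarrow> f (p ^ e * m)) has_sum (f (p ^ e) * S)) (generated_by Q)" for e
      using S' by simp
    show "((\<lambda>e. f (p ^ e) * S) has_sum F * S) UNIV" by (rule has_sum_cmult_left[OF F])
    show "(\<lambda>(e, m). f (p ^ e * m)) summable_on UNIV \<times> generated_by Q"
    proof (rule summable_on_SigmaI)
      show "((\<lambda>y. case (e, y) of (e, m) \<Rightarrow> f (p ^ e * m)) has_sum (f (p ^ e) * S)) (generated_by Q)" for e
        using S' by simp
      show "(\<lambda>e. f (p ^ e) * S) summable_on UNIV"
        using has_sum_cmult_left[OF F] by (rule has_sum_imp_summable)
    qed (simp add: nonneg)
  qed
  also have "?this \<longleftrightarrow> (f has_sum (F * S)) (generated_by (insert p Q))"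
  proof (rule has_sum_reindex_bij_witness[where i = "\<lambda>n. (multiplicity p n, n div p ^ multiplicity p n)" and j = "\<lambda>(e, m). p ^ e * m"])
    fix x :: "nat \<times> nat" assume x: "x \<in> UNIV \<times> generated_by Q"
    obtain e m where em: "x = (e, m)" by (cases x)
    have m: "0 < m" "prime_factors m \<subseteq> Q" "\<not> p dvd m" using x p by (auto simp: em generated_by_def prime_factors_dvd)
    have mu: "multiplicity p (p ^ e * m) = e"
      using m p by (intro multiplicity_eqI) (auto simp: prime_gt_0_nat)
    then show "(multiplicity p (case x of (e, m) \<Rightarrow> p ^ e * m), (case x of (e, m) \<Rightarrow> p ^ e * m) div p ^ multiplicity p (case x of (e, m) \<Rightarrow> p ^ e * m)) = x"
      using p by (simp add: em prime_gt_0_nat)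
    have "prime_factors (p ^ e * m) \<subseteq> insert p (prime_factors m)"
      using m p by (auto simp: prime_factors_dvd prime_dvd_mult_iff) (metis prime_dvd_power primes_dvd_imp_eq)
    then show "(case x of (e, m) \<Rightarrow> p ^ e * m) \<in> generated_by (insert p Q)"
      using m p by (auto simp: em generated_by_def prime_gt_0_nat)
    show "f (case x of (e, m) \<Rightarrow> p ^ e * m) = (case x of (e, m) \<Rightarrow> f (p ^ e * m))" by (simp add: em)
  next
    fix n assume n: "n \<in> generated_by (insert p Q)"
    then have n0: "n > 0" by (simp add: generated_by_def)
    obtain m where m: "n = p ^ multiplicity p n * m" "\<not> p dvd m"
      using multiplicity_decompose'[of n p] n0 prime_gt_1_nat[OF p(1)] by auto
    have "n div p ^ multiplicity p n = m" using m p by (metis nonzero_mult_div_cancel_left power_not_zero not_prime_0)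
    moreover have "m \<in> generated_by Q"
    proof -
      have "m > 0" using m n0 by (intro Nat.gr0I) auto
      moreover have "prime_factors m \<subseteq> Q"
      proof
        fix q assume q: "q \<in> prime_factors m"
        then have "q \<noteq> p" using m by (auto simp: prime_factors_dvd)
        have "q dvd m" "prime q" using q by (auto simp: prime_factors_dvd)
        moreover have "m dvd n" using m(1) by (metis dvd_triv_right)
        ultimately have "q \<in> prime_factors n" using n0 by (auto simp: prime_factors_dvd intro: dvd_trans)
        then show "q \<in> Q" using n \<open>q \<noteq> p\<close> by (auto simp: generated_by_def)
      qed
      ultimately show ?thesis by (simp add: generated_by_def)
    qed
    ultimately show "(multiplicity p n, n div p ^ multiplicity p n) \<in> UNIV \<times> generated_by Q" by simp
    show "(case (multiplicity p n, n div p ^ multiplicity p n) of (e, m) \<Rightarrow> p ^ e * m) = n"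
      using m(1) \<open>n div p ^ multiplicity p n = m\<close> by simp
  qed simp
  finally show ?thesis .
qed

text \<open>\<open>Q\<close> may be infinite: finitely many local factors are split off while the
  rest stays untouched. This allows the comparison of two functions that differ only at finitely
  many primes.\<close>

lemma has_sum_union_primes:
  assumes "finite D" "\<And>p. p \<in> D \<Longrightarrow> prime p" "D \<inter> Q = {}"
    and "\<And>p. p \<in> D \<Longrightarrow> ((\<lambda>e. f (p ^ e)) has_sum F p) UNIV"
    and "(f has_sum S) (generated_by Q)"
  shows "(f has_sum ((\<Prod>p\<in>D. F p) * S)) (generated_by (D \<union> Q))"
  using assms
proof (induction D rule: finite_induct)
  case (insert p D)
  have "(f has_sum (F p * ((\<Prod>p\<in>D. F p) * S))) (generated_by (insert p (D \<union> Q)))"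
    using insert by (intro has_sum_insert_prime) auto
  then show ?case using insert by (simp add: mult_ac)
qed simp

lemma has_sum_generated_finite:
  assumes "finite D" "\<And>p. p \<in> D \<Longrightarrow> prime p"
    and "\<And>p. p \<in> D \<Longrightarrow> ((\<lambda>e. f (p ^ e)) has_sum F p) UNIV"
  shows "(f has_sum (\<Prod>p\<in>D. F p)) (generated_by D)"
proof -
  have "generated_by {} = {1}"
    by (auto simp: generated_by_def prime_factorization_empty_iff)
  then have "(f has_sum 1) (generated_by {})" using one by (simp add: has_sum_finite_iff)
  from has_sum_union_primes[OF assms(1,2) _ assms(3) this] show ?thesis by simp
qed

context
  fixes F :: "nat \<Rightarrow> real"
  assumes F: "\<And>p. prime p \<Longrightarrow> ((\<lambda>e. f (p ^ e)) has_sum F p) UNIV"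
begin

abbreviation "P N \<equiv> (\<Prod>p | prime p \<and> p \<le> N. F p)"

lemma has_sum_smooth: "(f has_sum P N) (generated_by {p. prime p \<and> p \<le> N})"
  by (rule has_sum_generated_finite) (auto simp: F)

lemma subset_smooth: "{1..N} \<subseteq> generated_by {p. prime p \<and> p \<le> N}"
  by (auto simp: generated_by_def prime_factors_dvd dest!: dvd_imp_le)

lemma sum_le_euler_product: "(\<Sum>n=1..N. f n) \<le> P N"
  using finite_sum_le_has_sum[OF has_sum_smooth _ subset_smooth] nonneg by simp

lemma summable_on_if_bounded:
  assumes "\<And>N. P N \<le> B"
  shows "f summable_on {0::nat<..}"
proof (rule nonneg_bdd_above_summable_on)
  show "bdd_above (sum f ` {G. G \<subseteq> {0<..} \<and> finite G})"
  proof (rule bdd_aboveI2)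
    fix G :: "nat set" assume G: "G \<in> {G. G \<subseteq> {0<..} \<and> finite G}"
    define N where "N = Max (insert 0 G)"
    have "G \<subseteq> {1..N}" using G by (auto simp: N_def Suc_le_eq)
    then have "sum f G \<le> (\<Sum>n=1..N. f n)" by (intro sum_mono2) (auto simp: nonneg)
    also have "\<dots> \<le> P N" by (rule sum_le_euler_product)
    also have "\<dots> \<le> B" by (rule assms)
    finally show "sum f G \<le> B" .
  qed
qed (simp add: nonneg)

text \<open>The product up to \<open>N\<close> is the sum over the \<open>N\<close>-smooth numbers,
  which include \<open>1..N\<close>; so it lies between a partial sum and the full sum.\<close>

theorem euler_product_LIMSEQ:
  assumes "f summable_on {0<..}"
  shows "(\<lambda>N. P N) \<longlonglongrightarrow> infsum f {0<..}"
proof (rule tendsto_sandwich)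
  have hs: "(f has_sum infsum f {0<..}) {0<..}" using assms by simp
  show "\<forall>\<^sub>F N in sequentially. (\<Sum>n=1..N. f n) \<le> P N"
    using sum_le_euler_product by simp
  show "\<forall>\<^sub>F N in sequentially. P N \<le> infsum f {0<..}"
  proof (intro always_eventually allI)
    fix N
    have "generated_by {p. prime p \<and> p \<le> N} \<subseteq> {0<..}" by (auto simp: generated_by_def)
    then show "P N \<le> infsum f {0<..}"
      using has_sum_mono2[OF has_sum_smooth hs] nonneg by simp
  qed
  show "(\<lambda>N. infsum f {0<..}) \<longlonglongrightarrow> infsum f {0<..}" by simp
  have "((\<lambda>n. if n = 0 then 0 else f n) has_sum infsum f {0<..}) UNIV"
    by (rule has_sum_cong_neutral[THEN iffD1, OF _ _ _ hs]) auto
  then have "(\<lambda>n. if n = 0 then 0 else f n) sums infsum f {0<..}" by (rule has_sum_imp_sums)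
  then have "(\<lambda>N. \<Sum>n\<le>N. if n = 0 then 0 else f n) \<longlonglongrightarrow> infsum f {0<..}" by (simp add: sums_def_le)
  moreover have "(\<Sum>n\<le>N. if n = 0 then 0 else f n) = (\<Sum>n=1..N. f n)" for N
    by (rule sum.mono_neutral_cong_right) auto
  ultimately show "(\<lambda>N. \<Sum>n=1..N. f n) \<longlonglongrightarrow> infsum f {0<..}" by simp
qed

end
end

section \<open>The constant in Mertens' second theorem\<close>

text \<open>Abel's limit theorem. With partial sums \<open>B k\<close> the deviation from
  \<open>L\<close> is \<open>(1 - x)\<close> times the sum of \<open>(B k - L) * x^k\<close>: the
  factor \<open>1 - x\<close> kills finitely many terms, and the others are small and weighted by
  \<open>(1 - x) * x^k\<close>, of total mass at most 1.\<close>

lemma abel_limit: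
  fixes b :: "nat \<Rightarrow> real"
  assumes lim: "(\<lambda>n. \<Sum>k\<le>n. b k) \<longlonglongrightarrow> L"
  shows "((\<lambda>x. \<Sum>k. b k * x ^ k) \<longlongrightarrow> L) (at_left 1)"
proof -
  define B where "B = (\<lambda>n. \<Sum>k\<le>n. b k)"
  obtain R where R: "\<And>n. \<bar>B n - L\<bar> \<le> R"
  proof -
    have "Bseq (\<lambda>n. B n - L)"
      using lim unfolding B_def by (intro convergent_imp_Bseq convergentI[of _ "L - L"] tendsto_intros)
    then show ?thesis using that by (auto simp: Bseq_def)
  qed
  have R0: "0 \<le> R" using R[of 0] by linarith
  have expand: "(\<Sum>k. b k * x ^ k) - L = (1 - x) * (\<Sum>k. (B k - L) * x ^ k)"
    and summ: "summable (\<lambda>k. (B k - L) * x ^ k)" if x: "0 < x" "x < 1" for x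
  proof -
    show s: "summable (\<lambda>k. (B k - L) * x ^ k)"
    proof (rule summable_comparison_test)
      show "\<exists>N. \<forall>n\<ge>N. norm ((B n - L) * x ^ n) \<le> R * x ^ n"
        using R x by (auto simp: abs_mult intro!: mult_right_mono)
      show "summable (\<lambda>n. R * x ^ n)" using x by (intro summable_mult summable_geometric) auto
    qed
    define S where "S = (\<Sum>k. (B k - L) * x ^ k)"
    have S: "(\<lambda>k. (B k - L) * x ^ k) sums S" unfolding S_def by (rule summable_sums[OF s])
    have g: "(\<lambda>k. x ^ k) sums (1 / (1 - x))" using x by (intro geometric_sums) auto
    have 1: "(\<lambda>k. (B k - L) * x ^ k + L * x ^ k) sums (S + L * (1 / (1 - x)))"
      by (intro sums_add S sums_mult g)
    then have Bs: "(\<lambda>k. B k * x ^ k) sums (S + L / (1 - x))" by (simp add: algebra_simps)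
    then have "(\<lambda>k. x * (B k * x ^ k)) sums (x * (S + L / (1 - x)))" by (rule sums_mult)
    then have "(\<lambda>k. (if k = 0 then 0 else B (k - 1) * x ^ k)) sums (x * (S + L / (1 - x)))"
      using sums_Suc[of "\<lambda>k. (if k = 0 then 0 else B (k - 1) * x ^ k)" "x * (S + L / (1 - x))"] by (simp add: mult_ac)
    then have "(\<lambda>k. B k * x ^ k - (if k = 0 then 0 else B (k - 1) * x ^ k)) sums ((S + L / (1 - x)) - x * (S + L / (1 - x)))"
      by (intro sums_diff Bs)
    also have "(\<lambda>k. B k * x ^ k - (if k = 0 then 0 else B (k - 1) * x ^ k)) = (\<lambda>k. b k * x ^ k)"
    proof
      fix k show "B k * x ^ k - (if k = 0 then 0 else B (k - 1) * x ^ k) = b k * x ^ k"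
        by (cases k) (simp_all add: B_def algebra_simps)
    qed
    also have "(S + L / (1 - x)) - x * (S + L / (1 - x)) = (1 - x) * S + L"
    proof -
      have "(S + w) - x * (S + w) = (1 - x) * S + (1 - x) * w" for w by (simp add: algebra_simps)
      from this[of "L / (1 - x)"] show ?thesis using x by simp
    qed
    finally show "(\<Sum>k. b k * x ^ k) - L = (1 - x) * (\<Sum>k. (B k - L) * x ^ k)"
      by (simp add: sums_iff S_def)
  qed
  show ?thesis
  proof (rule tendstoI)
    fix e :: real assume e: "0 < e"
    then obtain K where K: "\<And>n. n \<ge> K \<Longrightarrow> \<bar>B n - L\<bar> < e / 2"
      using LIMSEQ_D[OF lim, of "e / 2"] by (auto simp: B_def)
    have "((\<lambda>x. (1 - x) * (real K * R)) \<longlongrightarrow> (1 - 1) * (real K * R)) (at_left 1)"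
      by (intro tendsto_intros)
    then have "\<forall>\<^sub>F x in at_left 1. (1 - x) * (real K * R) < e / 2"
      using e by (intro order_tendstoD) auto
    moreover have "\<forall>\<^sub>F x::real in at_left 1. 0 < x \<and> x < 1"
      using eventually_at_left_field[of "\<lambda>x. 0 < x \<and> x < 1" "1::real"] by (auto intro!: exI[of _ 0])
    ultimately show "\<forall>\<^sub>F x in at_left 1. dist (\<Sum>k. b k * x ^ k) L < e"
    proof eventually_elim
      case (elim x)
      then have x: "0 < x" "x < 1" by auto
      have s: "summable (\<lambda>k. \<bar>(B k - L) * x ^ k\<bar>)"
      proof (rule summable_comparison_test)
        show "\<exists>N. \<forall>n\<ge>N. norm \<bar>(B n - L) * x ^ n\<bar> \<le> R * x ^ n"
          using R x by (auto simp: abs_mult intro!: mult_right_mono)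
        show "summable (\<lambda>n. R * x ^ n)" using x by (intro summable_mult summable_geometric) auto
      qed
      have "\<bar>\<Sum>k. (B k - L) * x ^ k\<bar> \<le> (\<Sum>k. \<bar>(B k - L) * x ^ k\<bar>)" by (rule summable_rabs[OF s])
      also have "\<dots> = (\<Sum>k. \<bar>(B (k + K) - L) * x ^ (k + K)\<bar>) + (\<Sum>k<K. \<bar>(B k - L) * x ^ k\<bar>)"
        by (rule suminf_split_initial_segment[OF s])
      also have "(\<Sum>k<K. \<bar>(B k - L) * x ^ k\<bar>) \<le> (\<Sum>k<K. R)"
      proof (rule sum_mono)
        fix k
        have "\<bar>B k - L\<bar> * x ^ k \<le> R * 1" using x R R0 by (intro mult_mono power_le_one) auto
        then show "\<bar>(B k - L) * x ^ k\<bar> \<le> R" using x by (simp add: abs_mult)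
      qed
      also have "(\<Sum>k. \<bar>(B (k + K) - L) * x ^ (k + K)\<bar>) \<le> (\<Sum>k. e / 2 * x ^ k)"
      proof (rule suminf_le)
        fix k
        have "\<bar>B (k + K) - L\<bar> * x ^ (k + K) \<le> e / 2 * x ^ k"
          using K[of "k + K"] x e by (intro mult_mono power_decreasing) auto
        then show "\<bar>(B (k + K) - L) * x ^ (k + K)\<bar> \<le> e / 2 * x ^ k" using x by (simp add: abs_mult)
      next
        show "summable (\<lambda>k. \<bar>(B (k + K) - L) * x ^ (k + K)\<bar>)" using s by (subst summable_iff_shift)
        show "summable (\<lambda>k. e / 2 * x ^ k)" using x by (intro summable_mult summable_geometric) auto
      qed
      also have "(\<Sum>k. e / 2 * x ^ k) = e / 2 * (1 / (1 - x))"
        using x suminf_mult[OF summable_geometric[of x], of "e / 2"] suminf_geometric[of x] by simp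
      finally have "\<bar>\<Sum>k. (B k - L) * x ^ k\<bar> \<le> e / 2 * (1 / (1 - x)) + real K * R" by simp
      then have "(1 - x) * \<bar>\<Sum>k. (B k - L) * x ^ k\<bar> \<le> (1 - x) * (e / 2 * (1 / (1 - x)) + real K * R)"
        using x by (intro mult_left_mono) auto
      also have "\<dots> = e / 2 + (1 - x) * (real K * R)"
      proof -
        have "(1 - x) * (w * (1 / (1 - x))) = w" for w using x by simp
        then show ?thesis by (simp only: distrib_left)
      qed
      also have "\<dots> < e" using elim by simp
      finally show ?case using expand[OF x] x by (simp add: dist_real_def abs_mult)
    qed
  qed
qed

section \<open>Zeta near 1 and the prime zeta series\<close>

lemma powr_diff_mvt:
  assumes "1 < s" "1 \<le> (n::nat)"
  shows "real (Suc n) powr - s * (s - 1) \<le> real n powr (1 - s) - real (Suc n) powr (1 - s)"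
    and "real n powr (1 - s) - real (Suc n) powr (1 - s) \<le> real n powr - s * (s - 1)"
proof -
  have "\<exists>z>real n. z < real (Suc n) \<and> real (Suc n) powr (1 - s) - real n powr (1 - s) = (real (Suc n) - real n) * ((1 - s) * z powr (1 - s - 1))"
    using assms by (intro MVT2 has_real_derivative_powr) auto
  then obtain z where z: "real n < z" "z < real (Suc n)"
    "real n powr (1 - s) - real (Suc n) powr (1 - s) = z powr - s * (s - 1)"
    by (auto simp: algebra_simps)
  have "real (Suc n) powr - s \<le> z powr - s" "z powr - s \<le> real n powr - s"
    using z assms by (auto intro!: powr_mono2')
  then show "real (Suc n) powr - s * (s - 1) \<le> real n powr (1 - s) - real (Suc n) powr (1 - s)"
    "real n powr (1 - s) - real (Suc n) powr (1 - s) \<le> real n powr - s * (s - 1)"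
    using assms unfolding z(3) by (auto intro!: mult_right_mono)
qed

lemma zeta_summable: "1 < s \<Longrightarrow> summable (\<lambda>n. real (Suc n) powr - s)"
  by (subst summable_Suc_iff, subst summable_real_powr_iff) auto

lemma zeta_powr: "zeta s = (\<Sum>n. real (Suc n) powr - s)"
  by (simp add: zeta_def powr_minus divide_inverse)

text \<open>The integral test in telescoping form: \<open>(s - 1) * n powr - s\<close> is squeezed
  between consecutive differences of \<open>n powr (1 - s)\<close>. The result is the simple pole of
  zeta at 1.\<close>

lemma zeta_bounds:
  assumes "1 < s"
  shows "1 / (s - 1) \<le> zeta s" "zeta s \<le> 1 / (s - 1) + 1"
proof -
  have "(\<lambda>n. real (Suc n) powr (1 - s) - real (Suc (Suc n)) powr (1 - s)) sums (real (Suc 0) powr (1 - s) - 0)"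
    by (rule telescope_sums'[of "\<lambda>n. real (Suc n) powr (1 - s)"]) (use assms in real_asymp)
  then have tel: "(\<lambda>n. real (Suc n) powr (1 - s) - real (Suc (Suc n)) powr (1 - s)) sums 1" by simp
  have z: "(\<lambda>n. real (Suc n) powr - s) sums zeta s"
    unfolding zeta_powr using zeta_summable[OF assms] by (rule summable_sums)
  have "1 \<le> zeta s * (s - 1)"
  proof (rule sums_le[OF _ tel sums_mult2[OF z]])
    fix n show "real (Suc n) powr (1 - s) - real (Suc (Suc n)) powr (1 - s) \<le> real (Suc n) powr - s * (s - 1)"
      by (rule powr_diff_mvt(2)[OF assms]) simp
  qed
  then show "1 / (s - 1) \<le> zeta s" using assms by (simp add: field_simps)
  have z2: "(\<lambda>n. real (Suc (Suc n)) powr - s) sums (zeta s - 1)"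
    using z by (subst sums_Suc_iff) simp
  have "(zeta s - 1) * (s - 1) \<le> 1"
  proof (rule sums_le[OF _ sums_mult2[OF z2] tel])
    fix n show "real (Suc (Suc n)) powr - s * (s - 1) \<le> real (Suc n) powr (1 - s) - real (Suc (Suc n)) powr (1 - s)"
      by (rule powr_diff_mvt(1)[OF assms]) simp
  qed
  then show "zeta s \<le> 1 / (s - 1) + 1" using assms by (simp add: field_simps)
qed

lemma multiplicative_fun_powr: "multiplicative_fun (\<lambda>n. real n powr - s)"
  by unfold_locales (auto simp: powr_mult)

lemma zeta_euler_product:
  assumes "1 < s"
  shows "(\<lambda>N. \<Prod>p | prime p \<and> p \<le> N. 1 / (1 - real p powr - s)) \<longlonglongrightarrow> zeta s"
proof -
  interpret multiplicative_fun "\<lambda>n. real n powr - s" by (rule multiplicative_fun_powr)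
  have F: "((\<lambda>e. real (p ^ e) powr - s) has_sum 1 / (1 - real p powr - s)) UNIV" if "prime p" for p
  proof -
    have "1 < real p" using prime_gt_1_nat[OF that] by simp
    then have "real p powr - s < 1" using assms powr_less_mono2_neg[of "- s" 1 "real p"] by auto
    then have "(\<lambda>e. (real p powr - s) ^ e) sums (1 / (1 - real p powr - s))" by (intro geometric_sums) auto
    moreover have "(real p powr - s) ^ e = real (p ^ e) powr - s" for e
      using \<open>1 < real p\<close> by (simp add: powr_realpow[symmetric] powr_powr powr_powr_swap mult_ac flip: powr_realpow)
    ultimately show ?thesis by (intro sums_nonneg_imp_has_sum) auto
  qed
  have hs: "((\<lambda>n. real n powr - s) has_sum zeta s) {0<..}"
  proof -
    have "((\<lambda>n. real (Suc n) powr - s) has_sum zeta s) UNIV"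
      unfolding zeta_powr using zeta_summable[OF assms] by (intro sums_nonneg_imp_has_sum summable_sums) auto
    also have "?this \<longleftrightarrow> ?thesis"
      by (rule has_sum_reindex_bij_witness[where i = "\<lambda>n. n - 1" and j = Suc]) auto
    finally show ?thesis .
  qed
  then show ?thesis
    using euler_product_LIMSEQ[OF F] by (simp add: infsumI has_sum_imp_summable)
qed

lemma summable_inverse_square: "summable (\<lambda>n. 2 / (real n)\<^sup>2)"
  using inverse_power_summable[of 2, where 'a = real] by (simp add: divide_inverse summable_mult)

text \<open>What remains of \<open>ln (1 - p powr - s)\<close> once its first-order term
  \<open>- p powr - s\<close> is removed. At \<open>s = 1\<close> it is the summand of
  \<open>mertens_B1\<close>, and unlike the first-order term it is summable there.\<close>

definition euler_correction :: "real \<Rightarrow> nat \<Rightarrow> real" where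
  "euler_correction s n = (if prime n then ln (1 - real n powr - s) + real n powr - s else 0)"

lemma euler_correction_bound:
  assumes "1 \<le> s"
  shows "\<bar>euler_correction s n\<bar> \<le> 2 / (real n)\<^sup>2"
proof (cases "prime n")
  case True
  define x where "x = real n powr - s"
  have n: "2 \<le> n" using prime_ge_2_nat[OF True] .
  have "x \<le> real n powr - 1" unfolding x_def using n assms by (intro powr_mono) auto
  then have x: "0 < x" "x \<le> 1 / real n" using n by (auto simp: x_def powr_minus divide_inverse)
  moreover have "1 / real n \<le> 1 / 2" using n by (intro divide_left_mono) auto
  ultimately have x2: "x \<le> 1 / 2" by linarith
  have "- x - 2 * x\<^sup>2 \<le> ln (1 - x)" using x x2 ln_one_minus_pos_lower_bound[of x] by simp
  moreover have "ln (1 - x) \<le> - x" using x x2 ln_le_minus_one[of "1 - x"] by simp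
  ultimately have "\<bar>ln (1 - x) + x\<bar> \<le> 2 * x\<^sup>2" by simp
  also have "\<dots> \<le> 2 * (1 / real n)\<^sup>2" using x by (intro mult_left_mono power_mono) auto
  finally show ?thesis using True by (simp add: euler_correction_def x_def power_divide)
qed (simp add: euler_correction_def)

lemma summable_euler_correction: "1 \<le> s \<Longrightarrow> summable (euler_correction s)"
  using summable_comparison_test[OF _ summable_inverse_square] euler_correction_bound by force

text \<open>The logarithm of the Euler product with the first-order terms isolated. As
  \<open>s\<close> tends to 1, the prime series therefore diverges exactly like
  \<open>ln (zeta s)\<close>, up to a convergent correction.\<close>

lemma prime_zeta_sums:
  assumes "1 < s"
  shows "(\<lambda>n. if prime n then real n powr - s else 0) sums (ln (zeta s) + (\<Sum>n. euler_correction s n))"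
proof -
  have z: "0 < zeta s" using zeta_bounds(1)[OF assms] assms by (auto intro: less_le_trans[rotated])
  have lt: "real p powr - s < 1" if "prime p" for p
    using assms powr_less_mono2_neg[of "- s" 1 "real p"] prime_gt_1_nat[OF that] by auto
  have "(\<lambda>N. ln (\<Prod>p | prime p \<and> p \<le> N. 1 / (1 - real p powr - s))) \<longlonglongrightarrow> ln (zeta s)"
    by (rule tendsto_ln[OF zeta_euler_product[OF assms]]) (use z in simp)
  also have "(\<lambda>N. ln (\<Prod>p | prime p \<and> p \<le> N. 1 / (1 - real p powr - s)))
      = (\<lambda>N. \<Sum>n\<le>N. if prime n then - ln (1 - real n powr - s) else 0)"
  proof
    fix N
    have "ln (\<Prod>p | prime p \<and> p \<le> N. 1 / (1 - real p powr - s)) = (\<Sum>p | prime p \<and> p \<le> N. ln (1 / (1 - real p powr - s)))"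
    proof (rule ln_prod[OF finite_primes_le])
      fix p assume "p \<in> {p. prime p \<and> p \<le> N}"
      then have "real p powr - s < 1" using lt by blast
      then show "1 / (1 - real p powr - s) \<noteq> 0" by simp
    qed
    also have "\<dots> = (\<Sum>p | prime p \<and> p \<le> N. - ln (1 - real p powr - s))"
    proof (rule sum.cong[OF refl])
      fix p assume "p \<in> {p. prime p \<and> p \<le> N}"
      then have "real p powr - s < 1" using lt by blast
      then show "ln (1 / (1 - real p powr - s)) = - ln (1 - real p powr - s)" by (simp add: ln_div)
    qed
    finally show "ln (\<Prod>p | prime p \<and> p \<le> N. 1 / (1 - real p powr - s)) = (\<Sum>n\<le>N. if prime n then - ln (1 - real n powr - s) else 0)"
      by (simp only: sum_primes_eq)
  qed
  finally have "(\<lambda>n. if prime n then - ln (1 - real n powr - s) else 0) sums ln (zeta s)"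
    by (simp only: sums_def_le)
  moreover have "euler_correction s sums (\<Sum>n. euler_correction s n)"
    using assms by (intro summable_sums summable_euler_correction) simp
  ultimately have "(\<lambda>n. (if prime n then - ln (1 - real n powr - s) else 0) + euler_correction s n) sums (ln (zeta s) + (\<Sum>n. euler_correction s n))"
    by (rule sums_add)
  also have "(\<lambda>n. (if prime n then - ln (1 - real n powr - s) else 0) + euler_correction s n) = (\<lambda>n. if prime n then real n powr - s else 0)"
    by (auto simp: fun_eq_iff euler_correction_def)
  finally show ?thesis .
qed

lemma euler_correction_1: "(\<Sum>n. euler_correction 1 n) = mertens_B1 - euler_mascheroni"
proof -
  have "(\<lambda>n. norm (euler_correction 1 n)) summable_on UNIV"
    using summable_comparison_test[OF _ summable_inverse_square] euler_correction_bound[of 1]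
    by (intro summable_nonneg_imp_summable_on) force+
  then have "euler_correction 1 summable_on UNIV" by (rule abs_summable_summable)
  then have "(euler_correction 1 has_sum infsum (euler_correction 1) UNIV) UNIV" by simp
  then have "(\<Sum>n. euler_correction 1 n) = infsum (euler_correction 1) UNIV"
    by (intro sums_unique[symmetric] has_sum_imp_sums)
  also have "\<dots> = (\<Sum>\<^sub>\<infinity>p\<in>{p::nat. prime p}. ln (1 - 1 / real p) + 1 / real p)"
    by (rule infsum_cong_neutral) (auto simp: euler_correction_def powr_minus divide_inverse dest: prime_gt_0_nat)
  finally show ?thesis by (simp add: mertens_B1_def)
qed

text \<open>The majorant \<open>2 / n^2\<close> is uniform in \<open>s \<ge> 1\<close>, so Tannery's
  theorem moves the limit under the sum.\<close>

lemma euler_correction_LIMSEQ: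
  "(\<lambda>j. \<Sum>n. euler_correction (1 + 1 / real (Suc j)) n) \<longlonglongrightarrow> (\<Sum>n. euler_correction 1 n)"
proof -
  have "(\<lambda>j. euler_correction (1 + 1 / real (Suc j)) n) \<longlonglongrightarrow> euler_correction 1 n" for n
  proof (cases "prime n")
    case True
    then have n: "1 < real n" using prime_gt_1_nat by auto
    have s: "(\<lambda>j. 1 + 1 / real (Suc j)) \<longlonglongrightarrow> 1" by real_asymp
    have "1 - real n powr - 1 \<noteq> 0" using n by (auto simp: powr_minus field_simps)
    then have "(\<lambda>j. ln (1 - real n powr - (1 + 1 / real (Suc j))) + real n powr - (1 + 1 / real (Suc j))) \<longlonglongrightarrow> ln (1 - real n powr - 1) + real n powr - 1"
      using n by (intro tendsto_intros s) auto
    then show ?thesis using True by (simp add: euler_correction_def)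
  qed (simp add: euler_correction_def)
  note lim = this
  have "\<forall>\<^sub>F (n, j) in sequentially \<times>\<^sub>F sequentially. norm (euler_correction (1 + 1 / real (Suc j)) n) \<le> 2 / (real n)\<^sup>2"
    by (intro always_eventually) (auto intro!: euler_correction_bound simp del: of_nat_Suc)
  from tannerys_theorem[OF lim this summable_inverse_square] show ?thesis by simp
qed

text \<open>The blocks \<open>\<Sum> 1 / p\<close> over \<open>e\<^sup>k\<^sup>-\<^sup>1 < p \<le> e\<^sup>k\<close> are compared with \<open>1 / k\<close>: the partial sums of the differences
  tend to \<open>M - \<gamma>\<close>, and Abel's limit theorem evaluates the same limit at \<open>x = e\<^sup>-\<^sup>\<sigma>\<close> from \<open>log \<zeta>(1 + \<sigma>) + log (1 - e\<^sup>-\<^sup>\<sigma>) \<rightarrow> 0\<close>.\<close>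

lemma mertens_constant:
  assumes "mertens_weight prime_weight C"
  shows "mertens_weight.M prime_weight = mertens_B1"
proof -
  interpret mertens_weight prime_weight C by fact
  \<comment> \<open>\<open>A (exp K) = ln K + M + o(1)\<close> is set against the harmonic number,
    \<open>ln K + euler_mascheroni + o(1)\<close>; this is where Euler's constant enters.\<close>
  define b where "b = (\<lambda>k. if k = 0 then 0 else A (exp (real k)) - A (exp (real (k - 1))) - 1 / real k)"
  have bsum: "(\<Sum>k\<le>K. b k) = A (exp (real K)) - harm K" for K
  proof (induction K)
    case 0 then show ?case by (simp add: b_def A_eq_0 harm_def)
  next
    case (Suc K) then show ?case by (simp add: b_def harm_Suc divide_inverse)
  qed
  have blim: "(\<lambda>K. \<Sum>k\<le>K. b k) \<longlonglongrightarrow> M - euler_mascheroni"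
  proof -
    have "(\<lambda>K. A (exp (real K)) - ln (real K) - M) \<longlonglongrightarrow> 0"
    proof (rule Lim_null_comparison)
      show "\<forall>\<^sub>F K in sequentially. norm (A (exp (real K)) - ln (real K) - M) \<le> K1 / real K"
        using eventually_ge_at_top[of "1::nat"]
      proof eventually_elim
        case (elim K)
        have "2 \<le> exp (1::real)" using exp_ge_add_one_self[of 1] by simp
        also have "\<dots> \<le> exp (real K)" using elim by simp
        finally show ?case using A_asymp[of "exp (real K)"] by simp
      qed
    qed real_asymp
    from tendsto_diff[OF this euler_mascheroni_LIMSEQ] tendsto_add[OF _ tendsto_const[of M]]
    have "(\<lambda>K. (A (exp (real K)) - ln (real K) - M) - (harm K - ln (real K)) + M) \<longlonglongrightarrow> (0 - euler_mascheroni) + M"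
      by (intro tendsto_add tendsto_const) auto
    then show ?thesis unfolding bsum by (simp add: algebra_simps)
  qed
  define \<sigma> where "\<sigma> = (\<lambda>j. 1 / real (Suc j))"
  define x where "x = (\<lambda>j. exp (- \<sigma> j))"
  have \<sigma>: "0 < \<sigma> j" for j by (simp add: \<sigma>_def)
  have x: "0 < x j" "x j < 1" for j using \<sigma>[of j] by (auto simp: x_def)
  define P where "P = (\<lambda>j. \<Sum>n. prime_weight n * real n powr - \<sigma> j)"
  \<comment> \<open>This is \<open>P\<close> with \<open>ln n\<close> rounded up to an integer, so
    that the weight is constant on each block and a power series in \<open>x j\<close>
    results.\<close>
  define T where "T = (\<lambda>j. \<Sum>n. prime_weight n * x j ^ nat \<lceil>ln (real n)\<rceil>)"
  define E where "E = (\<lambda>j. \<Sum>n. euler_correction (1 + \<sigma> j) n)"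
  have Psums: "(\<lambda>n. prime_weight n * real n powr - \<sigma> j) sums (ln (zeta (1 + \<sigma> j)) + E j)" for j
  proof -
    have "(\<lambda>n. prime_weight n * real n powr - \<sigma> j) = (\<lambda>n. if prime n then real n powr - (1 + \<sigma> j) else 0)"
      by (auto simp: fun_eq_iff prime_weight_def powr_diff powr_minus divide_inverse dest: prime_gt_0_nat)
    then show ?thesis using prime_zeta_sums[of "1 + \<sigma> j"] \<sigma>[of j] unfolding E_def by simp
  qed
  then have P_eq: "P j = ln (zeta (1 + \<sigma> j)) + E j" for j unfolding P_def by (simp add: sums_iff)
  \<comment> \<open>Rounding \<open>ln n\<close> up by at most 1 costs at most a factor
    \<open>x j = exp (- \<sigma> j)\<close>, which tends to 1.\<close>
  have sandwich: "x j * (prime_weight n * real n powr - \<sigma> j) \<le> prime_weight n * x j ^ nat \<lceil>ln (real n)\<rceil>"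
    "prime_weight n * x j ^ nat \<lceil>ln (real n)\<rceil> \<le> prime_weight n * real n powr - \<sigma> j" for n j
  proof -
    have *: "x j * real n powr - \<sigma> j \<le> x j ^ nat \<lceil>ln (real n)\<rceil> \<and> x j ^ nat \<lceil>ln (real n)\<rceil> \<le> real n powr - \<sigma> j" if "n > 0"
    proof -
      define k where "k = real (nat \<lceil>ln (real n)\<rceil>)"
      have "0 \<le> ln (real n)" using that by simp
      then have k: "ln (real n) \<le> k" "k \<le> ln (real n) + 1" unfolding k_def by linarith+
      have "x j ^ nat \<lceil>ln (real n)\<rceil> = exp (- (\<sigma> j * k))" by (simp add: x_def k_def exp_of_nat_mult[symmetric] mult_ac)
      moreover have "real n powr - \<sigma> j = exp (- (\<sigma> j * ln (real n)))" using that by (simp add: powr_def)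
      moreover have "\<sigma> j * ln (real n) \<le> \<sigma> j * k" "\<sigma> j * k \<le> \<sigma> j * (ln (real n) + 1)"
        using k \<sigma>[of j] by (auto intro!: mult_left_mono)
      ultimately show ?thesis by (simp add: x_def exp_add[symmetric] distrib_left)
    qed
    show "x j * (prime_weight n * real n powr - \<sigma> j) \<le> prime_weight n * x j ^ nat \<lceil>ln (real n)\<rceil>"
      "prime_weight n * x j ^ nat \<lceil>ln (real n)\<rceil> \<le> prime_weight n * real n powr - \<sigma> j"
      using * mult_left_mono[OF _ nonneg[of n]] by (cases "n = 0"; force simp: c_small mult.left_commute)+
  qed
  have T_summable: "summable (\<lambda>n. prime_weight n * x j ^ nat \<lceil>ln (real n)\<rceil>)" for j
    by (rule summable_comparison_test[OF _ sums_summable[OF Psums[of j]]])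
       (use sandwich(2)[of _ j] less_imp_le[OF x(1)[of j]] nonneg in \<open>auto intro!: exI[of _ 0] simp: abs_mult power_abs\<close>)
  have TP: "x j * P j \<le> T j" "T j \<le> P j" for j
  proof -
    note s = sums_summable[OF Psums[of j]]
    have "x j * P j = (\<Sum>n. x j * (prime_weight n * real n powr - \<sigma> j))"
      unfolding P_def by (rule suminf_mult[OF s, symmetric])
    also have "\<dots> \<le> T j" unfolding T_def
      by (intro suminf_le sandwich T_summable summable_mult s)
    finally show "x j * P j \<le> T j" .
    show "T j \<le> P j" unfolding T_def P_def by (intro suminf_le sandwich T_summable s)
  qed
  \<comment> \<open>Block \<open>k\<close> carries the weight \<open>b k + 1 / k\<close>, and the
    terms \<open>x j ^ k / k\<close> sum to \<open>- ln (1 - x j)\<close>.\<close>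
  have T_eq: "T j = (\<Sum>k. b k * x j ^ k) - ln (1 - x j)" for j
  proof -
    have part: "(\<Sum>n | real n \<le> exp (real K). prime_weight n * x j ^ nat \<lceil>ln (real n)\<rceil>)
        = (\<Sum>k\<le>K. b k * x j ^ k) + (\<Sum>k\<le>K. x j ^ k / real k)" for K
    proof (induction K)
      case 0
      have "(\<Sum>n | real n \<le> 1. prime_weight n * x j ^ nat \<lceil>ln (real n)\<rceil>) = 0"
        by (rule sum.neutral) (auto simp: c_small)
      then show ?case by (simp add: b_def)
    next
      case (Suc K)
      define G where "G = {n. real n \<le> exp (real (Suc K)) \<and> exp (real K) < real n}"
      have u: "{n. real n \<le> exp (real (Suc K))} = {n. real n \<le> exp (real K)} \<union> G"
        unfolding G_def by (auto intro: order.trans)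
      have fin: "finite G" unfolding G_def by simp
      have split: "(\<Sum>n | real n \<le> exp (real (Suc K)). f n) = (\<Sum>n | real n \<le> exp (real K). f n) + sum f G" for f :: "nat \<Rightarrow> real"
        unfolding u using fin by (intro sum.union_disjoint) (auto simp: G_def)
      have "(\<Sum>n\<in>G. prime_weight n * x j ^ nat \<lceil>ln (real n)\<rceil>) = (\<Sum>n\<in>G. prime_weight n * x j ^ Suc K)"
      proof (rule sum.cong[OF refl])
        fix n assume n: "n \<in> G"
        then have "0 < real n" unfolding G_def using exp_gt_zero[of "real K"] by (auto intro: less_trans simp del: exp_gt_zero)
        then have "ln (exp (real K)) < ln (real n)" "ln (real n) \<le> ln (exp (real (Suc K)))"
          using n unfolding G_def by (subst ln_less_cancel_iff ln_le_cancel_iff; simp)+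
        then have "real K < ln (real n)" "ln (real n) \<le> real (Suc K)" by (simp_all only: ln_exp)
        then have "\<lceil>ln (real n)\<rceil> = int (Suc K)" by (intro ceiling_unique) auto
        then show "prime_weight n * x j ^ nat \<lceil>ln (real n)\<rceil> = prime_weight n * x j ^ Suc K" by (simp only: nat_int)
      qed
      also have "\<dots> = sum prime_weight G * x j ^ Suc K" by (simp only: sum_distrib_right)
      also have "sum prime_weight G = A (exp (real (Suc K))) - A (exp (real K))" unfolding A_def split by simp
      also have "\<dots> = b (Suc K) + 1 / real (Suc K)" by (simp add: b_def)
      finally show ?case unfolding split Suc.IH by (simp add: algebra_simps del: power_Suc of_nat_Suc)
    qed
    have Tlim: "(\<lambda>K. \<Sum>n | real n \<le> exp (real K). prime_weight n * x j ^ nat \<lceil>ln (real n)\<rceil>) \<longlonglongrightarrow> T j"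
    proof -
      have "(\<lambda>N. \<Sum>n\<le>N. prime_weight n * x j ^ nat \<lceil>ln (real n)\<rceil>) \<longlonglongrightarrow> T j"
        using summable_sums[OF T_summable] unfolding T_def sums_def_le .
      moreover have "filterlim (\<lambda>K::nat. nat \<lfloor>exp (real K)\<rfloor>) sequentially sequentially" by real_asymp
      ultimately have "(\<lambda>K. \<Sum>n\<le>nat \<lfloor>exp (real K)\<rfloor>. prime_weight n * x j ^ nat \<lceil>ln (real n)\<rceil>) \<longlonglongrightarrow> T j"
        by (rule filterlim_compose)
      then show ?thesis by (simp add: real_nat_le_eq)
    qed
    have "(\<lambda>n. - ((- (- x j)) ^ n) / of_nat n) sums ln (1 + - x j)"
      using x[of j] by (intro ln_series') auto
    then have lnsums: "(\<lambda>n. x j ^ n / real n) sums (- ln (1 - x j))"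
      using sums_minus by fastforce
    then have "(\<lambda>K. \<Sum>k\<le>K. x j ^ k / real k) \<longlonglongrightarrow> - ln (1 - x j)" by (simp add: sums_def_le)
    from tendsto_diff[OF Tlim this] have "(\<lambda>K. \<Sum>k\<le>K. b k * x j ^ k) \<longlonglongrightarrow> T j - (- ln (1 - x j))"
      unfolding part by simp
    then have "(\<lambda>k. b k * x j ^ k) sums (T j - (- ln (1 - x j)))" by (simp only: sums_def_le)
    then show ?thesis by (simp add: sums_iff)
  qed
  have "filterlim x (at_left 1) sequentially"
    unfolding x_def \<sigma>_def by real_asymp
  then have 1: "(\<lambda>j. \<Sum>k. b k * x j ^ k) \<longlonglongrightarrow> M - euler_mascheroni"
    by (rule filterlim_compose[OF abel_limit[OF blim]])
  have Elim: "E \<longlonglongrightarrow> mertens_B1 - euler_mascheroni"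
    using euler_correction_LIMSEQ unfolding E_def \<sigma>_def euler_correction_1 by simp
  have zb: "ln (1 / \<sigma> j) \<le> ln (zeta (1 + \<sigma> j))" "ln (zeta (1 + \<sigma> j)) \<le> ln (1 / \<sigma> j + 1)" for j
  proof -
    have "1 / \<sigma> j \<le> zeta (1 + \<sigma> j)" "zeta (1 + \<sigma> j) \<le> 1 / \<sigma> j + 1"
      using zeta_bounds[of "1 + \<sigma> j"] \<sigma>[of j] by auto
    moreover have "0 < 1 / \<sigma> j" using \<sigma>[of j] by simp
    ultimately show "ln (1 / \<sigma> j) \<le> ln (zeta (1 + \<sigma> j))" "ln (zeta (1 + \<sigma> j)) \<le> ln (1 / \<sigma> j + 1)"
      by (subst ln_le_cancel_iff; linarith)+
  qed
  \<comment> \<open>\<open>zeta (1 + \<sigma> j)\<close> is \<open>1 / \<sigma> j\<close> up to a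
    bounded term and \<open>1 - exp (- \<sigma> j)\<close> is asymptotic to
    \<open>\<sigma> j\<close>, so the two logarithms cancel.\<close>
  have 2: "(\<lambda>j. ln (zeta (1 + \<sigma> j)) + ln (1 - x j)) \<longlonglongrightarrow> 0"
  proof (rule tendsto_sandwich)
    show "\<forall>\<^sub>F j in sequentially. ln (1 / \<sigma> j) + ln (1 - x j) \<le> ln (zeta (1 + \<sigma> j)) + ln (1 - x j)" using zb by simp
    show "\<forall>\<^sub>F j in sequentially. ln (zeta (1 + \<sigma> j)) + ln (1 - x j) \<le> ln (1 / \<sigma> j + 1) + ln (1 - x j)" using zb by simp
    show "(\<lambda>j. ln (1 / \<sigma> j) + ln (1 - x j)) \<longlonglongrightarrow> 0" unfolding x_def \<sigma>_def by real_asymp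
    show "(\<lambda>j. ln (1 / \<sigma> j + 1) + ln (1 - x j)) \<longlonglongrightarrow> 0" unfolding x_def \<sigma>_def by real_asymp
  qed
  \<comment> \<open>\<open>P - T\<close> is at most \<open>(1 - x) * P\<close>, and \<open>P\<close>
    grows only like the logarithm of \<open>1 / \<sigma>\<close>, while \<open>1 - x\<close> is of
    order \<open>\<sigma>\<close>.\<close>
  have 3: "(\<lambda>j. P j - T j) \<longlonglongrightarrow> 0"
  proof (rule tendsto_sandwich[OF _ _ tendsto_const])
    show "\<forall>\<^sub>F j in sequentially. 0 \<le> P j - T j" using TP by simp
    show "\<forall>\<^sub>F j in sequentially. P j - T j \<le> (1 - x j) * (ln (1 / \<sigma> j + 1)) + (1 - x j) * E j"
    proof (intro always_eventually allI)
      fix j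
      have "P j - T j \<le> (1 - x j) * P j" using TP(1)[of j] by (simp add: algebra_simps)
      also have "\<dots> \<le> (1 - x j) * (ln (1 / \<sigma> j + 1) + E j)"
        using zb(2)[of j] x[of j] unfolding P_eq by (intro mult_left_mono) auto
      finally show "P j - T j \<le> (1 - x j) * (ln (1 / \<sigma> j + 1)) + (1 - x j) * E j" by (simp add: distrib_left)
    qed
    have "(\<lambda>j. (1 - x j) * (ln (1 / \<sigma> j + 1))) \<longlonglongrightarrow> 0" unfolding x_def \<sigma>_def by real_asymp
    moreover have "(\<lambda>j. 1 - x j) \<longlonglongrightarrow> 0" unfolding x_def \<sigma>_def by real_asymp
    ultimately have "(\<lambda>j. (1 - x j) * (ln (1 / \<sigma> j + 1)) + (1 - x j) * E j) \<longlonglongrightarrow> 0 + 0 * (mertens_B1 - euler_mascheroni)"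
      by (intro tendsto_add tendsto_mult Elim)
    then show "(\<lambda>j. (1 - x j) * (ln (1 / \<sigma> j + 1)) + (1 - x j) * E j) \<longlonglongrightarrow> 0" by simp
  qed
  have "(\<lambda>j. (\<Sum>k. b k * x j ^ k) + (P j - T j) - (ln (zeta (1 + \<sigma> j)) + ln (1 - x j))) \<longlonglongrightarrow> (M - euler_mascheroni) + 0 - 0"
    by (intro tendsto_add tendsto_diff 1 2 3)
  also have "(\<lambda>j. (\<Sum>k. b k * x j ^ k) + (P j - T j) - (ln (zeta (1 + \<sigma> j)) + ln (1 - x j))) = E"
    by (rule ext) (simp add: T_eq P_eq)
  finally have "M - euler_mascheroni = mertens_B1 - euler_mascheroni"
    using LIMSEQ_unique[OF _ Elim] by simp
  then show ?thesis by simp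
qed

section \<open>The arithmetic of h-full numbers\<close>

definition h_core :: "nat \<Rightarrow> nat \<Rightarrow> bool" where
  "h_core h b \<longleftrightarrow> 0 < b \<and> (\<forall>p. prime p \<longrightarrow> multiplicity p b = 0 \<or> (h < multiplicity p b \<and> multiplicity p b < 2 * h))"

lemma h_full_iff:
  "h_full h n \<longleftrightarrow> 0 < n \<and> (\<forall>p. prime p \<longrightarrow> multiplicity p n = 0 \<or> h \<le> multiplicity p n)"
  unfolding h_full_def by (auto simp: prime_factors_multiplicity)

lemma multiplicity_power_mult:
  fixes a b :: nat
  assumes "prime p" "0 < a" "0 < b"
  shows "multiplicity p (a ^ h * b) = h * multiplicity p a + multiplicity p b"
  using assms by (simp add: prime_elem_multiplicity_mult_distrib prime_elem_multiplicity_power_distrib)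

text \<open>A residue \<open>r > 0\<close> of the exponent modulo \<open>h\<close> goes into the
  core as \<open>h + r\<close> and not as \<open>r\<close>. An h-full exponent has room for this,
  and in exchange \<open>a\<close> and \<open>b\<close> become independent: with \<open>r\<close>
  alone, \<open>p dvd b\<close> would force \<open>p dvd a\<close>.\<close>

definition core_exponent :: "nat \<Rightarrow> nat \<Rightarrow> nat" where
  "core_exponent h e = (if h dvd e then 0 else h + e mod h)"

lemma core_exponent_props:
  assumes "2 \<le> h" "e = 0 \<or> h \<le> e"
  shows "h * ((e - core_exponent h e) div h) + core_exponent h e = e"
    and "core_exponent h e = 0 \<or> (h < core_exponent h e \<and> core_exponent h e < 2 * h)"
proof -
  show "core_exponent h e = 0 \<or> (h < core_exponent h e \<and> core_exponent h e < 2 * h)"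
    using assms by (auto simp: core_exponent_def mod_greater_zero_iff_not_dvd)
  have "h dvd e - core_exponent h e \<and> core_exponent h e \<le> e"
  proof (cases "h dvd e")
    case False
    then have "h \<le> e" using assms by auto
    have e: "e = e div h * h + e mod h" by simp
    have "1 \<le> e div h" using \<open>h \<le> e\<close> assms by (simp add: Suc_le_eq div_greater_zero_iff)
    then have "h \<le> e div h * h" by (cases "e div h") auto
    then have "h + e mod h \<le> e" using e by linarith
    moreover have "e - (h + e mod h) = e div h * h - h" using e by linarith
    then have "h dvd e - (h + e mod h)" by (simp add: dvd_diff_nat)
    ultimately show ?thesis using False by (simp add: core_exponent_def)
  qed (simp add: core_exponent_def)
  then show "h * ((e - core_exponent h e) div h) + core_exponent h e = e" by auto
qed

lemma core_exponent_unique: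
  assumes "\<beta> = 0 \<or> (h < \<beta> \<and> \<beta> < 2 * h)"
  shows "core_exponent h (h * \<alpha> + \<beta>) = \<beta>"
proof (cases "\<beta> = 0")
  case False
  then have b: "h < \<beta>" "\<beta> < 2 * h" using assms by auto
  then obtain r where r: "\<beta> = h + r" "0 < r" "r < h" by (metis less_imp_add_positive mult_2 nat_add_left_cancel_less)
  have "h * \<alpha> + \<beta> = r + h * (\<alpha> + 1)" using r by simp
  then have "(h * \<alpha> + \<beta>) mod h = r" using r by (simp only: mod_mult_self2 mod_less)
  then show ?thesis using r by (simp add: core_exponent_def dvd_eq_mod_eq_0)
qed (simp add: core_exponent_def)

text \<open>The decomposition is carried out on the exponent of each prime separately; as
  multiplicities determine an integer, existence and uniqueness of \<open>a\<close> and
  \<open>b\<close> follow from those of the core exponent.\<close>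

lemma bij_betw_h_full:
  assumes h: "2 \<le> h"
  shows "bij_betw (\<lambda>(a, b). a ^ h * b) ({0<..} \<times> {b. h_core h b}) {n. h_full h n}"
proof (rule bij_betw_imageI)
  show "inj_on (\<lambda>(a, b). a ^ h * b) ({0<..} \<times> {b. h_core h b})"
  proof (rule inj_onI, clarsimp)
    fix a b a' b' :: nat
    assume a: "0 < a" "0 < a'" and b: "h_core h b" "h_core h b'" and eq: "a ^ h * b = a' ^ h * b'"
    have pos: "0 < b" "0 < b'" using b by (auto simp: h_core_def)
    have m: "multiplicity p b = multiplicity p b' \<and> multiplicity p a = multiplicity p a'" if p: "prime p" for p
    proof -
      have e: "h * multiplicity p a + multiplicity p b = h * multiplicity p a' + multiplicity p b'"
        using multiplicity_power_mult[OF p, of a b h] multiplicity_power_mult[OF p, of a' b' h] a pos eq by simp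
      have "multiplicity p b = core_exponent h (h * multiplicity p a + multiplicity p b)"
        using b p by (intro core_exponent_unique[symmetric]) (auto simp: h_core_def)
      also have "\<dots> = multiplicity p b'"
        unfolding e using b p by (intro core_exponent_unique) (auto simp: h_core_def)
      finally show ?thesis using e h by simp
    qed
    have "a = a'" by (rule multiplicity_eq_nat) (use m a in auto)
    moreover have "b = b'" by (rule multiplicity_eq_nat) (use m pos in auto)
    ultimately show "a = a' \<and> b = b'" ..
  qed
  show "(\<lambda>(a, b). a ^ h * b) ` ({0<..} \<times> {b. h_core h b}) = {n. h_full h n}"
  proof (intro equalityI subsetI)
    fix n assume "n \<in> (\<lambda>(a, b). a ^ h * b) ` ({0<..} \<times> {b. h_core h b})"
    then obtain a b where ab: "n = a ^ h * b" "0 < a" "h_core h b" by auto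
    then have b: "0 < b" by (simp add: h_core_def)
    have "multiplicity p n = 0 \<or> h \<le> multiplicity p n" if p: "prime p" for p
    proof -
      have e: "multiplicity p n = h * multiplicity p a + multiplicity p b"
        unfolding ab(1) by (rule multiplicity_power_mult[OF p ab(2) b])
      show ?thesis
      proof (cases "multiplicity p a = 0")
        case True then show ?thesis using e ab(3) p by (auto simp: h_core_def)
      next
        case False
        then have "h * 1 \<le> h * multiplicity p a" by (intro mult_left_mono) auto
        then show ?thesis using e by linarith
      qed
    qed
    then show "n \<in> {n. h_full h n}" using ab b by (simp add: h_full_iff)
  next
    fix n assume "n \<in> {n. h_full h n}"
    then have n: "0 < n" "\<And>p. prime p \<Longrightarrow> multiplicity p n = 0 \<or> h \<le> multiplicity p n" by (auto simp: h_full_iff)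
    define S where "S = prime_factors n"
    define be where "be = (\<lambda>p. core_exponent h (multiplicity p n))"
    define al where "al = (\<lambda>p. (multiplicity p n - be p) div h)"
    define a b where "a = (\<Prod>p\<in>S. p ^ al p)" and "b = (\<Prod>p\<in>S. p ^ be p)"
    have S: "finite S" "\<And>p. p \<in> S \<Longrightarrow> prime p" by (auto simp: S_def)
    have pos: "0 < a" "0 < b" unfolding a_def b_def using S by (auto intro!: prod_pos simp: prime_gt_0_nat)
    have ma: "multiplicity p a = al p" and mb: "multiplicity p b = be p" if p: "prime p" for p
    proof -
      have "p \<notin> S \<Longrightarrow> multiplicity p n = 0" using p by (auto simp: S_def prime_factors_multiplicity)
      then have "p \<notin> S \<Longrightarrow> al p = 0 \<and> be p = 0" by (simp add: al_def be_def core_exponent_def)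
      then show "multiplicity p a = al p" "multiplicity p b = be p"
        unfolding a_def b_def using multiplicity_prod_prime_powers[OF S p] by auto
    qed
    have "n = a ^ h * b"
    proof (rule multiplicity_eq_nat)
      fix p :: nat assume p: "prime p"
      show "multiplicity p n = multiplicity p (a ^ h * b)"
        unfolding multiplicity_power_mult[OF p pos] ma[OF p] mb[OF p]
        using core_exponent_props(1)[OF h n(2)[OF p]] by (simp add: al_def be_def)
    qed (use n pos in auto)
    moreover have "h_core h b"
      unfolding h_core_def using pos core_exponent_props(2)[OF h n(2)] by (simp add: mb be_def)
    ultimately show "n \<in> (\<lambda>(a, b). a ^ h * b) ` ({0<..} \<times> {b. h_core h b})" using pos by force
  qed
qed

text \<open>For a finite set \<open>D\<close> of primes the product is \<open>gcd (\<Prod>D, n)\<^sup>\<kappa>\<close>.\<close>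

definition core_fun :: "nat \<Rightarrow> real \<Rightarrow> real \<Rightarrow> nat set \<Rightarrow> nat \<Rightarrow> real" where
  "core_fun h s \<kappa> D n = (if h_core h n then real n powr - s else 0) *
     (\<Prod>p\<in>D. if p dvd n then real p powr \<kappa> else 1)"

text \<open>The nontrivial part of the local factor at \<open>p\<close> of the series of
  \<open>b powr - s\<close> over the cores \<open>b\<close>: a core has exponent 0 or an exponent
  from \<open>h + 1\<close> to \<open>2 * h - 1\<close> at \<open>p\<close>.\<close>

definition core_mu :: "nat \<Rightarrow> real \<Rightarrow> nat \<Rightarrow> real" where
  "core_mu h s p = (\<Sum>e=Suc h..<2 * h. real p powr - (s * real e))"

lemma core_mu_nonneg: "0 \<le> core_mu h s p"
  unfolding core_mu_def by (intro sum_nonneg) auto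

lemma h_core_prime_power_mult:
  assumes p: "prime p" "\<not> p dvd m"
  shows "h_core h (p ^ e * m) \<longleftrightarrow> h_core h (p ^ e) \<and> h_core h m"
proof (cases "m = 0")
  case False
  have p0: "0 < p ^ e" using p by (simp add: prime_gt_0_nat)
  have mult: "multiplicity q (p ^ e * m) = multiplicity q (p ^ e) + multiplicity q m" if "prime q" for q
    using that p0 False by (simp add: prime_elem_multiplicity_mult_distrib)
  have pm: "multiplicity p m = 0" using p(2) by (rule not_dvd_imp_multiplicity_0)
  have qp: "multiplicity q (p ^ e) = 0" if "prime q" "q \<noteq> p" for q
    using that p by (simp add: prime_elem_multiplicity_power_distrib prime_multiplicity_other)
  define P where "P = (\<lambda>k. k = 0 \<or> (h < k \<and> k < 2 * h))"
  have "P (multiplicity q (p ^ e * m)) \<longleftrightarrow> P (multiplicity q (p ^ e)) \<and> P (multiplicity q m)" if q: "prime q" for q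
    using mult[OF q] pm qp[OF q] by (cases "q = p") (auto simp: P_def)
  moreover have "h_core h k \<longleftrightarrow> 0 < k \<and> (\<forall>q. prime q \<longrightarrow> P (multiplicity q k))" for k
    by (simp add: h_core_def P_def)
  ultimately show ?thesis using p0 False by auto
qed (use p in auto)

lemma h_core_1: "h_core h 1" by (simp add: h_core_def)

lemma h_core_prime_power:
  assumes "prime p"
  shows "h_core h (p ^ e) \<longleftrightarrow> e = 0 \<or> (h < e \<and> e < 2 * h)"
proof -
  have m: "multiplicity q (p ^ e) = (if q = p then e else 0)" if "prime q" for q
    using that assms by (auto simp: prime_elem_multiplicity_power_distrib prime_multiplicity_other)
  show ?thesis unfolding h_core_def using assms m by (auto simp: prime_gt_0_nat)
qed

lemma multiplicative_core_fun:
  assumes "\<And>p. p \<in> D \<Longrightarrow> prime p"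
  shows "multiplicative_fun (core_fun h s \<kappa> D)"
proof
  have "\<not> p dvd 1" if "p \<in> D" for p using assms[OF that] by (auto dest: not_prime_unit)
  then show "core_fun h s \<kappa> D 1 = 1" unfolding core_fun_def using h_core_1 by simp
  fix p m e :: nat assume p: "prime p" "\<not> p dvd m"
  have "(\<Prod>q\<in>D. if q dvd p ^ e * m then real q powr \<kappa> else 1)
     = (\<Prod>q\<in>D. (if q dvd p ^ e then real q powr \<kappa> else 1) * (if q dvd m then real q powr \<kappa> else 1))"
  proof (rule prod.cong[OF refl])
    fix q assume "q \<in> D"
    then have q: "prime q" by (rule assms)
    have "q dvd p ^ e \<Longrightarrow> q = p" using p q by (metis prime_dvd_power primes_dvd_imp_eq)
    then show "(if q dvd p ^ e * m then real q powr \<kappa> else 1) = (if q dvd p ^ e then real q powr \<kappa> else 1) * (if q dvd m then real q powr \<kappa> else 1)"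
      using p q by (auto simp: prime_dvd_mult_iff)
  qed
  then show "core_fun h s \<kappa> D (p ^ e * m) = core_fun h s \<kappa> D (p ^ e) * core_fun h s \<kappa> D m"
    unfolding core_fun_def h_core_prime_power_mult[OF p] by (simp add: prod.distrib powr_mult)
qed (auto simp: core_fun_def intro!: mult_nonneg_nonneg prod_nonneg)

text \<open>For \<open>p\<close> in \<open>D\<close> every term except \<open>e = 0\<close> carries
  \<open>p powr \<kappa>\<close>; a prime outside \<open>D\<close> contributes as in the plain
  series.\<close>

lemma core_fun_local_factor:
  assumes "\<And>p. p \<in> D \<Longrightarrow> prime p" "finite D" "prime p"
  shows "((\<lambda>e. core_fun h s \<kappa> D (p ^ e)) has_sum (1 + (if p \<in> D then real p powr \<kappa> else 1) * core_mu h s p)) UNIV"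
proof -
  interpret multiplicative_fun "core_fun h s \<kappa> D" by (rule multiplicative_core_fun) (use assms in auto)
  have "core_fun h s \<kappa> D (p ^ e) = (if p \<in> D then real p powr \<kappa> else 1) * real p powr - (s * real e)" if e: "e \<in> {Suc h..<2 * h}" for e
  proof -
    have "(\<Prod>q\<in>D. if q dvd p ^ e then real q powr \<kappa> else 1) = (\<Prod>q\<in>D. if q = p then real p powr \<kappa> else 1)"
    proof (rule prod.cong[OF refl])
      fix q assume "q \<in> D"
      then have "prime q" by (rule assms)
      then have "q dvd p ^ e \<longleftrightarrow> q = p" using assms(3) e by (auto simp: prime_dvd_power_iff dest: primes_dvd_imp_eq)
      then show "(if q dvd p ^ e then real q powr \<kappa> else 1) = (if q = p then real p powr \<kappa> else 1)" by simp
    qed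
    also have "\<dots> = (if p \<in> D then real p powr \<kappa> else 1)" using assms(2) by simp
    finally have "(\<Prod>q\<in>D. if q dvd p ^ e then real q powr \<kappa> else 1) = (if p \<in> D then real p powr \<kappa> else 1)" .
    moreover have "real (p ^ e) powr - s = real p powr - (s * real e)"
      using prime_gt_0_nat[OF assms(3)] by (simp add: powr_realpow[symmetric] powr_powr mult.commute)
    ultimately show ?thesis using e h_core_prime_power[OF assms(3)] by (simp add: core_fun_def)
  qed
  then have "(\<Sum>e\<in>{Suc h..<2 * h}. core_fun h s \<kappa> D (p ^ e)) = (if p \<in> D then real p powr \<kappa> else 1) * core_mu h s p"
    unfolding core_mu_def sum_distrib_left by (intro sum.cong) auto
  then have "(\<Sum>e\<in>insert 0 {Suc h..<2 * h}. core_fun h s \<kappa> D (p ^ e)) = 1 + (if p \<in> D then real p powr \<kappa> else 1) * core_mu h s p"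
    using one by simp
  moreover have "core_fun h s \<kappa> D (p ^ e) = 0" if "e \<notin> insert 0 {Suc h..<2 * h}" for e
    using that h_core_prime_power[OF assms(3), of h e] by (auto simp: core_fun_def)
  ultimately show ?thesis by (intro has_sum_finite_neutralI[of "insert 0 {Suc h..<2 * h}"]) auto
qed

text \<open>There are \<open>h - 1\<close> terms and the first is the largest; its exponent
  \<open>s * (h + 1)\<close> governs the convergence of the whole series.\<close>

lemma core_mu_le:
  assumes "prime p" "0 < s"
  shows "core_mu h s p \<le> real h * real p powr - (s * real (Suc h))"
proof -
  have "1 < real p" using prime_gt_1_nat[OF assms(1)] by simp
  then have "core_mu h s p \<le> (\<Sum>e=Suc h..<2 * h. real p powr - (s * real (Suc h)))"
    unfolding core_mu_def using assms by (intro sum_mono powr_mono) auto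
  also have "\<dots> = real (h - 1) * real p powr - (s * real (Suc h))" by simp
  also have "\<dots> \<le> real h * real p powr - (s * real (Suc h))" by (intro mult_right_mono) auto
  finally show ?thesis .
qed

section \<open>The Dirichlet series of the cores and its Euler product\<close>

definition core_sum :: "nat \<Rightarrow> real \<Rightarrow> real" where
  "core_sum h s = infsum (core_fun h s 0 {}) {0<..}"

lemma core_fun_plain: "core_fun h s \<kappa> {} n = (if h_core h n then real n powr - s else 0)"
  by (simp add: core_fun_def)

context
  fixes h :: nat and s :: real
  assumes s: "1 < s * real (Suc h)"
begin

lemma s_pos: "0 < s"
proof (rule ccontr)
  assume "\<not> 0 < s"
  then have "s * real (Suc h) \<le> 0" by (intro mult_nonpos_nonneg) auto
  then show False using s by simp
qed

text \<open>The partial Euler products are at most the exponential of the sum of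
  \<open>core_mu\<close>, which is finite because \<open>s * (h + 1) > 1\<close>.\<close>

lemma core_summable: "core_fun h s 0 {} summable_on {0<..}"
proof -
  interpret multiplicative_fun "core_fun h s 0 {}" by (rule multiplicative_core_fun) auto
  have F: "((\<lambda>e. core_fun h s 0 {} (p ^ e)) has_sum (1 + core_mu h s p)) UNIV" if "prime p" for p
    using core_fun_local_factor[of "{}" p h s 0] that by simp
  define Z where "Z = (\<Sum>n. real n powr - (s * real (Suc h)))"
  have summ: "summable (\<lambda>n. real n powr - (s * real (Suc h)))" using s by (subst summable_real_powr_iff) auto
  show ?thesis
  proof (rule summable_on_if_bounded[OF F])
    fix N
    have "(\<Prod>p | prime p \<and> p \<le> N. 1 + core_mu h s p) \<le> (\<Prod>p | prime p \<and> p \<le> N. exp (core_mu h s p))"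
      using core_mu_nonneg by (intro prod_mono) (auto simp: add_nonneg_nonneg)
    also have "\<dots> = exp (\<Sum>p | prime p \<and> p \<le> N. core_mu h s p)" by (simp add: exp_sum)
    also have "\<dots> \<le> exp (\<Sum>p | prime p \<and> p \<le> N. real h * real p powr - (s * real (Suc h)))"
      using s_pos by (subst exp_le_cancel_iff, intro sum_mono core_mu_le) auto
    also have "\<dots> = exp (real h * (\<Sum>p | prime p \<and> p \<le> N. real p powr - (s * real (Suc h))))" by (simp only: sum_distrib_left)
    also have "\<dots> \<le> exp (real h * Z)"
      unfolding Z_def by (subst exp_le_cancel_iff, intro mult_left_mono sum_le_suminf summ) auto
    finally show "(\<Prod>p | prime p \<and> p \<le> N. 1 + core_mu h s p) \<le> exp (real h * Z)" .
  qed
qed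

lemma core_euler_product: "(\<lambda>N. \<Prod>p | prime p \<and> p \<le> N. 1 + core_mu h s p) \<longlonglongrightarrow> core_sum h s"
proof -
  interpret multiplicative_fun "core_fun h s 0 {}" by (rule multiplicative_core_fun) auto
  have F: "((\<lambda>e. core_fun h s 0 {} (p ^ e)) has_sum (1 + core_mu h s p)) UNIV" if "prime p" for p
    using core_fun_local_factor[of "{}" p h s 0] that by simp
  show ?thesis unfolding core_sum_def by (rule euler_product_LIMSEQ[OF F core_summable])
qed

lemma core_sum_ge_1: "1 \<le> core_sum h s"
proof -
  have "(\<Sum>n\<in>{1}. core_fun h s 0 {} n) \<le> core_sum h s"
    unfolding core_sum_def by (rule finite_sum_le_infsum[OF core_summable]) (auto simp: core_fun_plain)
  then show ?thesis using h_core_1 by (simp add: core_fun_plain)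
qed

text \<open>Both Euler products share the factors at the primes outside \<open>D\<close>.\<close>

lemma core_fun_has_sum:
  assumes "finite D" "\<And>p. p \<in> D \<Longrightarrow> prime p"
  shows "\<exists>R. 0 \<le> R \<and> R \<le> core_sum h s \<and> core_sum h s = (\<Prod>p\<in>D. 1 + core_mu h s p) * R \<and>
    (core_fun h s \<kappa> D has_sum ((\<Prod>p\<in>D. 1 + real p powr \<kappa> * core_mu h s p) * R)) {0<..}"
proof -
  define Q where "Q = {p. prime p \<and> p \<notin> D}"
  have all: "generated_by (D \<union> Q) = {0<..}"
    unfolding generated_by_def Q_def by auto
  interpret f: multiplicative_fun "core_fun h s 0 {}" by (rule multiplicative_core_fun) auto
  interpret g: multiplicative_fun "core_fun h s \<kappa> D" by (rule multiplicative_core_fun) (use assms in auto)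
  \<comment> \<open>\<open>R\<close> is the part of the series prime to \<open>D\<close>. That it
    stays below the full series makes the later error bounds uniform in \<open>D\<close>.\<close>
  define R where "R = infsum (core_fun h s 0 {}) (generated_by Q)"
  have sub: "generated_by Q \<subseteq> {0<..}" by (auto simp: generated_by_def)
  have fR: "(core_fun h s 0 {} has_sum R) (generated_by Q)"
    unfolding R_def using summable_on_subset[OF core_summable sub] by simp
  have gR: "(core_fun h s \<kappa> D has_sum R) (generated_by Q)"
  proof -
    have "(core_fun h s \<kappa> D has_sum R) (generated_by Q) \<longleftrightarrow> (core_fun h s 0 {} has_sum R) (generated_by Q)"
    proof (rule has_sum_cong)
      fix n assume n: "n \<in> generated_by Q"
      have "\<not> p dvd n" if "p \<in> D" for p
        using n that assms(2)[OF that] by (auto simp: generated_by_def Q_def prime_factors_dvd)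
      then show "core_fun h s \<kappa> D n = core_fun h s 0 {} n" by (simp add: core_fun_def)
    qed
    then show ?thesis using fR by simp
  qed
  have "(core_fun h s 0 {} has_sum ((\<Prod>p\<in>D. 1 + core_mu h s p) * R)) (generated_by (D \<union> Q))"
    using assms core_fun_local_factor[of "{}" _ h s 0]
    by (intro f.has_sum_union_primes fR) (auto simp: Q_def)
  then have cs: "core_sum h s = (\<Prod>p\<in>D. 1 + core_mu h s p) * R" unfolding core_sum_def all by (rule infsumI)
  have "(core_fun h s \<kappa> D has_sum ((\<Prod>p\<in>D. 1 + real p powr \<kappa> * core_mu h s p) * R)) (generated_by (D \<union> Q))"
  proof (intro g.has_sum_union_primes gR)
    fix p assume "p \<in> D"
    then show "((\<lambda>e. core_fun h s \<kappa> D (p ^ e)) has_sum 1 + real p powr \<kappa> * core_mu h s p) UNIV"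
      using core_fun_local_factor[OF assms(2,1), of p h s \<kappa>] assms(2) by simp
  qed (use assms in \<open>auto simp: Q_def\<close>)
  moreover have "0 \<le> R" unfolding R_def by (intro infsum_nonneg) (auto simp: core_fun_plain)
  moreover have "R \<le> core_sum h s" unfolding R_def core_sum_def
    by (intro infsum_mono2 core_summable sub summable_on_subset[OF core_summable sub]) (auto simp: core_fun_plain)
  ultimately show ?thesis using cs unfolding all by blast
qed

end

text \<open>The density of the multiples of \<open>p\<close> among the \<open>h\<close>-full numbers.\<close>

definition lam :: "nat \<Rightarrow> nat \<Rightarrow> real" where
  "lam h p = 1 / (real p - real p powr (1 - 1 / real h) + 1)"

text \<open>At \<open>s = 1 / h\<close> the local sum is a finite geometric sum in
  \<open>z = p powr - (1 / h)\<close>, and \<open>z ^ h = 1 / p\<close> turns its value into a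
  rational function of \<open>z\<close> and \<open>1 / p\<close>.\<close>

lemma core_mu_closed_form:
  assumes "prime p" "2 \<le> h"
  defines "z \<equiv> real p powr - (1 / real h)"
  shows "z ^ h = 1 / real p" "0 < z" "z < 1"
    and "core_mu h (1 / real h) p = z ^ Suc h * (1 - z ^ (h - 1)) / (1 - z)"
proof -
  have p: "1 < real p" using prime_gt_1_nat[OF assms(1)] by simp
  show z: "0 < z" "z < 1"
    using p assms(2) powr_less_mono2_neg[of "- (1 / real h)" 1 "real p"] by (auto simp: z_def)
  have "z ^ h = z powr real h" using z by (simp add: powr_realpow)
  also have "\<dots> = real p powr (- (1 / real h) * real h)" by (simp only: z_def powr_powr)
  also have "\<dots> = real p powr - 1" using assms(2) by simp
  finally show "z ^ h = 1 / real p" using p by (simp add: powr_minus divide_inverse)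
  have "core_mu h (1 / real h) p = (\<Sum>e=Suc h..<2 * h. z ^ e)"
    unfolding core_mu_def using z(1) by (intro sum.cong refl) (simp add: z_def powr_realpow[symmetric] powr_powr)
  also have "\<dots> = (\<Sum>e<h - 1. z ^ (e + Suc h))"
    by (rule sum.reindex_bij_witness[of _ "\<lambda>e. e + Suc h" "\<lambda>e. e - Suc h"]) auto
  also have "\<dots> = z ^ Suc h * (\<Sum>e<h - 1. z ^ e)" by (simp only: sum_distrib_left power_add mult.commute)
  also have "(\<Sum>e<h - 1. z ^ e) = (1 - z ^ (h - 1)) / (1 - z)" using z by (simp add: sum_gp_strict)
  finally show "core_mu h (1 / real h) p = z ^ Suc h * (1 - z ^ (h - 1)) / (1 - z)" by simp
qed

text \<open>The numerator is the local contribution of the multiples of \<open>p\<close>: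
  \<open>1 / p\<close> if \<open>p\<close> does not divide \<open>b\<close> and so must divide
  \<open>a\<close>, and \<open>core_mu\<close> if \<open>p dvd b\<close>. The denominator is the
  whole local factor. With \<open>w = 1 / p\<close> both contain \<open>(1 - w) / (1 - z)\<close>,
  which cancels.\<close>

lemma lam_eq:
  assumes "prime p" "2 \<le> h"
  shows "(1 / real p + core_mu h (1 / real h) p) / (1 + core_mu h (1 / real h) p) = lam h p"
proof -
  define z where "z = real p powr - (1 / real h)"
  note z = core_mu_closed_form[OF assms, folded z_def]
  have p: "1 < real p" using prime_gt_1_nat[OF assms(1)] by simp
  define w where "w = z ^ h"
  have w: "w = 1 / real p" "0 < w" "w < 1" using z p by (auto simp: w_def)
  have e: "z ^ Suc h * z ^ (h - 1) = w * w"
    unfolding w_def using assms(2) by (cases h) simp_all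
  have mu: "core_mu h (1 / real h) p = (z * w - w * w) / (1 - z)"
    unfolding z(4) right_diff_distrib e by (simp add: w_def)
  have nz: "1 - z \<noteq> 0" using z by simp
  have 1: "w + core_mu h (1 / real h) p = w * (1 - w) / (1 - z)"
    unfolding mu using nz by (simp add: field_simps)
  have 2: "1 + core_mu h (1 / real h) p = (1 - w) * (1 - z + w) / (1 - z)"
    unfolding mu using nz by (simp add: field_simps)
  have "(w + core_mu h (1 / real h) p) / (1 + core_mu h (1 / real h) p) = w / (1 - z + w)"
    unfolding 1 2 using nz w z by simp
  also have "1 - z + w = w * (real p - real p * z + 1)"
  proof -
    have "w * (real p - real p * z + 1) = (w * real p) - (w * real p) * z + w" by (simp add: algebra_simps)
    moreover have "w * real p = 1" using w(1) p by simp
    ultimately show ?thesis by simp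
  qed
  also have "w / \<dots> = 1 / (real p - real p * z + 1)" using w by simp
  also have "real p * z = real p powr (1 - 1 / real h)"
    using p by (simp add: z_def powr_diff powr_minus divide_inverse)
  finally show ?thesis by (simp add: w lam_def)
qed

lemma gamma0_eq_core_sum:
  assumes h: "2 \<le> h"
  shows "gamma0 h = core_sum h (1 / real h)"
proof -
  have s: "1 < 1 / real h * real (Suc h)" using h by (simp add: field_simps)
  define f where "f = (\<lambda>p. if prime p
     then 1 + (real p - real p powr (1 / real h)) / ((real p)\<^sup>2 * (real p powr (1 / real h) - 1)) else 1)"
  have f: "f p = 1 + core_mu h (1 / real h) p" if "prime p" for p
  proof -
    define z where "z = real p powr - (1 / real h)"
    note z = core_mu_closed_form[OF that h, folded z_def]
    have p: "1 < real p" using prime_gt_1_nat[OF that] by simp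
    have pz: "real p powr (1 / real h) = 1 / z" using p by (simp add: z_def powr_minus divide_inverse)
    have e: "z ^ Suc h * z ^ (h - 1) = z ^ h * z ^ h" using h by (cases h) simp_all
    have "core_mu h (1 / real h) p = (z * (1 / real p) - 1 / real p * (1 / real p)) / (1 - z)"
      unfolding z(4) right_diff_distrib e z(1) by (simp add: z(1))
    also have "\<dots> = (real p - 1 / z) / ((real p)\<^sup>2 * (1 / z - 1))"
      using p z(2,3) by (simp add: field_simps power2_eq_square)
    finally show ?thesis using that by (simp add: f_def pz)
  qed
  have f': "f p = 1" if "\<not> prime p" for p using that by (simp add: f_def)
  have "(\<lambda>N. \<Prod>p\<le>N. f p) \<longlonglongrightarrow> core_sum h (1 / real h)"
  proof -
    have "(\<Prod>p\<le>N. f p) = (\<Prod>p | prime p \<and> p \<le> N. 1 + core_mu h (1 / real h) p)" for N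
    proof (rule prod.mono_neutral_cong_right)
      show "\<forall>p\<in>{..N} - {p. prime p \<and> p \<le> N}. f p = 1" using f' by auto
    qed (auto simp: f)
    then show ?thesis using core_euler_product[OF s] by simp
  qed
  \<comment> \<open>A convergent infinite product must have a nonzero limit; here the limit is at
    least 1.\<close>
  then have "raw_has_prod f 0 (core_sum h (1 / real h))"
    using core_sum_ge_1[OF s] by (simp add: raw_has_prod_def)
  then have "f has_prod core_sum h (1 / real h)" by (simp add: has_prod_def)
  then show ?thesis unfolding gamma0_def f_def by (rule has_prod_unique[symmetric])
qed

section \<open>Counting h-full multiples of a finite set of primes\<close>

definition h_full_count :: "nat \<Rightarrow> nat set \<Rightarrow> real \<Rightarrow> nat" where
  "h_full_count h D x = card {n. h_full h n \<and> real n \<le> x \<and> (\<forall>p\<in>D. p dvd n)}"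

lemma dvd_prod_iff:
  assumes "finite (D :: nat set)" "\<And>p. p \<in> D \<Longrightarrow> prime p"
  shows "\<Prod>D dvd n \<longleftrightarrow> (\<forall>p\<in>D. p dvd n)"
  using assms prod_primes_dvd[of D n] by (auto intro: dvd_trans[OF dvd_prodI])

lemma card_multiples_real:
  assumes "0 < d" "0 \<le> y"
  shows "card {a::nat. 0 < a \<and> real a \<le> y \<and> d dvd a} = nat \<lfloor>y / real d\<rfloor>"
proof -
  have "{a::nat. 0 < a \<and> real a \<le> y \<and> d dvd a} = {a \<in> {1..nat \<lfloor>y\<rfloor>}. d dvd a}"
    using assms by (auto simp: le_nat_iff le_floor_iff)
  then have "card {a::nat. 0 < a \<and> real a \<le> y \<and> d dvd a} = nat \<lfloor>y\<rfloor> div d"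
    using card_multiples[OF assms(1)] by simp
  also have "\<dots> = nat (\<lfloor>y\<rfloor> div int d)" using assms by (simp add: nat_div_distrib)
  also have "\<lfloor>y\<rfloor> div int d = \<lfloor>y / real d\<rfloor>" using floor_divide_real_eq_div[of "int d" y] by simp
  finally show ?thesis .
qed

locale h_full_counting =
  fixes h :: nat and x :: real and D :: "nat set"
  assumes h: "2 \<le> h" and x: "1 \<le> x" and finD: "finite D" and primeD: "\<And>p. p \<in> D \<Longrightarrow> prime p"
begin

definition Y where "Y = x powr (1 / real h)"

lemma Y_ge_1: "1 \<le> Y" unfolding Y_def using x by (simp add: ge_one_powr_ge_zero)

text \<open>This is \<open>gcd (\<Prod>D, b) / \<Prod>D\<close>.\<close>

definition rho where "rho b = (\<Prod>p\<in>D. if p dvd b then 1 else 1 / real p)"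

text \<open>The number of admissible \<open>a\<close> for a given \<open>b\<close> will be the
  integer part of \<open>t b\<close>: \<open>a\<close> runs up to
  \<open>(x / b) powr (1 / h)\<close> through the multiples of the product of those primes in
  \<open>D\<close> that do not divide \<open>b\<close>.\<close>

definition t where "t b = Y * real b powr - (1 / real h) * rho b"

lemma rho_bounds: "0 < rho b" "rho b \<le> 1"
proof -
  show "0 < rho b" unfolding rho_def using primeD by (intro prod_pos) (auto simp: prime_gt_0_nat)
  have "1 / real p \<le> 1" if "p \<in> D" for p using prime_ge_1_nat[OF primeD[OF that]] by simp
  then show "rho b \<le> 1" unfolding rho_def by (intro prod_le_1) auto
qed

lemma t_pos: "0 < b \<Longrightarrow> 0 < t b"
  unfolding t_def using Y_ge_1 rho_bounds by (intro mult_pos_pos) auto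

lemma fibre_card:
  assumes b: "0 < b"
  shows "card {a. 0 < a \<and> real (a ^ h * b) \<le> x \<and> (\<forall>p\<in>D. p dvd a ^ h * b)} = nat \<lfloor>t b\<rfloor>"
proof -
  define D' where "D' = {p \<in> D. \<not> p dvd b}"
  have D': "finite D'" "\<And>p. p \<in> D' \<Longrightarrow> prime p" using finD primeD by (auto simp: D'_def)
  define y where "y = (x / real b) powr (1 / real h)"
  have y: "y = Y * real b powr - (1 / real h)"
    unfolding y_def Y_def using x b by (subst powr_divide) (auto simp: powr_minus divide_inverse)
  have le: "real (a ^ h * b) \<le> x \<longleftrightarrow> real a \<le> y" if "0 < a" for a
  proof -
    have "real (a ^ h * b) \<le> x \<longleftrightarrow> real a ^ h \<le> x / real b" using b by (simp add: field_simps)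
    also have "\<dots> \<longleftrightarrow> (real a ^ h) powr (1 / real h) \<le> y"
    proof -
      have "u \<le> v \<longleftrightarrow> u powr (1 / real h) \<le> v powr (1 / real h)" if "0 \<le> u" "0 \<le> v" for u v :: real
      proof (cases "u \<le> v")
        case True
        then show ?thesis using powr_mono2[of "1 / real h" u v] that by simp
      next
        case False
        then show ?thesis using powr_less_mono2[of "1 / real h" v u] that h by simp
      qed
      from this[of "real a ^ h" "x / real b"] show ?thesis unfolding y_def using x b by (simp only: zero_le_power of_nat_0_le_iff) auto
    qed
    also have "(real a ^ h) powr (1 / real h) = real a"
      using that h by (simp add: powr_realpow[symmetric] powr_powr)
    finally show ?thesis .
  qed
  have dv: "(\<forall>p\<in>D. p dvd a ^ h * b) \<longleftrightarrow> \<Prod>D' dvd a" for a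
  proof -
    have "p dvd a ^ h * b \<longleftrightarrow> p dvd a \<or> p dvd b" if "p \<in> D" for p
      using primeD[OF that] h by (auto simp: prime_dvd_mult_iff prime_dvd_power_iff)
    then have "(\<forall>p\<in>D. p dvd a ^ h * b) \<longleftrightarrow> (\<forall>p\<in>D'. p dvd a)" by (auto simp: D'_def)
    then show ?thesis using dvd_prod_iff[OF D'] by simp
  qed
  have rho: "rho b = 1 / real (\<Prod>D')"
  proof -
    have "rho b = (\<Prod>p\<in>D'. 1 / real p)"
      unfolding rho_def D'_def using finD by (intro prod.mono_neutral_cong_right) auto
    then show ?thesis by (simp add: prod_dividef)
  qed
  have "{a. 0 < a \<and> real (a ^ h * b) \<le> x \<and> (\<forall>p\<in>D. p dvd a ^ h * b)} = {a. 0 < a \<and> real a \<le> y \<and> \<Prod>D' dvd a}"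
    using le dv by auto
  also have "card \<dots> = nat \<lfloor>y / real (\<Prod>D')\<rfloor>"
    using D' by (intro card_multiples_real) (auto simp: y_def prime_gt_0_nat intro!: prod_pos)
  also have "y / real (\<Prod>D') = t b" unfolding t_def rho y by simp
  finally show ?thesis .
qed

text \<open>For \<open>b > x\<close> the integer part of \<open>t b\<close> is 0, so the finite
  count extends to a sum over all cores and can be compared termwise with an infinite
  series.\<close>

lemma t_lt_1:
  assumes "0 < b" "x < real b"
  shows "t b < 1"
proof -
  have "Y < real b powr (1 / real h)" unfolding Y_def using assms x h by (intro powr_less_mono2) auto
  then have "Y * real b powr - (1 / real h) < 1" using assms by (simp add: powr_minus field_simps)
  moreover have "t b \<le> Y * real b powr - (1 / real h) * 1"
    unfolding t_def using rho_bounds Y_ge_1 by (intro mult_left_mono) auto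
  ultimately show ?thesis by simp
qed

lemma count_eq_sum:
  "h_full_count h D x = (\<Sum>b | h_core h b \<and> real b \<le> x. nat \<lfloor>t b\<rfloor>)"
proof -
  define B where "B = {b. h_core h b \<and> real b \<le> x}"
  define G where "G = (\<lambda>b. {a. 0 < a \<and> real (a ^ h * b) \<le> x \<and> (\<forall>p\<in>D. p dvd a ^ h * b)})"
  have Bpos: "0 < b" if "b \<in> B" for b using that by (simp add: B_def h_core_def)
  have finB: "finite B" unfolding B_def by (rule finite_subset[OF _ finite_real_nat_le[of x]]) auto
  have finG: "finite (G b)" if "b \<in> B" for b
  proof (rule finite_subset[OF _ finite_real_nat_le[of x]], rule subsetI)
    fix a assume a: "a \<in> G b"
    have "a * 1 \<le> a ^ h * b"
      using a Bpos[OF that] h self_le_power[of a h] by (intro mult_mono) (auto simp: G_def)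
    then show "a \<in> {a. real a \<le> x}" using a by (auto simp: G_def intro: order.trans[OF of_nat_mono])
  qed
  have bij: "bij_betw (\<lambda>(a, b). a ^ h * b) ({0<..} \<times> {b. h_core h b}) {n. h_full h n}"
    by (rule bij_betw_h_full[OF h])
  have "bij_betw (\<lambda>(b, a). a ^ h * b) (SIGMA b:B. G b) {n. h_full h n \<and> real n \<le> x \<and> (\<forall>p\<in>D. p dvd n)}"
  proof (rule bij_betw_imageI)
    show "inj_on (\<lambda>(b, a). a ^ h * b) (SIGMA b:B. G b)"
      using bij_betw_imp_inj_on[OF bij] by (auto simp: inj_on_def B_def G_def)
    show "(\<lambda>(b, a). a ^ h * b) ` (SIGMA b:B. G b) = {n. h_full h n \<and> real n \<le> x \<and> (\<forall>p\<in>D. p dvd n)}"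
    proof (intro equalityI subsetI)
      fix n assume "n \<in> (\<lambda>(b, a). a ^ h * b) ` (SIGMA b:B. G b)"
      then obtain a b where ab: "n = a ^ h * b" "b \<in> B" "a \<in> G b" by auto
      then have "(\<lambda>(a, b). a ^ h * b) (a, b) \<in> (\<lambda>(a, b). a ^ h * b) ` ({0<..} \<times> {b. h_core h b})"
        by (intro imageI) (auto simp: B_def G_def)
      then have "h_full h n" using bij_betw_imp_surj_on[OF bij] ab by auto
      then show "n \<in> {n. h_full h n \<and> real n \<le> x \<and> (\<forall>p\<in>D. p dvd n)}" using ab by (auto simp: G_def)
    next
      fix n assume n: "n \<in> {n. h_full h n \<and> real n \<le> x \<and> (\<forall>p\<in>D. p dvd n)}"
      then have "n \<in> (\<lambda>(a, b). a ^ h * b) ` ({0<..} \<times> {b. h_core h b})"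
        using bij_betw_imp_surj_on[OF bij] by auto
      then obtain a b where ab: "n = a ^ h * b" "0 < a" "h_core h b" by auto
      have "1 * b \<le> a ^ h * b" using ab by (intro mult_mono) auto
      then have "real b \<le> real n" unfolding ab(1) by (simp only: of_nat_le_iff mult_1)
      then have "real b \<le> x" using n by simp
      then have "(b, a) \<in> (SIGMA b:B. G b)" using ab n by (auto simp: B_def G_def)
      then show "n \<in> (\<lambda>(b, a). a ^ h * b) ` (SIGMA b:B. G b)" using ab by force
    qed
  qed
  then have "h_full_count h D x = card (SIGMA b:B. G b)"
    unfolding h_full_count_def by (rule bij_betw_same_card[symmetric])
  also have "\<dots> = (\<Sum>b\<in>B. card (G b))" using finB finG by (intro card_SigmaI) auto
  also have "\<dots> = (\<Sum>b\<in>B. nat \<lfloor>t b\<rfloor>)"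
    unfolding G_def using fibre_card Bpos by (intro sum.cong) auto
  finally show ?thesis by (simp add: B_def)
qed

text \<open>The dependence of \<open>rho b\<close> on \<open>b\<close> is the product of the primes
  of \<open>D\<close> dividing \<open>b\<close>, so a power of \<open>t b\<close> is a
  \<open>core_fun\<close> with \<open>s = \<theta> / h\<close> and
  \<open>\<kappa> = \<theta>\<close>. One evaluation then serves the main term (exponent 1) and the
  error (exponent below 1).\<close>

lemma core_fun_eq:
  assumes "0 < b"
  shows "(if h_core h b then t b powr \<theta> else 0)
    = Y powr \<theta> * (\<Prod>p\<in>D. real p powr - \<theta>) * core_fun h (\<theta> / real h) \<theta> D b"
proof -
  have r: "rho b powr \<theta> = (\<Prod>p\<in>D. real p powr - \<theta>) * (\<Prod>p\<in>D. if p dvd b then real p powr \<theta> else 1)"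
  proof -
    have "rho b powr \<theta> = (\<Prod>p\<in>D. (if p dvd b then 1 else 1 / real p) powr \<theta>)"
      unfolding rho_def by (rule prod_powr_distrib)
    also have "\<dots> = (\<Prod>p\<in>D. real p powr - \<theta> * (if p dvd b then real p powr \<theta> else 1))"
    proof (rule prod.cong[OF refl])
      fix p assume "p \<in> D"
      then have "0 < real p" using prime_gt_0_nat[OF primeD] by simp
      then show "(if p dvd b then 1 else 1 / real p) powr \<theta> = real p powr - \<theta> * (if p dvd b then real p powr \<theta> else 1)"
        by (simp add: powr_minus powr_divide field_simps)
    qed
    finally show ?thesis by (simp add: prod.distrib)
  qed
  have "t b powr \<theta> = Y powr \<theta> * real b powr - (\<theta> / real h) * rho b powr \<theta>"
    unfolding t_def using Y_ge_1 rho_bounds[of b] assms by (simp add: powr_mult powr_powr)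
  then show ?thesis by (simp add: core_fun_def r mult_ac)
qed

lemma t_powr_has_sum:
  assumes "1 < \<theta> / real h * real (Suc h)"
  shows "\<exists>R. 0 \<le> R \<and> R \<le> core_sum h (\<theta> / real h) \<and> core_sum h (\<theta> / real h) = (\<Prod>p\<in>D. 1 + core_mu h (\<theta> / real h) p) * R \<and>
   ((\<lambda>b. if h_core h b then t b powr \<theta> else 0) has_sum
      (Y powr \<theta> * (\<Prod>p\<in>D. real p powr - \<theta> * (1 + real p powr \<theta> * core_mu h (\<theta> / real h) p)) * R)) {0<..}"
proof -
  obtain R where R: "0 \<le> R" "R \<le> core_sum h (\<theta> / real h)" "core_sum h (\<theta> / real h) = (\<Prod>p\<in>D. 1 + core_mu h (\<theta> / real h) p) * R"
    "(core_fun h (\<theta> / real h) \<theta> D has_sum ((\<Prod>p\<in>D. 1 + real p powr \<theta> * core_mu h (\<theta> / real h) p) * R)) {0<..}"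
    using core_fun_has_sum[OF assms finD primeD] by blast
  have "((\<lambda>b. Y powr \<theta> * (\<Prod>p\<in>D. real p powr - \<theta>) * core_fun h (\<theta> / real h) \<theta> D b) has_sum
     (Y powr \<theta> * (\<Prod>p\<in>D. real p powr - \<theta>) * ((\<Prod>p\<in>D. 1 + real p powr \<theta> * core_mu h (\<theta> / real h) p) * R))) {0<..}"
    by (rule has_sum_cmult_right[OF R(4)])
  also have "?this \<longleftrightarrow> ((\<lambda>b. if h_core h b then t b powr \<theta> else 0) has_sum
     (Y powr \<theta> * (\<Prod>p\<in>D. real p powr - \<theta>) * ((\<Prod>p\<in>D. 1 + real p powr \<theta> * core_mu h (\<theta> / real h) p) * R))) {0<..}"
    by (rule has_sum_cong) (simp only: core_fun_eq greaterThan_iff)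
  finally have "((\<lambda>b. if h_core h b then t b powr \<theta> else 0) has_sum
      (Y powr \<theta> * (\<Prod>p\<in>D. real p powr - \<theta> * (1 + real p powr \<theta> * core_mu h (\<theta> / real h) p)) * R)) {0<..}"
    by (simp add: prod.distrib mult_ac)
  then show ?thesis using R by blast
qed

lemma main_has_sum:
  "((\<lambda>b. if h_core h b then t b else 0) has_sum (gamma0 h * Y * (\<Prod>p\<in>D. lam h p))) {0<..}"
proof -
  have s: "1 < 1 / real h * real (Suc h)" using h by (simp add: field_simps)
  obtain R where R: "core_sum h (1 / real h) = (\<Prod>p\<in>D. 1 + core_mu h (1 / real h) p) * R"
    "((\<lambda>b. if h_core h b then t b powr 1 else 0) has_sum
      (Y powr 1 * (\<Prod>p\<in>D. real p powr - 1 * (1 + real p powr 1 * core_mu h (1 / real h) p)) * R)) {0<..}"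
    using t_powr_has_sum[OF s] by blast
  \<comment> \<open>Requiring \<open>p\<close> to divide replaces the local factor
    \<open>1 + core_mu\<close> by \<open>1 / p + core_mu\<close>, which is \<open>lam h p\<close>
    times the old one; so the complete Euler product reappears.\<close>
  have "(\<Prod>p\<in>D. real p powr - 1 * (1 + real p powr 1 * core_mu h (1 / real h) p)) * R = (\<Prod>p\<in>D. lam h p) * core_sum h (1 / real h)"
  proof -
    have "real p powr - 1 * (1 + real p powr 1 * core_mu h (1 / real h) p) = lam h p * (1 + core_mu h (1 / real h) p)" if "p \<in> D" for p
    proof -
      have "0 < real p" using prime_gt_0_nat[OF primeD[OF that]] by simp
      then have "real p powr - 1 * (1 + real p powr 1 * core_mu h (1 / real h) p) = 1 / real p + core_mu h (1 / real h) p"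
        by (simp add: powr_minus field_simps)
      moreover have "0 < 1 + core_mu h (1 / real h) p" using core_mu_nonneg[of h "1 / real h" p] by simp
      ultimately show ?thesis using lam_eq[OF primeD[OF that] h] by (simp add: field_simps)
    qed
    then have "(\<Prod>p\<in>D. real p powr - 1 * (1 + real p powr 1 * core_mu h (1 / real h) p)) = (\<Prod>p\<in>D. lam h p) * (\<Prod>p\<in>D. 1 + core_mu h (1 / real h) p)"
      unfolding prod.distrib[symmetric] by (rule prod.cong[OF refl])
    then show ?thesis by (simp add: R(1))
  qed
  then have "Y powr 1 * (\<Prod>p\<in>D. real p powr - 1 * (1 + real p powr 1 * core_mu h (1 / real h) p)) * R = gamma0 h * Y * (\<Prod>p\<in>D. lam h p)"
    using Y_ge_1 by (simp add: gamma0_eq_core_sum[OF h] mult_ac)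
  moreover have "(\<lambda>b. if h_core h b then t b powr 1 else 0) = (\<lambda>b. if h_core h b then t b else 0)"
    using t_pos by (auto simp: fun_eq_iff h_core_def less_imp_le)
  ultimately show ?thesis using R(2) by simp
qed

lemma count_has_sum:
  "((\<lambda>b. if h_core h b then real (nat \<lfloor>t b\<rfloor>) else 0) has_sum real (h_full_count h D x)) {0<..}"
proof (rule has_sum_finite_neutralI)
  show "finite {b. h_core h b \<and> real b \<le> x}" by (rule finite_subset[OF _ finite_real_nat_le[of x]]) auto
  show "{b. h_core h b \<and> real b \<le> x} \<subseteq> {0<..}" by (auto simp: h_core_def)
  show "(if h_core h b then real (nat \<lfloor>t b\<rfloor>) else 0) = 0" if "b \<in> {0<..} - {b. h_core h b \<and> real b \<le> x}" for b
    using that t_lt_1[of b] t_pos[of b] by (auto simp: floor_eq_iff)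
  show "real (h_full_count h D x) = (\<Sum>b | h_core h b \<and> real b \<le> x. if h_core h b then real (nat \<lfloor>t b\<rfloor>) else 0)"
    unfolding count_eq_sum of_nat_sum by (rule sum.cong) auto
qed

lemma count_le: "real (h_full_count h D x) \<le> gamma0 h * Y * (\<Prod>p\<in>D. lam h p)"
  by (rule has_sum_mono[OF count_has_sum main_has_sum]) (use t_pos in \<open>auto simp: less_imp_le\<close>)

text \<open>The fractional part of \<open>t\<close> is at most 1 and at most \<open>t\<close>, hence
  at most \<open>t powr \<theta>\<close>. The local factor is at most
  \<open>(1 + h) * p powr - \<theta>\<close>, because \<open>core_mu\<close> at
  \<open>\<theta> / h\<close> is at most \<open>h * p powr - \<theta>\<close>.\<close>

lemma count_ge:
  assumes "0 < \<theta>" "\<theta> < 1" "1 < \<theta> / real h * real (Suc h)"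
  shows "gamma0 h * Y * (\<Prod>p\<in>D. lam h p) - real (h_full_count h D x)
    \<le> core_sum h (\<theta> / real h) * Y powr \<theta> * (\<Prod>p\<in>D. (1 + real h) * real p powr - \<theta>)"
proof -
  obtain R where R: "0 \<le> R" "R \<le> core_sum h (\<theta> / real h)" "((\<lambda>b. if h_core h b then t b powr \<theta> else 0) has_sum
      (Y powr \<theta> * (\<Prod>p\<in>D. real p powr - \<theta> * (1 + real p powr \<theta> * core_mu h (\<theta> / real h) p)) * R)) {0<..}"
    using t_powr_has_sum[OF assms(3)] by blast
  have pr: "(\<Prod>p\<in>D. real p powr - \<theta> * (1 + real p powr \<theta> * core_mu h (\<theta> / real h) p)) \<le> (\<Prod>p\<in>D. (1 + real h) * real p powr - \<theta>)"
  proof (rule prod_mono, rule conjI)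
    fix p assume "p \<in> D"
    then have p: "prime p" "1 \<le> real p" using prime_ge_1_nat[OF primeD] primeD by auto
    have "core_mu h (\<theta> / real h) p \<le> real h * real p powr - (\<theta> / real h * real (Suc h))"
      using p assms h by (intro core_mu_le) auto
    also have "\<dots> \<le> real h * real p powr - \<theta>"
    proof (intro mult_left_mono powr_mono)
      have "\<theta> = \<theta> / real h * real h" using h by simp
      also have "\<dots> \<le> \<theta> / real h * real (Suc h)" using assms by (intro mult_left_mono) auto
      finally show "- (\<theta> / real h * real (Suc h)) \<le> - \<theta>" by simp
    qed (use p in auto)
    finally have "real p powr \<theta> * core_mu h (\<theta> / real h) p \<le> real p powr \<theta> * (real h * real p powr - \<theta>)"
      by (intro mult_left_mono) auto
    also have "\<dots> = real h" using p by (simp add: powr_minus)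
    finally have "real p powr - \<theta> * (1 + real p powr \<theta> * core_mu h (\<theta> / real h) p) \<le> real p powr - \<theta> * (1 + real h)"
      by (intro mult_left_mono) auto
    then show "real p powr - \<theta> * (1 + real p powr \<theta> * core_mu h (\<theta> / real h) p) \<le> (1 + real h) * real p powr - \<theta>"
      by (simp only: mult.commute)
    show "0 \<le> real p powr - \<theta> * (1 + real p powr \<theta> * core_mu h (\<theta> / real h) p)"
      using core_mu_nonneg by (intro mult_nonneg_nonneg add_nonneg_nonneg) auto
  qed
  have "((\<lambda>b. (if h_core h b then t b else 0) + - (if h_core h b then real (nat \<lfloor>t b\<rfloor>) else 0)) has_sum
     (gamma0 h * Y * (\<Prod>p\<in>D. lam h p) + - real (h_full_count h D x))) {0<..}"
    by (intro has_sum_add main_has_sum has_sum_uminus[THEN iffD2]) (use count_has_sum in simp)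
  then have "gamma0 h * Y * (\<Prod>p\<in>D. lam h p) + - real (h_full_count h D x)
     \<le> Y powr \<theta> * (\<Prod>p\<in>D. real p powr - \<theta> * (1 + real p powr \<theta> * core_mu h (\<theta> / real h) p)) * R"
  proof (rule has_sum_mono[OF _ R(3)])
    fix b :: nat assume "b \<in> {0<..}"
    then have "0 < t b" using t_pos by simp
    have "t b - real (nat \<lfloor>t b\<rfloor>) \<le> t b powr \<theta>"
    proof (cases "1 \<le> t b")
      case True
      have "t b - real (nat \<lfloor>t b\<rfloor>) \<le> 1" using True by linarith
      also have "\<dots> \<le> t b powr \<theta>" using True assms by (simp add: ge_one_powr_ge_zero)
      finally show ?thesis .
    next
      case False
      have "t b - real (nat \<lfloor>t b\<rfloor>) \<le> t b powr 1" using \<open>0 < t b\<close> by simp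
      also have "\<dots> \<le> t b powr \<theta>" using \<open>0 < t b\<close> False assms by (intro powr_mono') auto
      finally show ?thesis .
    qed
    then show "(if h_core h b then t b else 0) + - (if h_core h b then real (nat \<lfloor>t b\<rfloor>) else 0) \<le> (if h_core h b then t b powr \<theta> else 0)"
      by simp
  qed
  also have "\<dots> \<le> Y powr \<theta> * (\<Prod>p\<in>D. (1 + real h) * real p powr - \<theta>) * core_sum h (\<theta> / real h)"
    using pr R core_mu_nonneg by (intro mult_mono mult_nonneg_nonneg prod_nonneg) (auto intro!: add_nonneg_nonneg)
  finally show ?thesis by (simp add: mult_ac)
qed

text \<open>An h-full multiple of the primes in \<open>D\<close> is divisible by the
  \<open>h\<close>-th power of their product, so this product cannot exceed \<open>Y\<close>. It
  confines pairs of primes to the hyperbolic region.\<close>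

lemma count_eq_0:
  assumes "Y < real (\<Prod>D)"
  shows "h_full_count h D x = 0"
proof -
  have False if n: "h_full h n" "real n \<le> x" "\<forall>p\<in>D. p dvd n" for n
  proof -
    have "(\<Prod>p\<in>D. p ^ h) dvd n"
    proof -
      have "(\<Prod>p\<in>E. p ^ h) dvd n" if "E \<subseteq> D" for E
        using finite_subset[OF that finD] that
      proof (induction E rule: finite_induct)
        case (insert p E)
        have p: "prime p" "p dvd n" using insert n primeD by auto
        have "p ^ h dvd n"
          using n(1) p by (intro multiplicity_dvd') (auto simp: h_full_def prime_factors_dvd)
        moreover have "coprime (p ^ h) (\<Prod>p\<in>E. p ^ h)"
          using insert p primeD by (intro prod_coprime_right) (auto intro!: primes_coprime)
        ultimately show ?case using insert by (auto intro: divides_mult)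
      qed simp
      then show ?thesis by simp
    qed
    then have "(\<Prod>p\<in>D. p ^ h) \<le> n" using n(1) by (intro dvd_imp_le) (auto simp: h_full_def)
    then have "(\<Prod>D) ^ h \<le> n" by (simp add: prod_power_distrib)
    then have "real (\<Prod>D) ^ h \<le> x" using n(2) by (metis of_nat_le_iff of_nat_power order_trans)
    moreover define d where "d = real (\<Prod>D)"
    moreover have "0 < \<Prod>D" using primeD by (intro prod_pos) (auto simp: prime_gt_0_nat)
    ultimately have d: "0 < d" "d ^ h \<le> x" by (simp_all only: of_nat_0_less_iff)
    then have "(d ^ h) powr (1 / real h) \<le> Y" unfolding Y_def using h by (intro powr_mono2) auto
    moreover have "(d ^ h) powr (1 / real h) = d"
      using d h by (simp add: powr_realpow[symmetric] powr_powr)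
    ultimately show False using assms by (simp add: d_def)
  qed
  then show ?thesis unfolding h_full_count_def by (auto simp: card_eq_0_iff)
qed

end

section \<open>Divisibility counts and the moments of omega\<close>

definition lam_weight :: "nat \<Rightarrow> nat \<Rightarrow> real" where
  "lam_weight h n = (if prime n then lam h n else 0)"

lemma lam_denominator_pos:
  assumes "prime p"
  shows "0 < real p - real p powr (1 - 1 / real h) + 1"
proof -
  have "1 \<le> real p" using prime_ge_1_nat[OF assms] by simp
  then have "real p powr (1 - 1 / real h) \<le> real p powr 1" by (intro powr_mono) auto
  then show ?thesis using \<open>1 \<le> real p\<close> by simp
qed

lemma lam_pos: "prime p \<Longrightarrow> 0 < lam h p"
  unfolding lam_def using lam_denominator_pos[of p h] by simp

text \<open>The right-hand side splits into \<open>\<lambda>_p * p powr - (1 / h)\<close> and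
  \<open>\<lambda>_p / p\<close>, the summands of \<open>L_series h (h + 1)\<close> and
  \<open>L_series h (2 * h)\<close>.\<close>

lemma lam_minus_inverse:
  assumes "prime p"
  shows "lam h p - 1 / real p = lam h p * (real p powr - (1 / real h) - 1 / real p)"
proof -
  define w where "w = real p powr - (1 / real h)"
  have p: "0 < real p" using prime_gt_0_nat[OF assms] by simp
  have e: "real p powr (1 - 1 / real h) = real p * w"
    using p by (simp add: w_def powr_diff powr_minus divide_inverse)
  have "0 < real p - real p * w + 1" using lam_denominator_pos[OF assms, of h] by (simp add: e)
  then show ?thesis unfolding w_def[symmetric] lam_def e using p by (simp add: field_simps)
qed

section \<open>The weights lambda and the constants D1 and D2\<close>

locale h_full_setting =
  fixes h :: nat
  assumes h: "2 \<le> h"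
begin

text \<open>\<open>p * \<lambda>_p\<close> is at most \<open>1 / (1 - p powr - (1 / h))\<close>, and
  this is largest at \<open>p = 2\<close>.\<close>

definition lam_const :: real where "lam_const = 1 / (1 - 2 powr - (1 / real h))"

lemma lam_le:
  assumes "prime p"
  shows "lam h p \<le> lam_const / real p"
proof -
  have p: "2 \<le> real p" using prime_ge_2_nat[OF assms] by simp
  have lt: "2 powr - (1 / real h) < (1::real)"
    using h powr_less_mono2_neg[of "- (1 / real h)" 1 "2::real"] by auto
  have "real p powr - (1 / real h) \<le> 2 powr - (1 / real h)" using p h by (intro powr_mono2') auto
  then have "real p * (1 - 2 powr - (1 / real h)) \<le> real p * (1 - real p powr - (1 / real h))"
    using p by (intro mult_left_mono) auto
  also have "\<dots> = real p - real p powr (1 - 1 / real h)"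
    using p by (simp add: powr_diff powr_minus divide_inverse right_diff_distrib)
  finally have "1 / (real p - real p powr (1 - 1 / real h) + 1) \<le> 1 / (real p * (1 - 2 powr - (1 / real h)))"
    using p lt by (intro divide_left_mono mult_pos_pos lam_denominator_pos assms) auto
  then show ?thesis by (simp add: lam_def lam_const_def mult.commute)
qed

lemma lam_inverse_bounds:
  assumes "prime p"
  shows "0 \<le> lam h p - 1 / real p"
    and "lam h p * real p powr - (1 / real h) \<le> lam_const * real p powr (- 1 - 1 / real h)"
    and "lam h p - 1 / real p \<le> lam_const * real p powr (- 1 - 1 / real h)"
proof -
  have p: "1 < real p" using prime_gt_1_nat[OF assms] by simp
  have "1 / real p = real p powr - 1" using p by (simp add: powr_minus divide_inverse)
  also have "\<dots> \<le> real p powr - (1 / real h)" using p h by (intro powr_mono) auto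
  finally show "0 \<le> lam h p - 1 / real p"
    unfolding lam_minus_inverse[OF assms] using lam_pos[OF assms, of h] by (intro mult_nonneg_nonneg) auto
  have "lam h p * real p powr - (1 / real h) \<le> lam_const / real p * real p powr - (1 / real h)"
    using lam_le[OF assms] by (intro mult_right_mono) auto
  also have "\<dots> = lam_const * (real p powr - 1 * real p powr - (1 / real h))" using p by (simp add: powr_minus divide_inverse)
  also have "real p powr - 1 * real p powr - (1 / real h) = real p powr (- 1 - 1 / real h)"
    by (simp only: powr_add[symmetric]) simp
  finally show 2: "lam h p * real p powr - (1 / real h) \<le> lam_const * real p powr (- 1 - 1 / real h)" .
  have "lam h p - 1 / real p \<le> lam h p * real p powr - (1 / real h)"
    unfolding lam_minus_inverse[OF assms] using lam_pos[OF assms, of h] by (intro mult_left_mono) auto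
  with 2 show "lam h p - 1 / real p \<le> lam_const * real p powr (- 1 - 1 / real h)" by linarith
qed

lemma mertens_weight_lam: "\<exists>C. mertens_weight (lam_weight h) C"
proof (rule mertens_weight_perturb[where \<epsilon> = "1 / real h" and D = lam_const])
  fix p assume p: "prime (p::nat)"
  show "\<bar>lam_weight h p - 1 / real p\<bar> \<le> lam_const * real p powr (- 1 - 1 / real h)"
    using lam_inverse_bounds[OF p] p by (simp add: lam_weight_def)
qed (use h in \<open>auto simp: lam_weight_def less_imp_le[OF lam_pos]\<close>)

definition lam_C :: real where "lam_C = (SOME C. mertens_weight (lam_weight h) C)"

lemma mertens_weight_lam': "mertens_weight (lam_weight h) lam_C"
  unfolding lam_C_def by (rule someI_ex[OF mertens_weight_lam])

lemma summable_on_primes: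
  fixes f :: "nat \<Rightarrow> real"
  assumes "\<And>p. prime p \<Longrightarrow> 0 \<le> f p" "\<And>p. prime p \<Longrightarrow> f p \<le> D * real p powr - r" "1 < r"
  shows "f summable_on {p. prime p}" "summable (\<lambda>n. if prime n then f n else 0)"
proof -
  have s: "summable (\<lambda>n. D * real n powr - r)" using assms(3) by (intro summable_mult) (simp add: summable_real_powr_iff)
  have "0 \<le> D * 2 powr - r" using assms(1,2)[of 2] by (auto intro: order.trans)
  then have D: "0 \<le> D" by (simp add: zero_le_mult_iff)
  show s2: "summable (\<lambda>n. if prime n then f n else 0)"
    by (rule summable_comparison_test[OF _ s]) (use assms D in \<open>auto intro!: exI[of _ 0]\<close>)
  have "(\<lambda>n. if prime n then f n else 0) summable_on UNIV"
    by (rule summable_nonneg_imp_summable_on) (use s2 assms(1) in auto)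
  then show "f summable_on {p. prime p}"
    by (rule summable_on_cong_neutral[THEN iffD1, rotated -1]) auto
qed

lemma suminf_primes_eq_infsum:
  fixes f :: "nat \<Rightarrow> real"
  assumes "f summable_on {p. prime p}"
  shows "(\<lambda>n. if prime n then f n else 0) sums infsum f {p. prime p}"
proof -
  have "(f has_sum infsum f {p. prime p}) {p. prime p}" using assms by simp
  then have "((\<lambda>n. if prime n then f n else 0) has_sum infsum f {p. prime p}) UNIV"
    by (rule has_sum_cong_neutral[THEN iffD1, rotated -1]) auto
  then show ?thesis by (rule has_sum_imp_sums)
qed

text \<open>The constant of \<open>\<lambda>_p\<close> exceeds \<open>mertens_B1\<close> by the sum
  of \<open>\<lambda>_p - 1 / p\<close>, which is the difference of the two values of
  \<open>L_series\<close>. The subtracted \<open>ln h\<close> prepares the passage from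
  \<open>ln (ln (Y x))\<close> to \<open>ln (ln x)\<close>.\<close>

lemma D1_eq: "D1 h = mertens_weight.M (lam_weight h) - ln (real h)"
proof -
  interpret L: mertens_weight "lam_weight h" lam_C by (rule mertens_weight_lam')
  obtain C where C: "mertens_weight prime_weight C" using mertens_weight_prime_weight by blast
  interpret W: mertens_weight prime_weight C by fact
  define f1 f2 where "f1 = (\<lambda>p. lam h p * real p powr - (1 / real h))" and "f2 = (\<lambda>p. lam h p * (1 / real p))"
  have r: "1 < 1 + 1 / real h" using h by simp
  have s1: "f1 summable_on {p. prime p}"
    by (rule summable_on_primes(1)[OF _ _ r, of _ lam_const])
       (use lam_inverse_bounds(2) in \<open>auto simp: f1_def less_imp_le[OF lam_pos]\<close>)
  have s2: "f2 summable_on {p. prime p}"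
  proof (rule summable_on_comparison_test[OF s1])
    fix p :: nat assume "p \<in> {p. prime p}"
    then have p: "prime p" by simp
    then have "1 / real p \<le> real p powr - (1 / real h)"
      using lam_inverse_bounds(1)[OF p] lam_pos[OF p, of h] unfolding lam_minus_inverse[OF p]
      by (simp add: zero_le_mult_iff)
    then show "f2 p \<le> f1 p" unfolding f1_def f2_def using lam_pos[OF p, of h] by (intro mult_left_mono) auto
  qed (auto simp: f2_def less_imp_le[OF lam_pos])
  have L1: "L_series h (real h + 1) = infsum f1 {p. prime p}"
  proof (unfold L_series_def, rule infsum_cong)
    fix p :: nat assume "p \<in> {p. prime p}"
    have "(real h + 1) / real h - 1 = 1 / real h" using h by (simp add: field_simps)
    then show "1 / (real p powr ((real h + 1) / real h - 1) * (real p - real p powr (1 - 1 / real h) + 1)) = f1 p"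
      unfolding f1_def lam_def by (simp only:) (simp add: powr_minus divide_inverse)
  qed
  have L2: "L_series h (2 * real h) = infsum f2 {p. prime p}"
  proof (unfold L_series_def, rule infsum_cong)
    fix p :: nat assume "p \<in> {p. prime p}"
    then have "0 < real p" by (simp add: prime_gt_0_nat)
    moreover have "2 * real h / real h - 1 = 1" using h by simp
    ultimately show "1 / (real p powr (2 * real h / real h - 1) * (real p - real p powr (1 - 1 / real h) + 1)) = f2 p"
      unfolding f2_def lam_def by (simp only:) simp
  qed
  have "(\<lambda>n. (if prime n then f1 n else 0) - (if prime n then f2 n else 0)) sums (infsum f1 {p. prime p} - infsum f2 {p. prime p})"
    by (intro sums_diff suminf_primes_eq_infsum s1 s2)
  moreover have "(\<lambda>n. (if prime n then f1 n else 0) - (if prime n then f2 n else 0)) = (\<lambda>n. lam_weight h n - prime_weight n)"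
  proof
    fix n
    have "f1 n - f2 n = lam h n - 1 / real n" if "prime n"
      unfolding f1_def f2_def right_diff_distrib[symmetric] using lam_minus_inverse[OF that, of h] by simp
    then show "(if prime n then f1 n else 0) - (if prime n then f2 n else 0) = lam_weight h n - prime_weight n"
      by (simp add: lam_weight_def prime_weight_def)
  qed
  ultimately have "(\<lambda>N. \<Sum>n\<le>N. lam_weight h n - prime_weight n) \<longlonglongrightarrow> L_series h (real h + 1) - L_series h (2 * real h)"
    unfolding L1 L2 by (simp add: sums_def_le)
  then have "(\<lambda>N. (W.A (real N) - ln (ln (real N))) + (\<Sum>n\<le>N. lam_weight h n - prime_weight n)) \<longlonglongrightarrow> W.M + (L_series h (real h + 1) - L_series h (2 * real h))"
    by (intro tendsto_add W.M_LIMSEQ)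
  also have "(\<lambda>N. (W.A (real N) - ln (ln (real N))) + (\<Sum>n\<le>N. lam_weight h n - prime_weight n)) = (\<lambda>N. L.A (real N) - ln (ln (real N)))"
    by (auto simp: fun_eq_iff W.A_nat L.A_nat sum_subtractf)
  finally have "L.M = W.M + (L_series h (real h + 1) - L_series h (2 * real h))"
    using LIMSEQ_unique[OF L.M_LIMSEQ] by simp
  then show ?thesis unfolding D1_def mertens_constant[OF C] by simp
qed

definition lam_square_sum :: real where
  "lam_square_sum = (\<Sum>\<^sub>\<infinity>p\<in>{p::nat. prime p}. (lam h p)\<^sup>2)"

lemma D2_eq: "D2 h = (D1 h)\<^sup>2 + D1 h - zeta 2 - lam_square_sum"
  by (simp add: D2_def lam_square_sum_def lam_def)

text \<open>Since \<open>\<lambda>_p\<close> is \<open>O(1 / p)\<close>, the tail is dominated by a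
  tail of zeta(2).\<close>

lemma lam_square_tail:
  assumes "1 \<le> K"
  shows "\<bar>lam_square_sum - (\<Sum>n\<le>K. (lam_weight h n)\<^sup>2)\<bar> \<le> lam_const\<^sup>2 / real K"
proof -
  have sq: "(lam h p)\<^sup>2 \<le> lam_const\<^sup>2 * (1 / (real p)\<^sup>2)" if "prime p" for p
    using power_mono[OF lam_le[OF that], of 2] lam_pos[OF that, of h] by (simp add: power_divide)
  have summ: "(\<lambda>p. (lam h p)\<^sup>2) summable_on {p. prime p}"
    by (rule summable_on_primes(1)[where r = 2 and D = "lam_const\<^sup>2"])
       (use sq in \<open>auto simp: powr_minus powr_numeral divide_inverse dest: prime_gt_0_nat\<close>)
  have s: "(\<lambda>n. (lam_weight h n)\<^sup>2) sums lam_square_sum"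
  proof -
    have "(\<lambda>n. if prime n then (lam h n)\<^sup>2 else 0) = (\<lambda>n. (lam_weight h n)\<^sup>2)" by (auto simp: lam_weight_def)
    then show ?thesis using suminf_primes_eq_infsum[OF summ] by (simp add: lam_square_sum_def)
  qed
  have tail: "(\<lambda>n. (lam_weight h (n + Suc K))\<^sup>2) sums (lam_square_sum - (\<Sum>n\<le>K. (lam_weight h n)\<^sup>2))"
    using sums_iff_shift'[of "\<lambda>n. (lam_weight h n)\<^sup>2" "Suc K" lam_square_sum] s by (simp add: lessThan_Suc_atMost)
  have zs: "(\<lambda>n. 1 / (real (Suc n))\<^sup>2) sums zeta 2"
    using zeta_summable[of 2] unfolding zeta_powr by (simp add: powr_minus powr_numeral divide_inverse summable_sums del: of_nat_Suc)
  have "(\<lambda>n. 1 / (real (Suc (n + K)))\<^sup>2) sums (zeta 2 - (\<Sum>n<K. 1 / (real (Suc n))\<^sup>2))"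
    using sums_iff_shift'[of "\<lambda>n. 1 / (real (Suc n))\<^sup>2" K "zeta 2"] zs by simp
  also have "(\<Sum>n<K. 1 / (real (Suc n))\<^sup>2) = (\<Sum>k=1..K. 1 / (real k)\<^sup>2)"
    by (rule sum.reindex_bij_witness[of _ "\<lambda>k. k - 1" Suc]) auto
  finally have zt: "(\<lambda>n. 1 / (real (Suc (n + K)))\<^sup>2) sums (zeta 2 - (\<Sum>k=1..K. 1 / (real k)\<^sup>2))" .
  have "0 \<le> lam_square_sum - (\<Sum>n\<le>K. (lam_weight h n)\<^sup>2)" by (rule sums_le[OF _ sums_zero tail]) simp
  moreover have "lam_square_sum - (\<Sum>n\<le>K. (lam_weight h n)\<^sup>2) \<le> lam_const\<^sup>2 * (zeta 2 - (\<Sum>k=1..K. 1 / (real k)\<^sup>2))"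
  proof (rule sums_le[OF _ tail sums_mult[OF zt]])
    fix n show "(lam_weight h (n + Suc K))\<^sup>2 \<le> lam_const\<^sup>2 * (1 / (real (Suc (n + K)))\<^sup>2)"
      using sq[of "Suc (n + K)"] by (auto simp: lam_weight_def simp del: of_nat_Suc of_nat_add)
  qed
  moreover have "lam_const\<^sup>2 * (zeta 2 - (\<Sum>k=1..K. 1 / (real k)\<^sup>2)) \<le> lam_const\<^sup>2 * (1 / real K)"
    using zeta2_partial_sum(2)[OF assms] by (intro mult_left_mono) auto
  ultimately show ?thesis by simp
qed

section \<open>Moments of omega as sums over primes\<close>

definition count_upto :: "real \<Rightarrow> real" where "count_upto x = real (card (h_full_upto h x))"
definition omega_sum :: "real \<Rightarrow> real" where "omega_sum x = (\<Sum>n\<in>h_full_upto h x. real (omega n))"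
text \<open>The factorial moment: \<open>\<omega> * (\<omega> - 1)\<close> counts the ordered pairs
  of distinct primes dividing \<open>n\<close>.\<close>

definition pair_sum :: "real \<Rightarrow> real" where "pair_sum x = (\<Sum>n\<in>h_full_upto h x. (real (omega n))\<^sup>2) - omega_sum x"
definition Y :: "real \<Rightarrow> real" where "Y x = x powr (1 / real h)"

lemma finite_h_full_upto [simp]: "finite (h_full_upto h x)"
  unfolding h_full_upto_def by (rule finite_subset[OF _ finite_real_nat_le[of x]]) auto

definition primes_upto :: "real \<Rightarrow> nat set" where "primes_upto y = {p. prime p \<and> real p \<le> y}"

lemma finite_primes_upto_real [simp]: "finite (primes_upto y)"
  unfolding primes_upto_def by (rule finite_subset[OF _ finite_real_nat_le[of y]]) auto

lemma h_full_counting_intro: "1 \<le> x \<Longrightarrow> finite D \<Longrightarrow> (\<And>p. p \<in> D \<Longrightarrow> prime p) \<Longrightarrow> h_full_counting h x D"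
  by unfold_locales (use h in auto)

lemma Y_eq: "h_full_counting h x D \<Longrightarrow> h_full_counting.Y h x = Y x"
  by (simp add: h_full_counting.Y_def Y_def)

lemma count_le':
  assumes "1 \<le> x" "finite D" "\<And>p. p \<in> D \<Longrightarrow> prime p"
  shows "real (h_full_count h D x) \<le> gamma0 h * Y x * (\<Prod>p\<in>D. lam h p)"
  using h_full_counting.count_le[OF h_full_counting_intro[OF assms]] Y_eq[OF h_full_counting_intro[OF assms]] by simp

lemma count_eq_0':
  assumes "1 \<le> x" "finite D" "\<And>p. p \<in> D \<Longrightarrow> prime p" "Y x < real (\<Prod>D)"
  shows "h_full_count h D x = 0"
  using h_full_counting.count_eq_0[OF h_full_counting_intro[OF assms(1-3)]] Y_eq[OF h_full_counting_intro[OF assms(1-3)]] assms(4) by simp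

text \<open>A value strictly between \<open>h / (h + 1)\<close> and 1: it must lie below 1 for a
  power saving, and above \<open>h / (h + 1)\<close> for the series of the cores to converge at
  \<open>\<theta> / h\<close>.\<close>

definition \<theta> :: real where "\<theta> = 2 * real h / (2 * real h + 1)"

lemma \<theta>: "0 < \<theta>" "\<theta> < 1" "1 < \<theta> / real h * real (Suc h)"
proof -
  have "\<theta> / real h = 2 / (2 * real h + 1)" using h by (simp add: \<theta>_def)
  then show "1 < \<theta> / real h * real (Suc h)" by (simp only:) (simp add: field_simps)
qed (use h in \<open>auto simp: \<theta>_def\<close>)

definition K\<theta> :: real where "K\<theta> = core_sum h (\<theta> / real h)"

lemma K\<theta>_pos: "0 < K\<theta>" unfolding K\<theta>_def using core_sum_ge_1[OF \<theta>(3)] by simp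

lemma count_ge':
  assumes "1 \<le> x" "finite D" "\<And>p. p \<in> D \<Longrightarrow> prime p"
  shows "gamma0 h * Y x * (\<Prod>p\<in>D. lam h p) - real (h_full_count h D x)
    \<le> K\<theta> * Y x powr \<theta> * (\<Prod>p\<in>D. (1 + real h) * real p powr - \<theta>)"
  using h_full_counting.count_ge[OF h_full_counting_intro[OF assms] \<theta>] Y_eq[OF h_full_counting_intro[OF assms]]
  by (simp add: K\<theta>_def)

lemma gamma0_pos: "0 < gamma0 h"
proof -
  have "1 < 1 / real h * real (Suc h)" using h by (simp add: field_simps)
  from core_sum_ge_1[OF this] show ?thesis unfolding gamma0_eq_core_sum[OF h] by simp
qed

lemma Y_ge_1: "1 \<le> x \<Longrightarrow> 1 \<le> Y x" unfolding Y_def by (simp add: ge_one_powr_ge_zero)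

lemma count_upto_eq: "count_upto x = real (h_full_count h {} x)"
  unfolding count_upto_def h_full_count_def h_full_upto_def by simp

lemma count_sum:
  "real (h_full_count h D x) = (\<Sum>n\<in>h_full_upto h x. if \<forall>p\<in>D. p dvd n then 1 else 0)"
proof -
  have "{n \<in> h_full_upto h x. \<forall>p\<in>D. p dvd n} = {n. h_full h n \<and> real n \<le> x \<and> (\<forall>p\<in>D. p dvd n)}"
    by (auto simp: h_full_upto_def)
  then show ?thesis
    unfolding h_full_count_def by (simp only: sum.inter_filter[symmetric, OF finite_h_full_upto] card_eq_sum of_nat_sum of_nat_1)
qed

lemma prime_dvd_h_full_le:
  assumes "1 \<le> x" "n \<in> h_full_upto h x" "prime p" "p dvd n"
  shows "real p \<le> Y x"
proof (rule ccontr)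
  assume "\<not> real p \<le> Y x"
  then have "h_full_count h {p} x = 0" using assms by (intro count_eq_0') auto
  then have "{n. h_full h n \<and> real n \<le> x \<and> p dvd n} = {}"
    unfolding h_full_count_def
    by (subst (asm) card_eq_0_iff) (auto intro: finite_subset[OF _ finite_real_nat_le[of x]])
  then show False using assms by (auto simp: h_full_upto_def)
qed

lemma omega_eq:
  assumes "1 \<le> x" "n \<in> h_full_upto h x"
  shows "real (omega n) = (\<Sum>p\<in>primes_upto (Y x). if p dvd n then 1 else 0)"
proof -
  have "prime_factors n = {p \<in> primes_upto (Y x). p dvd n}"
    using assms prime_dvd_h_full_le[OF assms] by (auto simp: prime_factors_dvd primes_upto_def h_full_upto_def h_full_def)
  then show ?thesis
    unfolding omega_def by (simp only: sum.inter_filter[symmetric, OF finite_primes_upto_real] card_eq_sum of_nat_sum of_nat_1)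
qed

lemma omega_sum_eq:
  assumes "1 \<le> x"
  shows "omega_sum x = (\<Sum>p\<in>primes_upto (Y x). real (h_full_count h {p} x))"
proof -
  have "omega_sum x = (\<Sum>n\<in>h_full_upto h x. \<Sum>p\<in>primes_upto (Y x). if p dvd n then 1 else 0)"
    unfolding omega_sum_def by (intro sum.cong refl omega_eq assms)
  also have "\<dots> = (\<Sum>p\<in>primes_upto (Y x). \<Sum>n\<in>h_full_upto h x. if p dvd n then 1 else 0)" by (rule sum.swap)
  finally show ?thesis by (simp add: count_sum)
qed

text \<open>The diagonal of the double sum over primes is \<open>omega_sum\<close>, which is
  subtracted; pairs with \<open>p * q > Y x\<close> divide no \<open>n\<close> in range, whence
  \<open>q \<le> Y x / p\<close>.\<close>

lemma pair_sum_eq: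
  assumes "1 \<le> x"
  shows "pair_sum x = (\<Sum>p\<in>primes_upto (Y x). \<Sum>q\<in>primes_upto (Y x / real p) - {p}. real (h_full_count h {p, q} x))"
proof -
  let ?P = "primes_upto (Y x)"
  have "(\<Sum>n\<in>h_full_upto h x. (real (omega n))\<^sup>2)
      = (\<Sum>n\<in>h_full_upto h x. \<Sum>p\<in>?P. \<Sum>q\<in>?P. if \<forall>r\<in>{p, q}. r dvd n then 1 else 0)"
  proof (rule sum.cong[OF refl])
    fix n assume "n \<in> h_full_upto h x"
    then have "(real (omega n))\<^sup>2 = (\<Sum>p\<in>?P. \<Sum>q\<in>?P. (if p dvd n then 1 else 0) * (if q dvd n then 1 else 0))"
      unfolding power2_eq_square using omega_eq[OF assms] by (simp add: sum_product)
    also have "\<dots> = (\<Sum>p\<in>?P. \<Sum>q\<in>?P. if \<forall>r\<in>{p, q}. r dvd n then 1 else 0)" by (intro sum.cong refl) auto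
    finally show "(real (omega n))\<^sup>2 = (\<Sum>p\<in>?P. \<Sum>q\<in>?P. if \<forall>r\<in>{p, q}. r dvd n then 1 else 0)" .
  qed
  also have "\<dots> = (\<Sum>p\<in>?P. \<Sum>n\<in>h_full_upto h x. \<Sum>q\<in>?P. if \<forall>r\<in>{p, q}. r dvd n then 1 else 0)" by (rule sum.swap)
  also have "\<dots> = (\<Sum>p\<in>?P. \<Sum>q\<in>?P. real (h_full_count h {p, q} x))"
    unfolding count_sum by (intro sum.cong refl sum.swap)
  also have "\<dots> = (\<Sum>p\<in>?P. real (h_full_count h {p} x) + (\<Sum>q\<in>primes_upto (Y x / real p) - {p}. real (h_full_count h {p, q} x)))"
  proof (rule sum.cong[OF refl])
    fix p assume p: "p \<in> ?P"
    then have pp: "prime p" "1 \<le> real p" using prime_ge_1_nat[of p] by (auto simp: primes_upto_def)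
    have sub: "primes_upto (Y x / real p) \<subseteq> ?P"
    proof
      fix q assume q: "q \<in> primes_upto (Y x / real p)"
      then have "real q \<le> Y x / real p" by (simp add: primes_upto_def)
      also have "\<dots> \<le> Y x / 1" using pp Y_ge_1[OF assms] by (intro divide_left_mono) auto
      finally show "q \<in> ?P" using q by (simp add: primes_upto_def)
    qed
    have "(\<Sum>q\<in>?P. real (h_full_count h {p, q} x)) = real (h_full_count h {p} x) + (\<Sum>q\<in>?P - {p}. real (h_full_count h {p, q} x))"
      using p by (subst sum.remove[of _ p]) auto
    also have "(\<Sum>q\<in>?P - {p}. real (h_full_count h {p, q} x)) = (\<Sum>q\<in>primes_upto (Y x / real p) - {p}. real (h_full_count h {p, q} x))"
    proof (rule sum.mono_neutral_right)
      show "\<forall>q\<in>?P - {p} - (primes_upto (Y x / real p) - {p}). real (h_full_count h {p, q} x) = 0"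
      proof
        fix q assume q: "q \<in> ?P - {p} - (primes_upto (Y x / real p) - {p})"
        then have "Y x / real p < real q" "prime q" "q \<noteq> p" by (auto simp: primes_upto_def)
        then have "Y x < real (\<Prod>{p, q})" using pp by (simp add: field_simps)
        then have "h_full_count h {p, q} x = 0" using pp \<open>prime q\<close> assms by (intro count_eq_0') auto
        then show "real (h_full_count h {p, q} x) = 0" by simp
      qed
    qed (use sub in auto)
    finally show "(\<Sum>q\<in>?P. real (h_full_count h {p, q} x)) = real (h_full_count h {p} x) + (\<Sum>q\<in>primes_upto (Y x / real p) - {p}. real (h_full_count h {p, q} x))" .
  qed
  finally show ?thesis unfolding pair_sum_def omega_sum_eq[OF assms] by (simp add: sum.distrib)
qed

lemma sum_primes_upto:
  assumes "\<And>n. \<not> prime n \<Longrightarrow> f n = 0"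
  shows "(\<Sum>p\<in>primes_upto y. f p) = (\<Sum>n | real n \<le> y. f n :: real)"
  unfolding primes_upto_def using assms by (intro sum.mono_neutral_left) auto

abbreviation "Asum \<equiv> mertens_weight.A (lam_weight h)"
abbreviation "S2sum \<equiv> mertens_weight.S2 (lam_weight h)"

lemma lam_sum_eq: "(\<Sum>p\<in>primes_upto y. lam h p) = Asum y"
proof -
  interpret L: mertens_weight "lam_weight h" lam_C by (rule mertens_weight_lam')
  have "(\<Sum>p\<in>primes_upto y. lam h p) = (\<Sum>p\<in>primes_upto y. lam_weight h p)"
    by (rule sum.cong) (auto simp: lam_weight_def primes_upto_def)
  also have "\<dots> = Asum y" unfolding L.A_def by (rule sum_primes_upto) (simp add: lam_weight_def)
  finally show ?thesis .
qed

text \<open>The excluded diagonal meets the region \<open>p * q \<le> y\<close> in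
  \<open>p \<le> sqrt y\<close>; its squares converge to the last constant in
  \<open>D2\<close>.\<close>

lemma lam_pair_sum_eq:
  assumes "1 \<le> y"
  shows "(\<Sum>p\<in>primes_upto y. \<Sum>q\<in>primes_upto (y / real p) - {p}. lam h p * lam h q)
     = S2sum y - (\<Sum>n\<le>nat \<lfloor>sqrt y\<rfloor>. (lam_weight h n)\<^sup>2)"
proof -
  interpret L: mertens_weight "lam_weight h" lam_C by (rule mertens_weight_lam')
  have "(\<Sum>p\<in>primes_upto y. \<Sum>q\<in>primes_upto (y / real p) - {p}. lam h p * lam h q)
    = (\<Sum>p\<in>primes_upto y. lam_weight h p * Asum (y / real p) - (if real p \<le> sqrt y then (lam_weight h p)\<^sup>2 else 0))"
  proof (rule sum.cong[OF refl])
    fix p assume "p \<in> primes_upto y"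
    then have p: "prime p" "0 < real p" by (auto simp: primes_upto_def prime_gt_0_nat)
    have iff: "p \<in> primes_upto (y / real p) \<longleftrightarrow> real p \<le> sqrt y"
    proof -
      have "real p \<le> y / real p \<longleftrightarrow> (real p)\<^sup>2 \<le> y" using p by (simp add: field_simps power2_eq_square)
      also have "\<dots> \<longleftrightarrow> real p \<le> sqrt y"
        using real_sqrt_le_iff[of "(real p)\<^sup>2" y] by simp
      finally show ?thesis using p by (simp add: primes_upto_def)
    qed
    have "(\<Sum>q\<in>primes_upto (y / real p) - {p}. lam h p * lam h q) = lam h p * (\<Sum>q\<in>primes_upto (y / real p) - {p}. lam h q)"
      by (simp only: sum_distrib_left)
    also have "(\<Sum>q\<in>primes_upto (y / real p) - {p}. lam h q) = Asum (y / real p) - (if real p \<le> sqrt y then lam h p else 0)"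
      unfolding lam_sum_eq[symmetric] using iff by (simp add: sum_diff1)
    finally show "(\<Sum>q\<in>primes_upto (y / real p) - {p}. lam h p * lam h q)
        = lam_weight h p * Asum (y / real p) - (if real p \<le> sqrt y then (lam_weight h p)\<^sup>2 else 0)"
      using p by (simp add: lam_weight_def power2_eq_square right_diff_distrib)
  qed
  also have "\<dots> = (\<Sum>n | real n \<le> y. lam_weight h n * Asum (y / real n) - (if real n \<le> sqrt y then (lam_weight h n)\<^sup>2 else 0))"
    by (rule sum_primes_upto) (simp add: lam_weight_def)
  also have "\<dots> = S2sum y - (\<Sum>n | real n \<le> y. if real n \<le> sqrt y then (lam_weight h n)\<^sup>2 else 0)"
    unfolding L.S2_def by (simp only: sum_subtractf)
  also have "(\<Sum>n | real n \<le> y. if real n \<le> sqrt y then (lam_weight h n)\<^sup>2 else 0) = (\<Sum>n | real n \<le> sqrt y. (lam_weight h n)\<^sup>2)"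
  proof -
    have "sqrt y \<le> y" using assms by (auto intro!: real_le_lsqrt simp: power2_eq_square)
    then have "{n. real n \<le> y} \<inter> {n. real n \<le> sqrt y} = {n. real n \<le> sqrt y}" by auto
    then show ?thesis by (simp add: sum.If_cases)
  qed
  also have "{n. real n \<le> sqrt y} = {..nat \<lfloor>sqrt y\<rfloor>}" using assms by (intro real_nat_le_eq) auto
  finally show ?thesis .
qed

end

text \<open>On the dyadic range below \<open>x / 2^i\<close> the weight is at most
  \<open>2 powr (\<delta> * (i + 1))\<close>, while the mass decays like
  \<open>2 powr - (\<alpha> * i)\<close>; the series is geometric because
  \<open>\<delta> < \<alpha>\<close>. Hence a weight that favours small \<open>n\<close> mildly
  enough does not change the order of the sum.\<close>

lemma powr_weighted_sum_le:
  fixes w :: "nat \<Rightarrow> real"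
  assumes fin: "finite S" and S: "\<And>n. n \<in> S \<Longrightarrow> 1 \<le> n \<and> real n \<le> x" and w: "\<And>n. n \<in> S \<Longrightarrow> 0 \<le> w n"
    and W: "\<And>t. 1 \<le> t \<Longrightarrow> t \<le> x \<Longrightarrow> (\<Sum>n\<in>{n\<in>S. real n \<le> t}. w n) \<le> B * t powr \<alpha>"
    and "0 < \<delta>" "\<delta> < \<alpha>" "1 \<le> x" "0 \<le> B"
  shows "(\<Sum>n\<in>S. (x / real n) powr \<delta> * w n) \<le> 2 powr \<delta> / (1 - 2 powr (\<delta> - \<alpha>)) * (B * x powr \<alpha>)"
proof -
  obtain J where J: "x < 2 ^ J" using real_arch_pow[of 2 x] by auto
  define q where "q = (2::real) powr (\<delta> - \<alpha>)"
  have q: "0 < q" "q < 1" using assms powr_less_mono[of "\<delta> - \<alpha>" 0 "2::real"] by (auto simp: q_def)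
  have pt: "(x / real n) powr \<delta> \<le> (\<Sum>i<J. if real n \<le> x / 2 ^ i then (2 ^ Suc i) powr \<delta> else 0)" if n: "n \<in> S" for n
  proof -
    \<comment> \<open>The first power of 2 that pushes \<open>x / 2^k\<close> below
      \<open>n\<close>. It has \<open>k > 0\<close> since \<open>n \<le> x\<close>, and
      \<open>k - 1\<close> is the dyadic index of \<open>n\<close>.\<close>
    define k where "k = (LEAST k. x / 2 ^ k < real n)"
    have ex: "x / 2 ^ J < real n"
    proof -
      have "x / 2 ^ J < 1" using J by simp
      then show ?thesis using S[OF n] by linarith
    qed
    have k: "x / 2 ^ k < real n" unfolding k_def by (rule LeastI[of "\<lambda>k. x / 2 ^ k < real n", OF ex])
    have kJ: "k \<le> J" unfolding k_def by (rule Least_le[of "\<lambda>k. x / 2 ^ k < real n", OF ex])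
    have "k \<noteq> 0" using k S[OF n] by (intro notI) simp
    then obtain i where i: "k = Suc i" by (cases k) auto
    have "\<not> x / 2 ^ i < real n" using not_less_Least[of i "\<lambda>k. x / 2 ^ k < real n"] i unfolding k_def by simp
    then have ni: "real n \<le> x / 2 ^ i" by simp
    have "x / real n \<le> 2 ^ Suc i" using k S[OF n] unfolding i by (simp add: field_simps)
    then have "(x / real n) powr \<delta> \<le> (2 ^ Suc i) powr \<delta>" using assms by (intro powr_mono2) auto
    also have "\<dots> = (\<Sum>i\<in>{i}. if real n \<le> x / 2 ^ i then (2 ^ Suc i) powr \<delta> else 0)" using ni by simp
    also have "\<dots> \<le> (\<Sum>i<J. if real n \<le> x / 2 ^ i then (2 ^ Suc i) powr \<delta> else 0)"
      using kJ i by (intro sum_mono2) auto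
    finally show ?thesis .
  qed
  have "(\<Sum>n\<in>S. (x / real n) powr \<delta> * w n) \<le> (\<Sum>n\<in>S. (\<Sum>i<J. if real n \<le> x / 2 ^ i then (2 ^ Suc i) powr \<delta> else 0) * w n)"
    using pt w by (intro sum_mono mult_right_mono)
  also have "\<dots> = (\<Sum>i<J. \<Sum>n\<in>S. (if real n \<le> x / 2 ^ i then (2 ^ Suc i) powr \<delta> else 0) * w n)"
    unfolding sum_distrib_right by (rule sum.swap)
  also have "\<dots> \<le> (\<Sum>i<J. 2 powr \<delta> * (B * x powr \<alpha>) * q ^ i)"
  proof (rule sum_mono)
    fix i
    have e: "(\<Sum>n\<in>S. (if real n \<le> x / 2 ^ i then (2 ^ Suc i) powr \<delta> else 0) * w n) = (2 ^ Suc i) powr \<delta> * (\<Sum>n\<in>{n\<in>S. real n \<le> x / 2 ^ i}. w n)"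
      unfolding sum_distrib_left sum.inter_filter[OF fin] by (rule sum.cong) auto
    have le: "(\<Sum>n\<in>{n\<in>S. real n \<le> x / 2 ^ i}. w n) \<le> B * (x / 2 ^ i) powr \<alpha>"
    proof (cases "1 \<le> x / 2 ^ i")
      case True
      have "x / 2 ^ i \<le> x / 1" using assms by (intro divide_left_mono) auto
      then show ?thesis using True by (intro W) auto
    next
      case False
      then have e: "{n \<in> S. real n \<le> x / 2 ^ i} = {}"
      proof -
        have "\<not> real n \<le> x / 2 ^ i" if "n \<in> S" for n
        proof -
          have "1 \<le> real n" using S[OF that] by simp
          then show ?thesis using False by linarith
        qed
        then show ?thesis by blast
      qed
      show ?thesis unfolding e using assms by simp
    qed
    have "(2 ^ Suc i) powr \<delta> * (B * (x / 2 ^ i) powr \<alpha>) = 2 powr \<delta> * (B * x powr \<alpha>) * q ^ i"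
    proof -
      have "(2 ^ Suc i) powr \<delta> = 2 powr \<delta> * 2 powr (\<delta> * real i)"
        by (simp add: powr_mult powr_realpow[symmetric] powr_powr mult.commute)
      moreover have "(x / 2 ^ i) powr \<alpha> = x powr \<alpha> * 2 powr (- (\<alpha> * real i))"
        using assms by (subst powr_divide) (auto simp: powr_realpow[symmetric] powr_powr powr_minus divide_inverse mult.commute)
      moreover have "q ^ i = 2 powr (\<delta> * real i) * 2 powr (- (\<alpha> * real i))"
        using q by (simp add: powr_realpow[symmetric] q_def powr_powr powr_add[symmetric] left_diff_distrib)
      ultimately show ?thesis by simp
    qed
    then show "(\<Sum>n\<in>S. (if real n \<le> x / 2 ^ i then (2 ^ Suc i) powr \<delta> else 0) * w n) \<le> 2 powr \<delta> * (B * x powr \<alpha>) * q ^ i"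
      unfolding e using mult_left_mono[OF le, of "(2 ^ Suc i) powr \<delta>"] by (simp only: powr_ge_zero)
  qed
  also have "\<dots> = 2 powr \<delta> * (B * x powr \<alpha>) * (\<Sum>i<J. q ^ i)" by (simp only: sum_distrib_left)
  also have "\<dots> \<le> 2 powr \<delta> * (B * x powr \<alpha>) * (1 / (1 - q))"
  proof (intro mult_left_mono)
    have "(\<Sum>i<J. q ^ i) \<le> (\<Sum>i. q ^ i)" using q by (intro sum_le_suminf summable_geometric) auto
    then show "(\<Sum>i<J. q ^ i) \<le> 1 / (1 - q)" using q by (simp add: suminf_geometric)
  qed (use assms in auto)
  finally show ?thesis by (simp add: q_def mult_ac)
qed

lemma loglog_square_powr_bigo:
  fixes a t :: real
  assumes "0 < a" "0 < t" "t < 1"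
  shows "(\<lambda>x. (ln (ln x))\<^sup>2 * (x powr a) powr t) \<in> O[at_top](\<lambda>x. x powr a * (ln (ln x) / ln x))"
  using assms by real_asymp

section \<open>Asymptotics of the moments about \<open>ln (ln x)\<close>\<close>

context h_full_setting
begin

lemma filterlim_Y: "filterlim Y at_top at_top"
  unfolding Y_def using h by real_asymp

lemma count_upto_asymp: "(\<lambda>x. count_upto x - gamma0 h * Y x) \<in> O[at_top](\<lambda>x. Y x powr \<theta>)"
proof (rule bigoI[where c = K\<theta>])
  show "\<forall>\<^sub>F x in at_top. norm (count_upto x - gamma0 h * Y x) \<le> K\<theta> * norm (Y x powr \<theta>)"
    using eventually_ge_at_top[of 1]
  proof eventually_elim
    case (elim x)
    then show ?case using count_le'[of x "{}"] count_ge'[of x "{}"] by (simp add: count_upto_eq)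
  qed
qed

text \<open>The errors \<open>Y powr \<theta> * p powr - \<theta>\<close> are summed over
  \<open>p \<le> Y\<close> by writing \<open>p powr - \<theta>\<close> as
  \<open>p powr (1 - \<theta>) / p\<close>; the sum of these is
  \<open>O(Y powr (1 - \<theta>) / ln Y)\<close>.\<close>

lemma omega_sum_asymp: "(\<lambda>x. omega_sum x - gamma0 h * Y x * Asum (Y x)) \<in> O[at_top](\<lambda>x. Y x / ln (Y x))"
proof -
  obtain C where C: "mertens_weight prime_weight C" using mertens_weight_prime_weight by blast
  interpret W: mertens_weight prime_weight C by fact
  obtain K where K: "0 < K" "\<And>y. 2 \<le> y \<Longrightarrow> (\<Sum>n | real n \<le> y. prime_weight n * real n powr (1 - \<theta>)) \<le> K * (y powr (1 - \<theta>) / ln y)"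
    using W.powr_sum_le[of "1 - \<theta>"] \<theta> by auto
  show ?thesis
  proof (rule bigoI[where c = "K\<theta> * (1 + real h) * K"])
    have "\<forall>\<^sub>F x in at_top. 2 \<le> Y x" using filterlim_Y by (simp add: filterlim_at_top)
    then show "\<forall>\<^sub>F x in at_top. norm (omega_sum x - gamma0 h * Y x * Asum (Y x)) \<le> K\<theta> * (1 + real h) * K * norm (Y x / ln (Y x))"
      using eventually_ge_at_top[of 1]
    proof eventually_elim
      case (elim x)
      let ?P = "primes_upto (Y x)"
      have "omega_sum x - gamma0 h * Y x * Asum (Y x) = (\<Sum>p\<in>?P. real (h_full_count h {p} x) - gamma0 h * Y x * lam h p)"
        using elim by (simp add: omega_sum_eq lam_sum_eq[symmetric] sum_subtractf sum_distrib_left)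
      then have "norm (omega_sum x - gamma0 h * Y x * Asum (Y x)) \<le> (\<Sum>p\<in>?P. \<bar>real (h_full_count h {p} x) - gamma0 h * Y x * lam h p\<bar>)"
        by simp
      also have "\<dots> \<le> (\<Sum>p\<in>?P. K\<theta> * (1 + real h) * Y x powr \<theta> * (prime_weight p * real p powr (1 - \<theta>)))"
      proof (rule sum_mono)
        fix p assume "p \<in> ?P"
        then have p: "prime p" "0 < real p" by (auto simp: primes_upto_def prime_gt_0_nat)
        have "real p powr - \<theta> = prime_weight p * real p powr (1 - \<theta>)"
          using p by (simp add: prime_weight_def powr_diff powr_minus divide_inverse)
        then show "\<bar>real (h_full_count h {p} x) - gamma0 h * Y x * lam h p\<bar> \<le> K\<theta> * (1 + real h) * Y x powr \<theta> * (prime_weight p * real p powr (1 - \<theta>))"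
          using count_le'[of x "{p}"] count_ge'[of x "{p}"] elim p by (simp add: mult_ac)
      qed
      also have "\<dots> = K\<theta> * (1 + real h) * Y x powr \<theta> * (\<Sum>n | real n \<le> Y x. prime_weight n * real n powr (1 - \<theta>))"
        unfolding sum_distrib_left[symmetric] by (subst sum_primes_upto) (simp_all add: prime_weight_def)
      also have "\<dots> \<le> K\<theta> * (1 + real h) * Y x powr \<theta> * (K * (Y x powr (1 - \<theta>) / ln (Y x)))"
        using elim K\<theta>_pos by (intro mult_left_mono K) auto
      also have "\<dots> = K\<theta> * (1 + real h) * K * (Y x powr \<theta> * Y x powr (1 - \<theta>) / ln (Y x))" by simp
      also have "Y x powr \<theta> * Y x powr (1 - \<theta>) = Y x" using elim by (simp add: powr_add[symmetric])
      finally show ?case using elim by simp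
    qed
  qed
qed

definition lam_square_partial :: "real \<Rightarrow> real" where
  "lam_square_partial y = (\<Sum>n\<le>nat \<lfloor>sqrt y\<rfloor>. (lam_weight h n)\<^sup>2)"

text \<open>The errors for pairs are of size
  \<open>Y powr \<theta> * (p * q) powr - \<theta>\<close>, to be summed over the hyperbolic region.
  The extra \<open>ln (ln Y)\<close> compared with single primes comes from
  \<open>powr_pair_sum_bigo\<close>.\<close>

lemma pair_sum_asymp:
  "(\<lambda>x. pair_sum x - gamma0 h * Y x * (S2sum (Y x) - lam_square_partial (Y x))) \<in> O[at_top](\<lambda>x. Y x * ln (ln (Y x)) / ln (Y x))"
proof -
  obtain C where C: "mertens_weight prime_weight C" using mertens_weight_prime_weight by blast
  interpret W: mertens_weight prime_weight C by fact
  define R where "R = (\<lambda>y. \<Sum>m | real m \<le> y. prime_weight m * real m powr (1 - \<theta>) * (\<Sum>n | real n \<le> y / real m. prime_weight n * real n powr (1 - \<theta>)))"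
  have R: "R \<in> O[at_top](\<lambda>y. y powr (1 - \<theta>) * ln (ln y) / ln y)"
    unfolding R_def by (rule W.powr_pair_sum_bigo) (use \<theta> in auto)
  have "(\<lambda>y. y powr \<theta> * R y) \<in> O[at_top](\<lambda>y. y powr \<theta> * (y powr (1 - \<theta>) * ln (ln y) / ln y))"
    by (intro landau_o.big.mult R) auto
  also have "(\<lambda>y. y powr \<theta> * (y powr (1 - \<theta>) * ln (ln y) / ln y)) \<in> O[at_top](\<lambda>y. y * ln (ln y) / ln y)"
  proof (rule bigoI[where c = 1])
    show "\<forall>\<^sub>F y::real in at_top. norm (y powr \<theta> * (y powr (1 - \<theta>) * ln (ln y) / ln y)) \<le> 1 * norm (y * ln (ln y) / ln y)"
      using eventually_gt_at_top[of 0]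
    proof eventually_elim
      case (elim y)
      have "y powr \<theta> * (y powr (1 - \<theta>) * ln (ln y) / ln y) = (y powr \<theta> * y powr (1 - \<theta>)) * ln (ln y) / ln y" by simp
      also have "y powr \<theta> * y powr (1 - \<theta>) = y" using elim by (simp add: powr_add[symmetric])
      finally show ?case by (simp only: mult_1 order_refl)
    qed
  qed
  finally have "(\<lambda>y. y powr \<theta> * R y) \<in> O[at_top](\<lambda>y. y * ln (ln y) / ln y)" .
  from landau_o.big.compose[OF this filterlim_Y]
  have RY: "(\<lambda>x. Y x powr \<theta> * R (Y x)) \<in> O[at_top](\<lambda>x. Y x * ln (ln (Y x)) / ln (Y x))" .
  have "(\<lambda>x. pair_sum x - gamma0 h * Y x * (S2sum (Y x) - lam_square_partial (Y x))) \<in> O[at_top](\<lambda>x. Y x powr \<theta> * R (Y x))"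
  proof (rule bigoI[where c = "K\<theta> * (1 + real h)\<^sup>2"])
    show "\<forall>\<^sub>F x in at_top. norm (pair_sum x - gamma0 h * Y x * (S2sum (Y x) - lam_square_partial (Y x))) \<le> K\<theta> * (1 + real h)\<^sup>2 * norm (Y x powr \<theta> * R (Y x))"
      using eventually_ge_at_top[of 1]
    proof eventually_elim
      case (elim x)
      let ?P = "primes_upto (Y x)"
      let ?Q = "\<lambda>p. primes_upto (Y x / real p)"
      let ?u = "\<lambda>p. prime_weight p * real p powr (1 - \<theta>)"
      have u: "real p powr - \<theta> = ?u p" if "prime p" for p
        using prime_gt_0_nat[OF that] that by (simp add: prime_weight_def powr_diff powr_minus divide_inverse)
      have u0: "0 \<le> ?u p" for p by (simp add: prime_weight_def)
      have "pair_sum x - gamma0 h * Y x * (S2sum (Y x) - lam_square_partial (Y x))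
         = (\<Sum>p\<in>?P. \<Sum>q\<in>?Q p - {p}. real (h_full_count h {p, q} x) - gamma0 h * Y x * (lam h p * lam h q))"
        unfolding lam_square_partial_def lam_pair_sum_eq[OF Y_ge_1[OF elim], symmetric] pair_sum_eq[OF elim]
        by (simp only: sum_subtractf sum_distrib_left)
      then have "norm (pair_sum x - gamma0 h * Y x * (S2sum (Y x) - lam_square_partial (Y x)))
         \<le> (\<Sum>p\<in>?P. \<Sum>q\<in>?Q p - {p}. \<bar>real (h_full_count h {p, q} x) - gamma0 h * Y x * (lam h p * lam h q)\<bar>)"
        by (auto intro!: order.trans[OF sum_abs] sum_mono)
      also have "\<dots> \<le> (\<Sum>p\<in>?P. \<Sum>q\<in>?Q p - {p}. K\<theta> * (1 + real h)\<^sup>2 * Y x powr \<theta> * (?u p * ?u q))"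
      proof (intro sum_mono)
        fix p q assume "p \<in> ?P" "q \<in> ?Q p - {p}"
        then have p: "prime p" "prime q" "p \<noteq> q" by (auto simp: primes_upto_def)
        have "\<bar>real (h_full_count h {p, q} x) - gamma0 h * Y x * (lam h p * lam h q)\<bar>
           \<le> K\<theta> * Y x powr \<theta> * (((1 + real h) * real p powr - \<theta>) * ((1 + real h) * real q powr - \<theta>))"
        proof -
          have pr: "\<And>r. r \<in> {p, q} \<Longrightarrow> prime r" using p by auto
          have "real (h_full_count h {p, q} x) \<le> gamma0 h * Y x * (lam h p * lam h q)"
            using count_le'[of x "{p, q}", OF elim _ pr] p(3) by simp
          moreover have "gamma0 h * Y x * (lam h p * lam h q) - real (h_full_count h {p, q} x)
             \<le> K\<theta> * Y x powr \<theta> * (((1 + real h) * real p powr - \<theta>) * ((1 + real h) * real q powr - \<theta>))"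
            using count_ge'[of x "{p, q}", OF elim _ pr] p(3) by simp
          moreover have "0 \<le> K\<theta> * Y x powr \<theta> * (((1 + real h) * real p powr - \<theta>) * ((1 + real h) * real q powr - \<theta>))"
            using K\<theta>_pos by simp
          ultimately show ?thesis unfolding abs_le_iff by linarith
        qed
        then show "\<bar>real (h_full_count h {p, q} x) - gamma0 h * Y x * (lam h p * lam h q)\<bar> \<le> K\<theta> * (1 + real h)\<^sup>2 * Y x powr \<theta> * (?u p * ?u q)"
          unfolding u[OF p(1)] u[OF p(2)] by (simp add: power2_eq_square mult_ac)
      qed
      also have "\<dots> = K\<theta> * (1 + real h)\<^sup>2 * Y x powr \<theta> * (\<Sum>p\<in>?P. ?u p * (\<Sum>q\<in>?Q p - {p}. ?u q))"
        by (simp only: sum_distrib_left)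
      also have "\<dots> \<le> K\<theta> * (1 + real h)\<^sup>2 * Y x powr \<theta> * (\<Sum>p\<in>?P. ?u p * (\<Sum>q\<in>?Q p. ?u q))"
        using u0 K\<theta>_pos by (intro mult_left_mono sum_mono sum_mono2) auto
      also have "(\<Sum>p\<in>?P. ?u p * (\<Sum>q\<in>?Q p. ?u q)) = (\<Sum>p\<in>?P. ?u p * (\<Sum>n | real n \<le> Y x / real p. ?u n))"
        by (subst sum_primes_upto) (simp_all add: prime_weight_def)
      also have "\<dots> = R (Y x)" unfolding R_def by (rule sum_primes_upto) (simp add: prime_weight_def)
      finally have "norm (pair_sum x - gamma0 h * Y x * (S2sum (Y x) - lam_square_partial (Y x)))
        \<le> K\<theta> * (1 + real h)\<^sup>2 * Y x powr \<theta> * R (Y x)" .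
      moreover have "0 \<le> R (Y x)" unfolding R_def by (intro sum_nonneg mult_nonneg_nonneg u0)
      ultimately show ?case by simp
    qed
  qed
  then show ?thesis by (rule landau_o.big.trans[OF _ RY])
qed

lemma ln_Y: "1 < x \<Longrightarrow> ln (Y x) = ln x / real h"
  by (simp add: Y_def ln_powr)

lemma loglog_Y: "1 < x \<Longrightarrow> ln (ln (Y x)) = ln (ln x) - ln (real h)"
  using h by (simp add: ln_Y ln_div)

abbreviation "EL \<equiv> (\<lambda>x::real. ln (ln x) / ln x)"

lemma Y_loglog_bigo: "(\<lambda>x. ln (ln (Y x)) / ln (Y x)) \<in> O[at_top](EL)"
  unfolding Y_def using h by real_asymp

lemma Asum_asymp: "(\<lambda>x. Asum (Y x) - (ln (ln x) + D1 h)) \<in> O[at_top](\<lambda>x. 1 / ln x)"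
proof -
  interpret L: mertens_weight "lam_weight h" lam_C by (rule mertens_weight_lam')
  have "(\<lambda>y. L.A y - ln (ln y) - L.M) \<in> O[at_top](\<lambda>y. 1 / ln y)"
  proof (rule bigoI[where c = L.K1])
    show "\<forall>\<^sub>F y in at_top. norm (L.A y - ln (ln y) - L.M) \<le> L.K1 * norm (1 / ln y)"
      using eventually_ge_at_top[of 2] by eventually_elim (use L.A_asymp in simp)
  qed
  from landau_o.big.compose[OF this filterlim_Y]
  have "(\<lambda>x. L.A (Y x) - ln (ln (Y x)) - L.M) \<in> O[at_top](\<lambda>x. 1 / ln (Y x))" .
  also have "(\<lambda>x. 1 / ln (Y x)) \<in> O[at_top](\<lambda>x. 1 / ln x)" unfolding Y_def using h by real_asymp
  finally have *: "(\<lambda>x. L.A (Y x) - ln (ln (Y x)) - L.M) \<in> O[at_top](\<lambda>x. 1 / ln x)" .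
  have "\<forall>\<^sub>F x in at_top. L.A (Y x) - ln (ln (Y x)) - L.M = Asum (Y x) - (ln (ln x) + D1 h)"
    using eventually_gt_at_top[of 1] by eventually_elim (simp add: loglog_Y D1_eq)
  from landau_o.big.in_cong[OF this] * show ?thesis by simp
qed

lemma S2sum_asymp: "(\<lambda>x. S2sum (Y x) - ((ln (ln x) + D1 h)\<^sup>2 - zeta 2)) \<in> O[at_top](EL)"
proof -
  interpret L: mertens_weight "lam_weight h" lam_C by (rule mertens_weight_lam')
  from landau_o.big.compose[OF L.S2_asymp filterlim_Y]
  have "(\<lambda>x. L.S2 (Y x) - ((ln (ln (Y x)) + L.M)\<^sup>2 - zeta 2)) \<in> O[at_top](\<lambda>x. ln (ln (Y x)) / ln (Y x))" .
  also note Y_loglog_bigo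
  finally have *: "(\<lambda>x. L.S2 (Y x) - ((ln (ln (Y x)) + L.M)\<^sup>2 - zeta 2)) \<in> O[at_top](EL)" .
  have "\<forall>\<^sub>F x in at_top. L.S2 (Y x) - ((ln (ln (Y x)) + L.M)\<^sup>2 - zeta 2) = S2sum (Y x) - ((ln (ln x) + D1 h)\<^sup>2 - zeta 2)"
    using eventually_gt_at_top[of 1] by eventually_elim (simp add: loglog_Y D1_eq algebra_simps)
  from landau_o.big.in_cong[OF this] * show ?thesis by simp
qed

lemma lam_square_partial_asymp: "(\<lambda>x. lam_square_partial (Y x) - lam_square_sum) \<in> O[at_top](EL)"
proof -
  have "(\<lambda>y. lam_square_partial y - lam_square_sum) \<in> O[at_top](\<lambda>y. 1 / real (nat \<lfloor>sqrt y\<rfloor>))"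
  proof (rule bigoI[where c = "lam_const\<^sup>2"])
    show "\<forall>\<^sub>F y in at_top. norm (lam_square_partial y - lam_square_sum) \<le> lam_const\<^sup>2 * norm (1 / real (nat \<lfloor>sqrt y\<rfloor>))"
      using eventually_ge_at_top[of 1]
    proof eventually_elim
      case (elim y)
      then have "1 \<le> sqrt y" by simp
      then have "1 \<le> nat \<lfloor>sqrt y\<rfloor>" by linarith
      from lam_square_tail[OF this] show ?case by (simp add: lam_square_partial_def abs_minus_commute)
    qed
  qed
  also have "(\<lambda>y::real. 1 / real (nat \<lfloor>sqrt y\<rfloor>)) \<in> O[at_top](\<lambda>y. ln (ln y) / ln y)" by real_asymp
  finally have "(\<lambda>y. lam_square_partial y - lam_square_sum) \<in> O[at_top](\<lambda>y. ln (ln y) / ln y)" .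
  from landau_o.big.compose[OF this filterlim_Y] show ?thesis by (rule landau_o.big.trans[OF _ Y_loglog_bigo])
qed

definition fixed_moment :: "real \<Rightarrow> real" where
  "fixed_moment x = (\<Sum>n\<in>h_full_upto h x. (real (omega n) - ln (ln x))\<^sup>2)"

text \<open>\<open>(\<omega> - L)^2 = \<omega> * (\<omega> - 1) + (1 - 2 * L) * \<omega> +
  L^2\<close> with \<open>L = ln (ln x)\<close>.\<close>

lemma fixed_moment_eq: "fixed_moment x = pair_sum x + omega_sum x * (1 - 2 * ln (ln x)) + (ln (ln x))\<^sup>2 * count_upto x"
proof -
  have "fixed_moment x = (\<Sum>n\<in>h_full_upto h x. (real (omega n))\<^sup>2 + (- (2 * ln (ln x))) * real (omega n) + (ln (ln x))\<^sup>2)"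
    unfolding fixed_moment_def by (intro sum.cong refl) (simp add: power2_eq_square algebra_simps)
  also have "\<dots> = (\<Sum>n\<in>h_full_upto h x. (real (omega n))\<^sup>2) + (- (2 * ln (ln x))) * omega_sum x + count_upto x * (ln (ln x))\<^sup>2"
    unfolding sum.distrib omega_sum_def count_upto_def sum_distrib_left[symmetric] by simp
  finally show ?thesis by (simp add: pair_sum_def algebra_simps)
qed

text \<open>In \<open>(L + D1)^2 - \<zeta>(2) - \<Sum> \<lambda>_p^2 + (1 - 2 * L) * (L + D1) +
  L^2\<close> with \<open>L = ln (ln x)\<close> all multiples of \<open>L^2\<close> and
  \<open>L * D1\<close> cancel, and \<open>L + D2\<close> remains. The factor
  \<open>1 - 2 * L\<close> is why the first moment is needed with error \<open>O(Y / ln x)\<close>,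
  better by \<open>L\<close> than the pair sum.\<close>

theorem fixed_moment_asymp:
  "(\<lambda>x. fixed_moment x - gamma0 h * Y x * (ln (ln x) + D2 h)) \<in> O[at_top](\<lambda>x. Y x * EL x)"
proof -
  define tQ t1 t0 where "tQ = (\<lambda>x. pair_sum x - gamma0 h * Y x * (S2sum (Y x) - lam_square_partial (Y x)))"
    and "t1 = (\<lambda>x. omega_sum x - gamma0 h * Y x * Asum (Y x))" and "t0 = (\<lambda>x. count_upto x - gamma0 h * Y x)"
  define e1 e2 e3 where "e1 = (\<lambda>x. Asum (Y x) - (ln (ln x) + D1 h))"
    and "e2 = (\<lambda>x. S2sum (Y x) - ((ln (ln x) + D1 h)\<^sup>2 - zeta 2))"
    and "e3 = (\<lambda>x. lam_square_partial (Y x) - lam_square_sum)"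
  have eq: "fixed_moment x - gamma0 h * Y x * (ln (ln x) + D2 h)
      = tQ x + t1 x * (1 - 2 * ln (ln x)) + (ln (ln x))\<^sup>2 * t0 x
        + gamma0 h * (Y x * (e2 x - e3 x + e1 x * (1 - 2 * ln (ln x))))" for x
    unfolding fixed_moment_eq tQ_def t1_def t0_def e1_def e2_def e3_def D2_eq
    by (simp add: power2_eq_square algebra_simps)
  have 1: "tQ \<in> O[at_top](\<lambda>x. Y x * EL x)"
  proof -
    have "(\<lambda>x. Y x * (ln (ln (Y x)) / ln (Y x))) \<in> O[at_top](\<lambda>x. Y x * EL x)"
      by (intro landau_o.big.mult Y_loglog_bigo) auto
    then show ?thesis using landau_o.big.trans[OF pair_sum_asymp] unfolding tQ_def by simp
  qed
  have 2: "(\<lambda>x. t1 x * (1 - 2 * ln (ln x))) \<in> O[at_top](\<lambda>x. Y x * EL x)"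
  proof -
    have "(\<lambda>x. t1 x * (1 - 2 * ln (ln x))) \<in> O[at_top](\<lambda>x. Y x / ln (Y x) * (1 - 2 * ln (ln x)))"
      unfolding t1_def by (intro landau_o.big.mult omega_sum_asymp) auto
    also have "(\<lambda>x. Y x / ln (Y x) * (1 - 2 * ln (ln x))) \<in> O[at_top](\<lambda>x. Y x * EL x)"
      unfolding Y_def using h by real_asymp
    finally show ?thesis .
  qed
  have 3: "(\<lambda>x. (ln (ln x))\<^sup>2 * t0 x) \<in> O[at_top](\<lambda>x. Y x * EL x)"
  proof -
    have "(\<lambda>x. (ln (ln x))\<^sup>2 * t0 x) \<in> O[at_top](\<lambda>x. (ln (ln x))\<^sup>2 * Y x powr \<theta>)"
      unfolding t0_def by (intro landau_o.big.mult count_upto_asymp) auto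
    also have "(\<lambda>x. (ln (ln x))\<^sup>2 * Y x powr \<theta>) \<in> O[at_top](\<lambda>x. Y x * EL x)"
      unfolding Y_def using h \<theta>(1,2) by (intro loglog_square_powr_bigo) auto
    finally show ?thesis .
  qed
  have "(\<lambda>x. e1 x * (1 - 2 * ln (ln x))) \<in> O[at_top](EL)"
  proof -
    have "(\<lambda>x. e1 x * (1 - 2 * ln (ln x))) \<in> O[at_top](\<lambda>x. 1 / ln x * (1 - 2 * ln (ln x)))"
      unfolding e1_def by (intro landau_o.big.mult Asum_asymp) auto
    also have "(\<lambda>x::real. 1 / ln x * (1 - 2 * ln (ln x))) \<in> O[at_top](EL)" by real_asymp
    finally show ?thesis .
  qed
  then have "(\<lambda>x. e2 x - e3 x + e1 x * (1 - 2 * ln (ln x))) \<in> O[at_top](EL)"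
    unfolding e2_def e3_def by (intro sum_in_bigo S2sum_asymp lam_square_partial_asymp)
  then have "(\<lambda>x. Y x * (e2 x - e3 x + e1 x * (1 - 2 * ln (ln x)))) \<in> O[at_top](\<lambda>x. Y x * EL x)"
    by (intro landau_o.big.mult) auto
  then have 4: "(\<lambda>x. gamma0 h * (Y x * (e2 x - e3 x + e1 x * (1 - 2 * ln (ln x))))) \<in> O[at_top](\<lambda>x. Y x * EL x)"
    using gamma0_pos by (subst landau_o.big.cmult_in_iff) auto
  show ?thesis unfolding eq by (intro sum_in_bigo(1) 1 2 3 4)
qed

end

section \<open>Normal order\<close>

context h_full_setting
begin

definition moment :: "real \<Rightarrow> real" where
  "moment x = (\<Sum>n\<in>h_full_upto h x. (real (omega n) - loglog (real n))\<^sup>2)"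

lemma h_full_ge_4:
  assumes "h_full h n" "n \<noteq> 1"
  shows "4 \<le> n"
proof -
  have "0 < n" using assms by (simp add: h_full_def)
  then obtain p where p: "prime p" "p dvd n" using assms(2) prime_factor_nat by blast
  have "p ^ h dvd n"
    using assms(1) p \<open>0 < n\<close> by (intro multiplicity_dvd') (auto simp: h_full_def prime_factors_dvd)
  then have "p ^ h \<le> n" using \<open>0 < n\<close> by (intro dvd_imp_le)
  moreover have "2 ^ 2 \<le> p ^ h"
    using h prime_ge_2_nat[OF p(1)] by (intro order.trans[OF power_increasing power_mono]) auto
  ultimately show ?thesis by simp
qed

lemma one_le_ln_nat:
  assumes "4 \<le> (n::nat)"
  shows "1 < ln (real n)"
proof -
  have "exp 1 < real n" using exp_le assms by (intro le_less_trans[of "exp 1" 3]) auto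
  then show ?thesis using assms by (metis exp_gt_zero ln_exp ln_less_cancel_iff less_trans)
qed

lemma loglog_nonneg:
  assumes "h_full h n"
  shows "0 \<le> loglog (real n)"
proof (cases "n = 1")
  case False
  then have "1 < ln (real n)" using one_le_ln_nat[OF h_full_ge_4[OF assms]] by simp
  then show ?thesis by (simp add: loglog_def)
qed (simp add: loglog_def)

lemma loglog_le:
  assumes "h_full h n" "real n \<le> x" "3 \<le> x"
  shows "loglog (real n) \<le> ln (ln x)"
proof -
  have e: "exp 1 \<le> x" using exp_le assms by linarith
  then have "1 \<le> ln x" using assms by (subst ln_ge_iff) auto
  then have L: "0 \<le> ln (ln x)" by simp
  show ?thesis
  proof (cases "n = 1")
    case False
    then have n: "4 \<le> n" using h_full_ge_4[OF assms(1)] by simp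
    then have "1 < ln (real n)" by (rule one_le_ln_nat)
    moreover have "ln (real n) \<le> ln x" using n assms by (subst ln_le_cancel_iff) auto
    ultimately show ?thesis by (simp add: loglog_def)
  qed (use L in \<open>simp add: loglog_def\<close>)
qed

text \<open>For \<open>n \<ge> sqrt x\<close> the mean value bound gives
  \<open>2 * ln (x / n) / ln x\<close>. For smaller \<open>n\<close>, including 1, the crude bound
  \<open>ln x\<close> suffices, because
  \<open>(x / n) powr \<delta> \<ge> x powr (\<delta> / 2)\<close> beats \<open>(ln x)^2\<close> up
  to the constant \<open>16 / \<delta>^2\<close>.\<close>

lemma loglog_diff_le:
  assumes n: "h_full h n" "real n \<le> x" and x: "3 \<le> x" and \<delta>: "0 < \<delta>"
  shows "ln (ln x) - loglog (real n) \<le> (2 / \<delta> + 16 / \<delta>\<^sup>2) * ((x / real n) powr \<delta> / ln x)"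
proof -
  have "exp 1 \<le> x" using exp_le x by linarith
  then have lx: "1 \<le> ln x" using x by (subst ln_ge_iff) auto
  have n1: "1 \<le> n" using n by (simp add: h_full_def Suc_le_eq)
  have q0: "0 \<le> (x / real n) powr \<delta> / ln x" using lx by simp
  show ?thesis
  proof (cases "n \<noteq> 1 \<and> sqrt x \<le> real n")
    case True
    then have n4: "4 \<le> n" using h_full_ge_4[OF n(1)] by simp
    then have ln1: "1 < ln (real n)" by (rule one_le_ln_nat)
    have "ln (sqrt x) \<le> ln (real n)" using True x n4 by (subst ln_le_cancel_iff) auto
    then have half: "ln x / 2 \<le> ln (real n)" using x by (simp add: ln_sqrt)
    have le: "ln (real n) \<le> ln x" using n n4 by (subst ln_le_cancel_iff) auto
    have "ln (ln x) - loglog (real n) \<le> (ln x - ln (real n)) / ln (real n)"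
      unfolding loglog_def using ln1 le by (intro ln_diff_bounds) auto
    also have "\<dots> \<le> (ln x - ln (real n)) / (ln x / 2)"
      using half lx le ln1 by (intro divide_left_mono) auto
    also have "\<dots> = 2 / ln x * ln (x / real n)" using x n4 by (simp add: ln_div)
    also have "\<dots> \<le> 2 / ln x * ((x / real n) powr \<delta> / \<delta>)"
      using \<delta> lx n n4 by (intro mult_left_mono ln_powr_bound) (auto simp: field_simps)
    also have "\<dots> = 2 / \<delta> * ((x / real n) powr \<delta> / ln x)" by simp
    also have "\<dots> \<le> (2 / \<delta> + 16 / \<delta>\<^sup>2) * ((x / real n) powr \<delta> / ln x)"
      using \<delta> q0 by (intro mult_right_mono) auto
    finally show ?thesis .
  next
    case False
    have sx: "1 \<le> sqrt x" using x by simp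
    have nsx: "real n \<le> sqrt x" using False sx by auto
    have "x / sqrt x \<le> x / real n" using nsx n1 x by (intro divide_left_mono) auto
    then have "sqrt x \<le> x / real n" using x by (simp add: real_div_sqrt)
    then have "sqrt x powr \<delta> \<le> (x / real n) powr \<delta>" using \<delta> x by (intro powr_mono2) auto
    moreover have "sqrt x powr \<delta> = x powr (\<delta> / 2)" using x by (simp add: powr_half_sqrt[symmetric] powr_powr)
    ultimately have p: "x powr (\<delta> / 2) \<le> (x / real n) powr \<delta>" by simp
    have l: "ln x \<le> x powr (\<delta> / 4) / (\<delta> / 4)" using x \<delta> by (intro ln_powr_bound) auto
    have "ln x * ln x \<le> (x powr (\<delta> / 4) / (\<delta> / 4)) * (x powr (\<delta> / 4) / (\<delta> / 4))"
      using l lx by (intro mult_mono) auto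
    also have "\<dots> = 16 / \<delta>\<^sup>2 * (x powr (\<delta> / 4) * x powr (\<delta> / 4))" by (simp add: power2_eq_square)
    also have "x powr (\<delta> / 4) * x powr (\<delta> / 4) = x powr (\<delta> / 2)" by (simp add: powr_add[symmetric])
    also have "16 / \<delta>\<^sup>2 * x powr (\<delta> / 2) \<le> 16 / \<delta>\<^sup>2 * (x / real n) powr \<delta>" using p by (intro mult_left_mono) auto
    finally have "ln x \<le> 16 / \<delta>\<^sup>2 * (x / real n) powr \<delta> / ln x" using lx by (subst pos_le_divide_eq) auto
    moreover have "ln (ln x) \<le> ln x" using lx ln_le_minus_one[of "ln x"] by simp
    moreover have "0 \<le> loglog (real n)" by (rule loglog_nonneg[OF n(1)])
    ultimately have "ln (ln x) - loglog (real n) \<le> 16 / \<delta>\<^sup>2 * (x / real n) powr \<delta> / ln x" by linarith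
    also have "\<dots> = 16 / \<delta>\<^sup>2 * ((x / real n) powr \<delta> / ln x)" by simp
    also have "\<dots> \<le> (2 / \<delta> + 16 / \<delta>\<^sup>2) * ((x / real n) powr \<delta> / ln x)"
      using \<delta> q0 by (intro mult_right_mono) auto
    finally show ?thesis .
  qed
qed

lemma count_upto_le: "1 \<le> x \<Longrightarrow> count_upto x \<le> gamma0 h * Y x"
  using count_le'[of x "{}"] by (simp add: count_upto_eq)

lemma omega_sum_le:
  assumes "1 \<le> x"
  shows "omega_sum x \<le> gamma0 h * Y x * Asum (Y x)"
proof -
  have "omega_sum x \<le> (\<Sum>p\<in>primes_upto (Y x). gamma0 h * Y x * lam h p)"
    unfolding omega_sum_eq[OF assms]
  proof (rule sum_mono)
    fix p assume "p \<in> primes_upto (Y x)"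
    then show "real (h_full_count h {p} x) \<le> gamma0 h * Y x * lam h p"
      using count_le'[of x "{p}"] assms by (simp add: primes_upto_def)
  qed
  then show ?thesis by (simp add: lam_sum_eq sum_distrib_left[symmetric])
qed

text \<open>A difference of squares is \<open>L - l\<close> times at most
  \<open>2 * (\<omega> + L)\<close>, where \<open>l = loglog n\<close>. The first factor is a small
  power of \<open>x / n\<close> divided by \<open>ln x\<close>, and by dyadic summation this power
  does not change the order of the sum over \<open>n\<close>.\<close>

lemma moment_minus_fixed_moment_le:
  shows "\<exists>K. \<forall>x\<ge>3. \<bar>moment x - fixed_moment x\<bar> \<le> K * (Y x * (Asum (Y x) + ln (ln x)) / ln x)"
proof -
  interpret L: mertens_weight "lam_weight h" lam_C by (rule mertens_weight_lam')
  \<comment> \<open>The dyadic estimate requires \<open>\<delta>\<close> below the growth exponent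
    \<open>1 / h\<close> of the h-full numbers; half of it is taken.\<close>
  define \<delta> where "\<delta> = 1 / (2 * real h)"
  have \<delta>: "0 < \<delta>" "\<delta> < 1 / real h" using h by (auto simp: \<delta>_def field_simps)
  define D where "D = 2 / \<delta> + 16 / \<delta>\<^sup>2"
  define D' where "D' = 2 powr \<delta> / (1 - 2 powr (\<delta> - 1 / real h))"
  have D: "0 < D" using \<delta> by (simp add: D_def add_pos_pos)
  have "\<bar>moment x - fixed_moment x\<bar> \<le> 2 * D * D' * gamma0 h * (Y x * (Asum (Y x) + ln (ln x)) / ln x)" if x: "3 \<le> x" for x
  proof -
    define L where "L = ln (ln x)"
    have "exp 1 \<le> x" using exp_le x by linarith
    then have lx: "1 \<le> ln x" using x by (subst ln_ge_iff) auto
    then have L: "0 \<le> L" by (simp add: L_def)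
    have "\<bar>moment x - fixed_moment x\<bar> \<le> (\<Sum>n\<in>h_full_upto h x. \<bar>(real (omega n) - loglog (real n))\<^sup>2 - (real (omega n) - L)\<^sup>2\<bar>)"
      unfolding moment_def fixed_moment_def L_def sum_subtractf[symmetric] by (rule sum_abs)
    also have "\<dots> \<le> (\<Sum>n\<in>h_full_upto h x. 2 * D / ln x * ((x / real n) powr \<delta> * (real (omega n) + L)))"
    proof (rule sum_mono)
      fix n assume "n \<in> h_full_upto h x"
      then have n: "h_full h n" "real n \<le> x" by (auto simp: h_full_upto_def)
      define l where "l = loglog (real n)"
      have l: "0 \<le> l" "l \<le> L" using loglog_nonneg[OF n(1)] loglog_le[OF n x] by (auto simp: l_def L_def)
      have "(real (omega n) - l)\<^sup>2 - (real (omega n) - L)\<^sup>2 = (L - l) * (2 * real (omega n) - l - L)"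
        by (simp add: power2_eq_square algebra_simps)
      then have "\<bar>(real (omega n) - l)\<^sup>2 - (real (omega n) - L)\<^sup>2\<bar> = (L - l) * \<bar>2 * real (omega n) - l - L\<bar>"
        using l by (simp add: abs_mult)
      also have "\<dots> \<le> (D * ((x / real n) powr \<delta> / ln x)) * (2 * (real (omega n) + L))"
        using loglog_diff_le[OF n x \<delta>(1)] l L lx D
        by (intro mult_mono) (auto simp: L_def l_def D_def)
      also have "\<dots> = 2 * D / ln x * ((x / real n) powr \<delta> * (real (omega n) + L))" by simp
      finally show "\<bar>(real (omega n) - loglog (real n))\<^sup>2 - (real (omega n) - L)\<^sup>2\<bar> \<le> 2 * D / ln x * ((x / real n) powr \<delta> * (real (omega n) + L))"
        by (simp add: l_def)
    qed
    also have "\<dots> = 2 * D / ln x * (\<Sum>n\<in>h_full_upto h x. (x / real n) powr \<delta> * (real (omega n) + L))"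
      by (simp only: sum_distrib_left)
    finally have 1: "\<bar>moment x - fixed_moment x\<bar> \<le> 2 * D / ln x * (\<Sum>n\<in>h_full_upto h x. (x / real n) powr \<delta> * (real (omega n) + L))" .
    have 2: "(\<Sum>n\<in>h_full_upto h x. (x / real n) powr \<delta> * (real (omega n) + L))
       \<le> 2 powr \<delta> / (1 - 2 powr (\<delta> - 1 / real h)) * (gamma0 h * (Asum (Y x) + L) * x powr (1 / real h))"
    proof (rule powr_weighted_sum_le)
      fix t :: real assume t: "1 \<le> t" "t \<le> x"
      have e: "{n \<in> h_full_upto h x. real n \<le> t} = h_full_upto h t" using t by (auto simp: h_full_upto_def)
      have Yt: "Y t \<le> Y x" unfolding Y_def using t by (intro powr_mono2) auto
      have "(\<Sum>n\<in>h_full_upto h t. real (omega n) + L) = omega_sum t + count_upto t * L"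
        by (simp add: sum.distrib omega_sum_def count_upto_def)
      also have "\<dots> \<le> gamma0 h * Y t * Asum (Y t) + gamma0 h * Y t * L"
        using L t by (intro add_mono omega_sum_le mult_right_mono count_upto_le) auto
      also have "\<dots> \<le> gamma0 h * Y t * Asum (Y x) + gamma0 h * Y t * L"
        using L.A_mono[OF Yt] gamma0_pos Y_ge_1[OF t(1)] by (intro add_mono mult_left_mono) auto
      also have "\<dots> = gamma0 h * (Asum (Y x) + L) * t powr (1 / real h)" by (simp add: Y_def algebra_simps)
      finally show "(\<Sum>n\<in>{n \<in> h_full_upto h x. real n \<le> t}. real (omega n) + L) \<le> gamma0 h * (Asum (Y x) + L) * t powr (1 / real h)"
        unfolding e .
    qed (use \<delta> x L gamma0_pos L.A_nonneg in \<open>auto simp: h_full_upto_def h_full_def\<close>)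
    have "0 \<le> 2 * D / ln x" using D lx by simp
    from order.trans[OF 1 mult_left_mono[OF 2 this]]
    have "\<bar>moment x - fixed_moment x\<bar> \<le> 2 * D / ln x * (D' * (gamma0 h * (Asum (Y x) + L) * Y x))"
      by (simp only: D'_def Y_def)
    then show ?thesis by (simp add: L_def mult_ac)
  qed
  then show ?thesis by blast
qed

theorem moment_asymp:
  "(\<lambda>x. moment x - gamma0 h * Y x * (ln (ln x) + D2 h)) \<in> O[at_top](\<lambda>x. Y x * EL x)"
proof -
  obtain K where K: "\<And>x. 3 \<le> x \<Longrightarrow> \<bar>moment x - fixed_moment x\<bar> \<le> K * (Y x * (Asum (Y x) + ln (ln x)) / ln x)"
    using moment_minus_fixed_moment_le by auto
  have A: "(\<lambda>x. Asum (Y x)) \<in> O[at_top](\<lambda>x. ln (ln x))"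
  proof -
    have "(\<lambda>x. Asum (Y x) - (ln (ln x) + D1 h)) \<in> O[at_top](\<lambda>x. ln (ln x))"
      using Asum_asymp by (rule landau_o.big.trans) real_asymp
    moreover have "(\<lambda>x. ln (ln x) + D1 h) \<in> O[at_top](\<lambda>x. ln (ln x))" by real_asymp
    ultimately have "(\<lambda>x. (Asum (Y x) - (ln (ln x) + D1 h)) + (ln (ln x) + D1 h)) \<in> O[at_top](\<lambda>x. ln (ln x))"
      by (rule sum_in_bigo)
    then show ?thesis by simp
  qed
  have "(\<lambda>x. moment x - fixed_moment x) \<in> O[at_top](\<lambda>x. Y x * ((Asum (Y x) + ln (ln x)) / ln x))"
  proof (rule bigoI[where c = "\<bar>K\<bar>"])
    show "\<forall>\<^sub>F x in at_top. norm (moment x - fixed_moment x) \<le> \<bar>K\<bar> * norm (Y x * ((Asum (Y x) + ln (ln x)) / ln x))"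
      using eventually_ge_at_top[of 3]
    proof eventually_elim
      case (elim x)
      have "\<bar>moment x - fixed_moment x\<bar> \<le> K * (Y x * ((Asum (Y x) + ln (ln x)) / ln x))" using K[OF elim] by simp
      also have "\<dots> \<le> \<bar>K * (Y x * ((Asum (Y x) + ln (ln x)) / ln x))\<bar>" by (rule abs_ge_self)
      finally show ?case by (simp only: abs_mult real_norm_def)
    qed
  qed
  also have "(\<lambda>x. Y x * ((Asum (Y x) + ln (ln x)) / ln x)) \<in> O[at_top](\<lambda>x. Y x * EL x)"
  proof -
    have "(\<lambda>x. (Asum (Y x) + ln (ln x)) * (1 / ln x)) \<in> O[at_top](\<lambda>x. ln (ln x) * (1 / ln x))"
      by (intro landau_o.big.mult sum_in_bigo A) auto
    then have "(\<lambda>x. (Asum (Y x) + ln (ln x)) / ln x) \<in> O[at_top](EL)" by simp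
    then show ?thesis by (rule landau_o.big.mult[OF landau_o.big_refl])
  qed
  finally have "(\<lambda>x. moment x - fixed_moment x) \<in> O[at_top](\<lambda>x. Y x * EL x)" .
  from sum_in_bigo(1)[OF this fixed_moment_asymp] show ?thesis by simp
qed

section \<open>Large deviations of omega\<close>

lemma moment_bigo: "moment \<in> O[at_top](\<lambda>x. Y x * ln (ln x))"
proof -
  have "(\<lambda>x. Y x * EL x) \<in> O[at_top](\<lambda>x. Y x * ln (ln x))" unfolding Y_def using h by real_asymp
  from landau_o.big.trans[OF moment_asymp this]
  have 1: "(\<lambda>x. moment x - gamma0 h * Y x * (ln (ln x) + D2 h)) \<in> O[at_top](\<lambda>x. Y x * ln (ln x))" .
  have "(\<lambda>x. ln (ln x) + D2 h) \<in> O[at_top](\<lambda>x. ln (ln x))" by real_asymp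
  then have "(\<lambda>x. gamma0 h * Y x * (ln (ln x) + D2 h)) \<in> O[at_top](\<lambda>x. Y x * ln (ln x))"
    using gamma0_pos by (intro landau_o.big.mult) auto
  from sum_in_bigo(1)[OF 1 this] show ?thesis by simp
qed

text \<open>The count is \<open>gamma0 h * Y x\<close> up to a smaller power, and
  \<open>gamma0 h\<close> is positive, so what is negligible against \<open>Y\<close> is negligible
  against the number of h-full integers.\<close>

lemma Y_bigo_count: "(\<lambda>x. Y x) \<in> O[at_top](count_upto)"
proof -
  have "(\<lambda>x. Y x powr \<theta>) \<in> o[at_top](\<lambda>x. Y x)"
  proof -
    have "(\<lambda>y::real. y powr \<theta>) \<in> o[at_top](\<lambda>y. y)" using \<theta> by real_asymp
    from landau_o.small.compose[OF this filterlim_Y] show ?thesis .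
  qed
  from landau_o.big_small_trans[OF count_upto_asymp this]
  have "(\<lambda>x. count_upto x - gamma0 h * Y x) \<in> o[at_top](\<lambda>x. Y x)" .
  then have "\<forall>\<^sub>F x in at_top. norm (count_upto x - gamma0 h * Y x) \<le> gamma0 h / 2 * norm (Y x)"
    using gamma0_pos by (intro landau_o.smallD) auto
  then have "\<forall>\<^sub>F x in at_top. norm (Y x) \<le> 2 / gamma0 h * norm (count_upto x)"
    using eventually_ge_at_top[of 1]
  proof eventually_elim
    case (elim x)
    have "\<bar>count_upto x - gamma0 h * Y x\<bar> \<le> gamma0 h / 2 * Y x" using elim Y_ge_1[of x] by simp
    then have "gamma0 h / 2 * Y x \<le> count_upto x" unfolding abs_le_iff by linarith
    then have "Y x \<le> 2 / gamma0 h * count_upto x" using gamma0_pos by (simp add: field_simps)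
    then show ?case using Y_ge_1[of x] elim by (simp add: count_upto_def)
  qed
  then show ?thesis by (rule bigoI)
qed

text \<open>Chebyshev's inequality, with the \<open>n \<le> \<surd>x\<close> discarded because there \<open>log log n\<close> may be far from \<open>log log x\<close>.\<close>

lemma exceptional_set:
  fixes G :: "real \<Rightarrow> real" and B :: "real \<Rightarrow> nat set"
  assumes G: "filterlim G at_top at_top"
    and B: "\<forall>\<^sub>F x in at_top. \<forall>n\<in>B x. n \<in> h_full_upto h x \<and>
      (sqrt x < real n \<longrightarrow> G x * ln (ln x) \<le> (real (omega n) - loglog (real n))\<^sup>2)"
  shows "(\<lambda>x. real (card (B x))) \<in> o[at_top](count_upto)"
proof -
  obtain c where c: "c > 0" "\<forall>\<^sub>F x in at_top. norm (moment x) \<le> c * norm (Y x * ln (ln x))"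
    using landau_o.bigE[OF moment_bigo] by auto
  \<comment> \<open>The first term counts the discarded \<open>n\<close>; the second is the bound
    for the second moment divided by the threshold \<open>G x * ln (ln x)\<close>.\<close>
  define H where "H = (\<lambda>x. gamma0 h * Y (sqrt x) + c * (Y x / G x))"
  have "(\<lambda>x. real (card (B x))) \<in> O[at_top](H)"
  proof (rule landau_o.big_mono)
    have "\<forall>\<^sub>F x::real in at_top. 0 < ln (ln x)" by real_asymp
    moreover have "\<forall>\<^sub>F x in at_top. 0 < G x" using G by (simp add: filterlim_at_top_dense)
    ultimately show "\<forall>\<^sub>F x in at_top. norm (real (card (B x))) \<le> norm (H x)"
      using B c(2) eventually_ge_at_top[of 1]
    proof eventually_elim
      case (elim x)
      define B1 where "B1 = {n \<in> B x. sqrt x < real n}"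
      have sx: "1 \<le> sqrt x" using elim by simp
      have sub: "B x \<subseteq> h_full_upto h x" using elim by blast
      have fin: "finite (B x)" by (rule finite_subset[OF sub]) simp
      have "B x \<subseteq> h_full_upto h (sqrt x) \<union> B1" using sub by (auto simp: B1_def h_full_upto_def)
      then have "card (B x) \<le> card (h_full_upto h (sqrt x)) + card B1"
        using fin by (intro order.trans[OF card_mono card_Un_le]) (auto simp: B1_def)
      moreover have "real (card (h_full_upto h (sqrt x))) \<le> gamma0 h * Y (sqrt x)" using count_upto_le[OF sx] by (simp add: count_upto_def)
      moreover have "real (card B1) \<le> c * (Y x / G x)"
      proof -
        have "real (card B1) * (G x * ln (ln x)) = (\<Sum>n\<in>B1. G x * ln (ln x))" by simp
        also have "\<dots> \<le> (\<Sum>n\<in>B1. (real (omega n) - loglog (real n))\<^sup>2)"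
          using elim by (intro sum_mono) (auto simp: B1_def)
        also have "\<dots> \<le> moment x" unfolding moment_def using sub by (intro sum_mono2) (auto simp: B1_def)
        also have "\<dots> \<le> c * (Y x * ln (ln x))" using elim Y_ge_1[of x] by simp
        also have "\<dots> = c * (Y x / G x) * (G x * ln (ln x))" using elim by simp
        finally show ?thesis using elim by (simp only: mult_le_cancel_right) auto
      qed
      ultimately have "real (card (B x)) \<le> H x" unfolding H_def by linarith
      then show ?case by simp
    qed
  qed
  also have "H \<in> o[at_top](\<lambda>x. Y x)"
  proof -
    have "(\<lambda>x. Y (sqrt x)) \<in> o[at_top](\<lambda>x. Y x)" unfolding Y_def using h by real_asymp
    moreover have "(\<lambda>x. Y x / G x) \<in> o[at_top](\<lambda>x. Y x)"
    proof -
      have "((\<lambda>x. inverse (G x)) \<longlongrightarrow> 0) at_top" using G by (rule tendsto_inverse_0_at_top)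
      then have "(\<lambda>x. inverse (G x)) \<in> o[at_top](\<lambda>_. 1)" by (intro smalloI_tendsto) auto
      then have "(\<lambda>x. Y x * inverse (G x)) \<in> o[at_top](\<lambda>x. Y x * 1)" by (intro landau_o.big_small_mult) auto
      then show ?thesis by (simp add: divide_inverse)
    qed
    ultimately show ?thesis
      unfolding H_def using gamma0_pos c(1) by (intro sum_in_smallo) (simp_all del: times_divide_eq_right)
  qed
  also note Y_bigo_count
  finally show ?thesis .
qed

text \<open>\<open>ln n \<ge> ln x / 2 \<ge> sqrt (ln x)\<close> as soon as
  \<open>ln x \<ge> 4\<close>, and the logarithm of \<open>sqrt (ln x)\<close> is
  \<open>ln (ln x) / 2\<close>.\<close>

lemma loglog_ge_half:
  assumes "sqrt x < real n" "exp 4 \<le> x"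
  shows "ln (ln x) / 2 \<le> loglog (real n)"
proof -
  have lx: "4 \<le> ln x" using assms by (subst ln_ge_iff) (auto intro: less_le_trans[OF exp_gt_zero])
  have x0: "0 < x" using assms(2) exp_gt_zero[of 4] by linarith
  then have "0 < sqrt x" by simp
  then have "ln (sqrt x) \<le> ln (real n)" using assms by (subst ln_le_cancel_iff) linarith+
  then have "ln x / 2 \<le> ln (real n)" using x0 by (simp add: ln_sqrt)
  moreover have "sqrt (ln x) \<le> ln x / 2"
    using lx by (intro real_le_lsqrt) (auto simp: power2_eq_square)
  ultimately have "sqrt (ln x) \<le> ln (real n)" by linarith
  moreover have "0 < sqrt (ln x)" using lx by simp
  ultimately have "ln (sqrt (ln x)) \<le> ln (ln (real n))" by (subst ln_le_cancel_iff) linarith+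
  then show ?thesis using lx by (simp add: ln_sqrt loglog_def)
qed

theorem few_large_deviations:
  assumes g: "filterlim g at_top at_top"
  shows "(\<lambda>x. real (card {n\<in>h_full_upto h x. \<bar>real (omega n) - loglog (real n)\<bar> / sqrt (loglog (real n)) \<ge> g x}))
     \<in> o[at_top](\<lambda>x. real (card (h_full_upto h x)))"
proof -
  \<comment> \<open>The squared deviation is at least \<open>(g x)^2 * loglog n\<close>, and
    \<open>loglog n \<ge> ln (ln x) / 2\<close> for \<open>n > sqrt x\<close>; this is the factor
    1/2.\<close>
  have "filterlim (\<lambda>x. (1 / 2) * (g x * g x)) at_top at_top"
    by (intro filterlim_tendsto_pos_mult_at_top[OF tendsto_const] filterlim_at_top_mult_at_top g) auto
  from exceptional_set[OF this]
  have "(\<lambda>x. real (card {n\<in>h_full_upto h x. \<bar>real (omega n) - loglog (real n)\<bar> / sqrt (loglog (real n)) \<ge> g x})) \<in> o[at_top](count_upto)"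
  proof this
    have "\<forall>\<^sub>F x::real in at_top. 0 < ln (ln x)" by real_asymp
    moreover have "\<forall>\<^sub>F x in at_top. 0 < g x" using g by (simp add: filterlim_at_top_dense)
    ultimately show "\<forall>\<^sub>F x in at_top. \<forall>n\<in>{n\<in>h_full_upto h x. \<bar>real (omega n) - loglog (real n)\<bar> / sqrt (loglog (real n)) \<ge> g x}.
      n \<in> h_full_upto h x \<and> (sqrt x < real n \<longrightarrow> (1 / 2) * (g x * g x) * ln (ln x) \<le> (real (omega n) - loglog (real n))\<^sup>2)"
      using eventually_ge_at_top[of "exp 4"]
    proof eventually_elim
      case (elim x)
      have "(1 / 2) * (g x * g x) * ln (ln x) \<le> (real (omega n) - loglog (real n))\<^sup>2"
        if n: "\<bar>real (omega n) - loglog (real n)\<bar> / sqrt (loglog (real n)) \<ge> g x" "sqrt x < real n" for n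
      proof -
        define l where "l = loglog (real n)"
        have l: "ln (ln x) / 2 \<le> l" unfolding l_def using n elim by (intro loglog_ge_half) auto
        then have l0: "0 < l" using elim by linarith
        have "g x * sqrt l \<le> \<bar>real (omega n) - l\<bar>" using n(1) l0 by (simp add: l_def field_simps)
        then have "(g x * sqrt l)\<^sup>2 \<le> \<bar>real (omega n) - l\<bar>\<^sup>2" using elim l0 by (intro power_mono) auto
        then have "g x * g x * l \<le> (real (omega n) - l)\<^sup>2" using l0 by (simp add: power_mult_distrib power2_eq_square[of "g x"])
        moreover have "g x * g x * (ln (ln x) / 2) \<le> g x * g x * l" using l by (intro mult_left_mono) auto
        ultimately show ?thesis by (simp add: l_def)
      qed
      then show ?case by blast
    qed
  qed
  then show ?thesis by (simp add: count_upto_def[abs_def])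
qed

theorem omega_has_normal_order: "has_normal_order (\<lambda>n. real (omega n)) (\<lambda>n. loglog (real n)) {n. h_full h n}"
  unfolding has_normal_order_def
proof (intro conjI allI impI ballI)
  show "0 \<le> loglog (real n)" if "n \<in> {n. h_full h n}" for n using that loglog_nonneg by simp
  show "mono_on {n. h_full h n} (\<lambda>n. loglog (real n))"
  proof (rule mono_onI)
    fix m n assume mn: "m \<in> {n. h_full h n}" "n \<in> {n. h_full h n}" "m \<le> n"
    show "loglog (real m) \<le> loglog (real n)"
    proof (cases "m = 1")
      case True
      then show ?thesis using loglog_nonneg[of n] mn by (simp add: loglog_def)
    next
      case False
      then have m: "4 \<le> m" using h_full_ge_4 mn by simp
      then have "n \<noteq> 1" using mn by simp
      then show ?thesis using loglog_le[of m "real n"] mn m by (simp add: loglog_def)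
    qed
  qed
  fix \<epsilon> :: real assume \<epsilon>: "0 < \<epsilon>"
  let ?B = "\<lambda>x. {n\<in>{n. h_full h n}. real n \<le> x \<and> \<not> ((1 - \<epsilon>) * loglog (real n) \<le> real (omega n) \<and> real (omega n) \<le> (1 + \<epsilon>) * loglog (real n))}"
  \<comment> \<open>A violation means a deviation of at least
    \<open>\<epsilon> * loglog n \<ge> \<epsilon> * ln (ln x) / 2\<close>. Its square is
    \<open>\<epsilon>^2 / 4 * ln (ln x)\<close> times \<open>ln (ln x)\<close>, so this first factor
    can serve as \<open>G\<close>.\<close>
  have "filterlim (\<lambda>x::real. \<epsilon>\<^sup>2 / 4 * ln (ln x)) at_top at_top" using \<epsilon> by real_asymp
  from exceptional_set[OF this, of ?B]
  have "(\<lambda>x. real (card (?B x))) \<in> o[at_top](count_upto)"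
  proof this
    have "\<forall>\<^sub>F x::real in at_top. 0 < ln (ln x)" by real_asymp
    then show "\<forall>\<^sub>F x in at_top. \<forall>n\<in>?B x. n \<in> h_full_upto h x \<and> (sqrt x < real n \<longrightarrow> \<epsilon>\<^sup>2 / 4 * ln (ln x) * ln (ln x) \<le> (real (omega n) - loglog (real n))\<^sup>2)"
      using eventually_ge_at_top[of "exp 4"]
    proof eventually_elim
      case (elim x)
      have "\<epsilon>\<^sup>2 / 4 * ln (ln x) * ln (ln x) \<le> (real (omega n) - loglog (real n))\<^sup>2"
        if n: "\<not> ((1 - \<epsilon>) * loglog (real n) \<le> real (omega n) \<and> real (omega n) \<le> (1 + \<epsilon>) * loglog (real n))" "sqrt x < real n" for n
      proof -
        define l where "l = loglog (real n)"
        have l: "ln (ln x) / 2 \<le> l" unfolding l_def using n elim by (intro loglog_ge_half) auto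
        have "\<epsilon> * (ln (ln x) / 2) \<le> \<epsilon> * l" using l \<epsilon> by (intro mult_left_mono) auto
        also have "\<dots> \<le> \<bar>real (omega n) - l\<bar>" using n(1) by (auto simp: l_def algebra_simps)
        finally have "(\<epsilon> * (ln (ln x) / 2))\<^sup>2 \<le> \<bar>real (omega n) - l\<bar>\<^sup>2" using \<epsilon> elim by (intro power_mono) auto
        then show ?thesis by (simp add: l_def power2_eq_square mult_ac)
      qed
      then show ?case by (auto simp: h_full_upto_def)
    qed
  qed
  then show "(\<lambda>x. real (card (?B x))) \<in> o[at_top](\<lambda>x. real (card {n\<in>{n. h_full h n}. real n \<le> x}))"
    by (simp add: count_upto_def[abs_def] h_full_upto_def)
qed auto

text \<open>The asymptotics settle all \<open>x\<close> beyond some \<open>X'\<close>. On the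
  remaining bounded range the left side is bounded, so a positive lower bound for the right side
  suffices. \<open>loglog x\<close> vanishes at \<open>x = exp 1\<close>, where the left side need
  not; keeping the distance \<open>\<delta>\<close> from this point supplies the lower bound, and
  \<open>C\<close> depends on it.\<close>

theorem moment_bound:
  assumes \<delta>: "0 < \<delta>"
  shows "\<exists>C. \<forall>x::real. x > 2 \<and> \<bar>x - exp 1\<bar> \<ge> \<delta> \<longrightarrow>
            \<bar>moment x - (gamma0 h * x powr (1 / real h) * loglog x + D2 h * gamma0 h * x powr (1 / real h))\<bar>
            \<le> C * (x powr (1 / real h) * \<bar>loglog x\<bar> / ln x)"
proof -
  define Er where "Er = (\<lambda>x. moment x - (gamma0 h * x powr (1 / real h) * loglog x + D2 h * gamma0 h * x powr (1 / real h)))"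
  define F where "F = (\<lambda>x. x powr (1 / real h) * \<bar>loglog x\<bar> / ln x)"
  have Er: "Er x = moment x - gamma0 h * Y x * (ln (ln x) + D2 h)" for x
    by (simp add: Er_def Y_def loglog_def algebra_simps)
  obtain c X where c: "c > 0" "\<And>x. X \<le> x \<Longrightarrow> norm (Er x) \<le> c * norm (Y x * EL x)"
    using landau_o.bigE[OF moment_asymp] unfolding Er[symmetric] eventually_at_top_linorder by metis
  define X' where "X' = max X 3"
  have F0: "0 \<le> F x" if "2 < x" for x using that by (auto simp: F_def)
  have large: "\<bar>Er x\<bar> \<le> c * F x" if "X' \<le> x" for x
  proof -
    have "norm (Y x * EL x) = F x" using that by (simp add: F_def Y_def loglog_def X'_def abs_mult)
    then show ?thesis using c(2)[of x] that by (simp add: X'_def)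
  qed
  \<comment> \<open>\<open>moment\<close> increases with \<open>x\<close>, and
    \<open>Y x \<le> x \<le> X'\<close>, so the values at the right end bound everything.\<close>
  define b where "b = (moment X' + gamma0 h * X' * (max \<bar>ln (ln 2)\<bar> \<bar>ln (ln X')\<bar> + \<bar>D2 h\<bar>))"
  have small: "\<bar>Er x\<bar> \<le> b" if x: "2 < x" "x \<le> X'" for x
  proof -
    have "moment x \<le> moment X'" unfolding moment_def using x by (intro sum_mono2) (auto simp: h_full_upto_def)
    moreover have "0 \<le> moment x" unfolding moment_def by (intro sum_nonneg) auto
    moreover have "\<bar>gamma0 h * Y x * (ln (ln x) + D2 h)\<bar> \<le> gamma0 h * X' * (max \<bar>ln (ln 2)\<bar> \<bar>ln (ln X')\<bar> + \<bar>D2 h\<bar>)"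
    proof -
      have "Y x \<le> x powr 1" unfolding Y_def using x h by (intro powr_mono) auto
      then have Y: "0 \<le> Y x" "Y x \<le> X'" using x by (auto simp: Y_def)
      have "ln (ln 2) \<le> ln (ln x)" "ln (ln x) \<le> ln (ln X')" using x by auto
      then have "\<bar>ln (ln x) + D2 h\<bar> \<le> max \<bar>ln (ln 2)\<bar> \<bar>ln (ln X')\<bar> + \<bar>D2 h\<bar>" by linarith
      then show ?thesis unfolding abs_mult using Y gamma0_pos by (intro mult_mono) auto
    qed
    ultimately show ?thesis unfolding Er b_def by linarith
  qed
  \<comment> \<open>The cap keeps \<open>exp 1 - \<eta>\<close> above 1, so that
    \<open>ln (exp 1 - \<eta>)\<close> is positive and its logarithm is negative.\<close>
  define \<eta> where "\<eta> = min \<delta> (exp 1 / 4)"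
  have \<eta>: "0 < \<eta>" "\<eta> \<le> \<delta>" "\<eta> < exp 1 - 1"
    using \<delta> exp_ge_add_one_self[of 1] by (auto simp: \<eta>_def min_def)
  define m where "m = min (ln (ln (exp 1 + \<eta>))) (- ln (ln (exp 1 - \<eta>)))"
  have l1: "1 < ln (exp 1 + \<eta>)"
  proof -
    have "ln (exp 1) < ln (exp 1 + \<eta>)" using \<eta> exp_gt_zero[of 1] by (subst ln_less_cancel_iff) linarith+
    then show ?thesis by simp
  qed
  have l2: "ln (exp 1 - \<eta>) < 1" "0 < ln (exp 1 - \<eta>)"
  proof -
    have "ln (exp 1 - \<eta>) < ln (exp 1)" using \<eta> by (subst ln_less_cancel_iff) linarith+
    then show "ln (exp 1 - \<eta>) < 1" by simp
    show "0 < ln (exp 1 - \<eta>)" using \<eta> by simp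
  qed
  have m0: "0 < m" using l1 l2 by (simp add: m_def)
  have mle: "m \<le> \<bar>loglog x\<bar>" if x: "2 < x" "\<delta> \<le> \<bar>x - exp 1\<bar>" for x
  proof -
    consider "exp 1 + \<eta> \<le> x" | "x \<le> exp 1 - \<eta>" using x \<eta> by linarith
    then show ?thesis
    proof cases
      case 1
      then have "ln (exp 1 + \<eta>) \<le> ln x" using \<eta> exp_gt_zero[of 1] by (subst ln_le_cancel_iff) linarith+
      then have "ln (ln (exp 1 + \<eta>)) \<le> loglog x" unfolding loglog_def using l1 by (subst ln_le_cancel_iff) linarith+
      then show ?thesis unfolding m_def by linarith
    next
      case 2
      then have "ln x \<le> ln (exp 1 - \<eta>)" using x by (subst ln_le_cancel_iff) linarith+
      moreover have "0 < ln x" using x by simp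
      ultimately have "loglog x \<le> ln (ln (exp 1 - \<eta>))" unfolding loglog_def using l2 by (subst ln_le_cancel_iff) linarith+
      then show ?thesis unfolding m_def by linarith
    qed
  qed
  note m = m0 mle
  have "\<exists>C. \<forall>x::real. x > 2 \<and> \<bar>x - exp 1\<bar> \<ge> \<delta> \<longrightarrow> \<bar>Er x\<bar> \<le> C * F x"
  \<comment> \<open>On the bounded range \<open>F\<close> is at least \<open>m / ln X'\<close>, so
    \<open>\<bar>b\<bar> * (ln X' / m) * F x\<close> is at least
    \<open>\<bar>b\<bar>\<close>.\<close>
  proof (intro exI[of _ "c + \<bar>b\<bar> * (ln X' / m)"] allI impI)
    fix x :: real assume x: "x > 2 \<and> \<bar>x - exp 1\<bar> \<ge> \<delta>"
    show "\<bar>Er x\<bar> \<le> (c + \<bar>b\<bar> * (ln X' / m)) * F x"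
    proof (cases "X' \<le> x")
      case True
      have "0 \<le> \<bar>b\<bar> * (ln X' / m) * F x" using m F0[of x] x by (intro mult_nonneg_nonneg) (auto simp: X'_def)
      then show ?thesis using large[OF True] by (simp add: distrib_right)
    next
      case False
      have lx: "0 < ln x" "ln x \<le> ln X'" using x False by auto
      have "1 * m / ln X' \<le> x powr (1 / real h) * \<bar>loglog x\<bar> / ln x"
        using x m lx by (intro frac_le mult_mono) (auto intro: ge_one_powr_ge_zero)
      then have "m / ln X' \<le> F x" by (simp add: F_def)
      then have "\<bar>b\<bar> * (ln X' / m) * (m / ln X') \<le> \<bar>b\<bar> * (ln X' / m) * F x"
        using m lx by (intro mult_left_mono mult_nonneg_nonneg) auto
      moreover have "\<bar>b\<bar> * (ln X' / m) * (m / ln X') = \<bar>b\<bar>" using m lx by simp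
      moreover have "0 \<le> c * F x" using c F0[of x] x by simp
      ultimately show ?thesis using small[of x] False x by (simp add: distrib_right)
    qed
  qed
  then show ?thesis unfolding Er_def F_def .
qed

end

theorem theorem1p3:
  fixes h :: nat
  assumes "h \<ge> 2"
  shows "(\<forall>\<delta>>0. \<exists>C. \<forall>x::real. x > 2 \<and> \<bar>x - exp 1\<bar> \<ge> \<delta> \<longrightarrow>
            \<bar>(\<Sum>n\<in>h_full_upto h x. (real (omega n) - loglog (real n))\<^sup>2)
              - (gamma0 h * x powr (1 / real h) * loglog x + D2 h * gamma0 h * x powr (1 / real h))\<bar>
            \<le> C * (x powr (1 / real h) * \<bar>loglog x\<bar> / ln x))
       \<and> (\<forall>g::real \<Rightarrow> real. mono_on {2<..} g \<and> filterlim g at_top at_top \<longrightarrow>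
            (\<lambda>x. real (card {n\<in>h_full_upto h x.
               \<bar>real (omega n) - loglog (real n)\<bar> / sqrt (loglog (real n)) \<ge> g x}))
            \<in> o[at_top](\<lambda>x. real (card (h_full_upto h x))))
       \<and> has_normal_order (\<lambda>n. real (omega n)) (\<lambda>n. loglog (real n)) {n. h_full h n}"
proof -
  interpret h_full_setting h by unfold_locales fact
  show ?thesis
    using moment_bound[unfolded moment_def] few_large_deviations omega_has_normal_order by blast
qed

end
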